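(* Let $y_{0,1}$ be the first positive solution of $Y_0(x)=0$, and let $\sigma\in\mathbb{R}$. When $\varepsilon\le R$, $\lambda\le 1$ and $\omega_\varepsilon<y_{0,1}$, there holds $$\left\Vert u_\varepsilon^s(|x|=R)\right\Vert_{H^\sigma}\le (1-\lambda)\,\omega_\varepsilon\left(3\sqrt{\frac{\varepsilon}{R}}\left\Vert u^i(|x|=\varepsilon)\right\Vert_{H_*^{\sigma-1/3}}+9\,\omega_\varepsilon\,|u^i(0)|\,\left|H_0^{(1)}(\sqrt{q_0}\,\omega R)\right|\right).$$ Furthermore, if for some $p>0$ the first $p$ Fourier coefficients of $u^i\left(|x|=(\varepsilon\omega)^{-1}\right)$ (the restriction of $u^i$ to the circle of radius $(\varepsilon\omega)^{-1}$) are zero, then for all $\omega_\varepsilon<p$ there holds $$\left\Vert u_\varepsilon^s(|x|=R)\right\Vert_{H^\sigma}\le 3(1-\lambda)\,\omega_\varepsilon\sqrt{\frac{\varepsilon}{R}}\left\Vert u^i(|x|=\varepsilon)\right\Vert_{H_*^{\sigma-1/3}}.$$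
   Context: Setting: $\varepsilon,\omega,q,q_0>0$; $q_\varepsilon=q$ for $|x|<\varepsilon$ and $q_\varepsilon=q_0$ for $|x|>\varepsilon$ in $\mathbb{R}^2$; $\omega_\varepsilon=\sqrt{q_0}\,\omega\varepsilon$ and $\lambda=\sqrt{q/q_0}$. $(r,\theta)$ are polar coordinates; $J_n,Y_n$ are Bessel functions and $H_n^{(1)}=J_n+iY_n$. The incident field, a non-singular solution of $\Delta u^i+\omega^2q_0u^i=0$ in $\mathbb{R}^2$, is $u^i=\sum_{n\in\mathbb{Z}}a_nJ_n(\sqrt{q_0}\,\omega r)e^{in\theta}$ (so $u^i(0)=a_0$). $u_\varepsilon\in H^1_{loc}(\mathbb{R}^2)$ solves $\Delta u_\varepsilon+\omega^2q_\varepsilon u_\varepsilon=0$, with $u_\varepsilon=u^i+u^s_\varepsilon$ for $|x|>\varepsilon$, where the scattered field $u_\varepsilon^s$ satisfies the outgoing radiation condition $\partial_ru^s_\varepsilon-i\omega\sqrt{q_0}u^s_\varepsilon=o(r^{-1/2})$. Equivalently, for $r\ge\varepsilon$, $u^s_\varepsilon=\sum_{n}a_nR_n(\omega_\varepsilon,\lambda)H^{(1)}_n(\sqrt{q_0}\,\omega r)e^{in\theta}$, with $$R_n(x,\lambda)=-\frac{\Re D_n}{D_n},\quad D_n=H_n^{(1)\prime}(x)J_n(\lambda x)-\lambda J_n'(\lambda x)H^{(1)}_n(x).$$ Norms: for $f$ defined on the circle $|x|=R$ with Fourier coefficients $c_n=\frac1{2\pi}\int_0^{2\pi}f(R,\theta)e^{-in\theta}d\theta$,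 $\Vert f(|x|=R)\Vert_{H^\sigma}=\sqrt{2\pi}\big(\sum_{n\in\mathbb{Z}}|c_n|^2(1+|n|)^{2\sigma}\big)^{1/2}$, and $\Vert f(|x|=R)\Vert_{H^\sigma_*}$ is the same with the sum over $n\ne0$.
   Formalization: In the second claim, "first p Fourier coefficients" means |n|<p, and it is also assumed that a_n=0 whenever J_n(√q_0/ε)=0 for such n; otherwise it fails, e.g. √q_0/ε a zero of J_0, u^i=J_0(√q_0 ω r), p=1, λ<1, ω small. *)

theory Defs
  imports "HOL-Analysis.Analysis"
begin

text \<open>
  The Bessel functions are first given for natural orders by their Taylor and logarithmic series
  at the origin (DLMF 10.2.2 and 10.8.1) and extended by
  \<open>J\<^sub>-\<^sub>n = (-1)\<^sup>n J\<^sub>n\<close> and \<open>Y\<^sub>-\<^sub>n = (-1)\<^sup>n Y\<^sub>n\<close>. The functions of the second kind are only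
  meaningful for \<open>x > 0\<close>.
\<close>

definition bessel_J_nat :: "nat \<Rightarrow> real \<Rightarrow> real" where
  "bessel_J_nat n x = (\<Sum>k. (-1) ^ k / (fact k * fact (n + k)) * (x / 2) ^ (2 * k + n))"

definition bessel_Y_nat :: "nat \<Rightarrow> real \<Rightarrow> real" where
  "bessel_Y_nat n x =
     2 / pi * ln (x / 2) * bessel_J_nat n x
     - 1 / pi * (\<Sum>k<n. fact (n - k - 1) / fact k * (x / 2) powi (2 * int k - int n))
     - 1 / pi * (\<Sum>k. (Digamma (real (k + 1)) + Digamma (real (n + k + 1)))
                    * ((-1) ^ k / (fact k * fact (n + k)) * (x / 2) ^ (2 * k + n)))"

definition bessel_J :: "int \<Rightarrow> real \<Rightarrow> real" where
  "bessel_J n x = (if n \<ge> 0 then bessel_J_nat (nat n) x else (-1) ^ nat (- n) * bessel_J_nat (nat (- n)) x)"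

definition bessel_Y :: "int \<Rightarrow> real \<Rightarrow> real" where
  "bessel_Y n x = (if n \<ge> 0 then bessel_Y_nat (nat n) x else (-1) ^ nat (- n) * bessel_Y_nat (nat (- n)) x)"

definition hankel1 :: "int \<Rightarrow> real \<Rightarrow> complex" where
  "hankel1 n x = Complex (bessel_J n x) (bessel_Y n x)"

text \<open>The plane is identified with \<^typ>\<open>complex\<close>; the point with polar coordinates
  \<open>(r, \<theta>)\<close> is \<open>rcis r \<theta>\<close>.\<close>

definition fourier_coeff :: "(complex \<Rightarrow> complex) \<Rightarrow> real \<Rightarrow> int \<Rightarrow> complex" where
  "fourier_coeff f R n =
     1 / (2 * pi) * integral {0..2 * pi} (\<lambda>\<theta>. f (rcis R \<theta>) * cis (- (of_int n * \<theta>)))"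

text \<open>The norms take the value \<open>\<infinity>\<close> when the defining series diverges.\<close>

definition circle_norm_over :: "int set \<Rightarrow> real \<Rightarrow> (complex \<Rightarrow> complex) \<Rightarrow> real \<Rightarrow> ennreal" where
  "circle_norm_over N s f R =
     (let w = (\<lambda>n. (cmod (fourier_coeff f R n))\<^sup>2 * (1 + \<bar>real_of_int n\<bar>) powr (2 * s))
      in if w summable_on N then ennreal (sqrt (2 * pi) * sqrt (\<Sum>\<^sub>\<infinity>n\<in>N. w n)) else \<infinity>)"

definition circle_norm :: "real \<Rightarrow> (complex \<Rightarrow> complex) \<Rightarrow> real \<Rightarrow> ennreal" where
  "circle_norm = circle_norm_over UNIV"

definition circle_norm_star :: "real \<Rightarrow> (complex \<Rightarrow> complex) \<Rightarrow> real \<Rightarrow> ennreal" where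
  "circle_norm_star = circle_norm_over (- {0})"

definition dir_deriv :: "complex \<Rightarrow> (complex \<Rightarrow> complex) \<Rightarrow> complex \<Rightarrow> complex" where
  "dir_deriv v f z = frechet_derivative f (at z) v"

text \<open>Real differentiability is meant: in \<open>\<phi> differentiable (at z)\<close> the derivative is
  real-linear, and the partial derivatives are the directional ones along \<open>1\<close> and \<open>\<i>\<close>.
  Testing with \<open>C\<^sup>1\<close> functions of compact support is equivalent, by density, to testing with
  \<open>C\<^sup>\<infinity>\<close> ones, since all integrands below are products with locally square integrable functions.\<close>

definition test_function :: "(complex \<Rightarrow> complex) \<Rightarrow> bool" where
  "test_function \<phi> \<longleftrightarrow>
     (\<forall>z. \<phi> differentiable (at z)) \<and>
     continuous_on UNIV (dir_deriv 1 \<phi>) \<and> continuous_on UNIV (dir_deriv \<i> \<phi>) \<and>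
     bounded {z. \<phi> z \<noteq> 0}"

definition L2_loc :: "(complex \<Rightarrow> complex) \<Rightarrow> bool" where
  "L2_loc g \<longleftrightarrow> g \<in> borel_measurable lborel \<and>
     (\<forall>K. compact K \<longrightarrow> set_integrable lborel K (\<lambda>z. (cmod (g z))\<^sup>2))"

definition weak_deriv :: "complex \<Rightarrow> (complex \<Rightarrow> complex) \<Rightarrow> (complex \<Rightarrow> complex) \<Rightarrow> bool" where
  "weak_deriv v u g \<longleftrightarrow>
     (\<forall>\<phi>. test_function \<phi> \<longrightarrow>
        (LINT z|lborel. u z * dir_deriv v \<phi> z) = - (LINT z|lborel. g z * \<phi> z))"

text \<open>
  \<open>u \<in> H\<^sup>1\<^sub>l\<^sub>o\<^sub>c\<close> solves \<open>\<Delta>u + c u = 0\<close> in the whole plane, for bounded \<open>c\<close>.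
  By elliptic regularity \<open>u\<close> has a continuous representative; it is the one meant here,
  so that the values of \<open>u\<close> on circles are well defined.
\<close>

definition H1_loc_solution :: "(complex \<Rightarrow> real) \<Rightarrow> (complex \<Rightarrow> complex) \<Rightarrow> bool" where
  "H1_loc_solution c u \<longleftrightarrow>
     continuous_on UNIV u \<and> L2_loc u \<and>
     (\<exists>g1 g2. L2_loc g1 \<and> L2_loc g2 \<and> weak_deriv 1 u g1 \<and> weak_deriv \<i> u g2 \<and>
        (\<forall>\<phi>. test_function \<phi> \<longrightarrow>
           (LINT z|lborel. g1 z * dir_deriv 1 \<phi> z + g2 z * dir_deriv \<i> \<phi> z)
           = (LINT z|lborel. of_real (c z) * u z * \<phi> z)))"

text \<open>The radiation condition \<open>\<partial>\<^sub>r v - i k v = o(r\<^sup>-\<^sup>1\<^sup>/\<^sup>2)\<close> is uniform in the angle, as usual.\<close>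

definition outgoing :: "real \<Rightarrow> real \<Rightarrow> (complex \<Rightarrow> complex) \<Rightarrow> bool" where
  "outgoing k r0 v \<longleftrightarrow>
     (\<exists>dv. (\<forall>r>r0. \<forall>\<theta>. ((\<lambda>s. v (rcis s \<theta>)) has_vector_derivative dv r \<theta>) (at r)) \<and>
        (\<forall>e>0. \<forall>\<^sub>F r in at_top. \<forall>\<theta>.
           cmod (dv r \<theta> - \<i> * of_real k * v (rcis r \<theta>)) \<le> e * r powr (- 1/2)))"

definition q_disc :: "real \<Rightarrow> real \<Rightarrow> real \<Rightarrow> complex \<Rightarrow> real" where
  "q_disc \<epsilon> q q0 z = (if cmod z < \<epsilon> then q else q0)"

definition incident_field :: "real \<Rightarrow> real \<Rightarrow> (int \<Rightarrow> complex) \<Rightarrow> (complex \<Rightarrow> complex) \<Rightarrow> bool" where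
  "incident_field \<omega> q0 a ui \<longleftrightarrow>
     H1_loc_solution (\<lambda>_. \<omega>\<^sup>2 * q0) ui \<and>
     (\<forall>r\<ge>0. \<forall>\<theta>. ((\<lambda>n. a n * of_real (bessel_J n (sqrt q0 * \<omega> * r)) * cis (of_int n * \<theta>))
                   has_sum ui (rcis r \<theta>)) UNIV)"

text \<open>\<open>u\<close> is the total field and \<open>us\<close> the scattered field; the latter is only constrained
  (and only used) for \<open>|x| \<ge> \<epsilon>\<close>, its values on \<open>|x| = \<epsilon>\<close> being the traces from outside.\<close>

definition scattering_solution ::
  "real \<Rightarrow> real \<Rightarrow> real \<Rightarrow> real \<Rightarrow> (complex \<Rightarrow> complex) \<Rightarrow> (complex \<Rightarrow> complex) \<Rightarrow> (complex \<Rightarrow> complex) \<Rightarrow> bool"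
where
  "scattering_solution \<epsilon> \<omega> q q0 ui u us \<longleftrightarrow>
     H1_loc_solution (\<lambda>z. \<omega>\<^sup>2 * q_disc \<epsilon> q q0 z) u \<and>
     (\<forall>z. cmod z \<ge> \<epsilon> \<longrightarrow> u z = ui z + us z) \<and>
     outgoing (\<omega> * sqrt q0) \<epsilon> us"

definition first_positive_zero :: "(real \<Rightarrow> real) \<Rightarrow> real \<Rightarrow> bool" where
  "first_positive_zero f y \<longleftrightarrow> 0 < y \<and> f y = 0 \<and> (\<forall>x. 0 < x \<and> x < y \<longrightarrow> f x \<noteq> 0)"

end

(*
  The n-th Fourier mode of the total field is regular at the origin, hence proportional to
  J_n(lambda k r) inside the disc, and the radiation condition forces the n-th mode of the scattered
  field to be proportional to an outgoing solution h_n of Bessel's equation. Matching Euler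
  derivatives at r = epsilon gives, with x = k epsilon and g(x) = x J_n'(x) / J_n(x),

    b h_n(x) = - a J_n(x) (g(x) - g(lambda x)) / (x h_n'(x) / h_n(x) - g(lambda x)).

  For n >= 1 the modulus s |h_n(s)|^2 is nonincreasing. This transports the bound from epsilon to R
  and makes the real part of the denominator at most - (g(lambda x) + 1/2). For x <= n the Riccati
  equation of g shows that - g' is increasing, and the value g(n) <= n^(2/3) produces the gain of
  1/3 of a derivative. The mode n = 0 is treated by explicit signs of J_0 and Y_0 on (0, y_{0,1}),
  where y_{0,1} < 1.

  The functions h_n are not identified with the Hankel functions. It is enough that
  h_0 = J_0 + tau Y_0 is outgoing for some tau, with |tau| and Im tau controlled by the values of J_0
  and Y_0 at 1 and a decreasing energy; the other h_n come from the recurrence relations. The constant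
  9 leaves room for the resulting loss.
*)

theory Submission
  imports Defs
begin

subsection \<open>Bessel functions of the first kind\<close>

text \<open>Two obstacles shape the proof. The field is known only through a weak equation and a
  radiation condition, so regularity at the origin, the continuity of r c'(r) across r = epsilon and
  the absence of incoming waves are established mode by mode. The test functions are a function of
  |z|^2 times a power of z or of its conjugate, because these stay smooth at the origin and admit
  two integrations by parts. Secondly, the monotonicity of s |h_n(s)|^2 is obtained without an
  integral formula for the modulus: a quantity with the sign of the derivative is followed out to
  infinity, where outgoing behaviour makes it vanish.

  The gain n^(-1/3) comes from the mean value theorem: g(lambda x) - g(x) is at most (1 - lambda) x
  g(n)^2 / n, since - g' increases and equals g(n)^2 / n at n. One factor g(n) is at most g(lambda
  x) and cancels against the denominator; g(n) / n <= n^(-1/3) is left. The constant 3 is the price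
  of replacing n by 1 + n.\<close>

definition clif :: "nat \<Rightarrow> real \<Rightarrow> real" where
  "clif n t = (\<Sum>k. (-1) ^ k / (fact k * fact (n + k)) * t ^ k)"

lemma summable_dominated_by_exp:
  fixes c :: "nat \<Rightarrow> real"
  assumes "\<And>k. \<bar>c k\<bar> \<le> 1 / fact k"
  shows "summable (\<lambda>k. c k * t ^ k)"
proof (rule summable_comparison_test')
  show "summable (\<lambda>k. inverse (fact k) * \<bar>t\<bar> ^ k)" by (rule summable_exp)
  show "norm (c k * t ^ k) \<le> inverse (fact k) * \<bar>t\<bar> ^ k" if "k \<ge> 0" for k
    using mult_right_mono[OF assms[of k], of "\<bar>t\<bar> ^ k"]
    by (simp add: abs_mult power_abs inverse_eq_divide)
qed

lemma clif_coeff_bound: "\<bar>(-1) ^ k / (fact k * fact (n + k)) :: real\<bar> \<le> 1 / fact k"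
proof -
  have "fact k * 1 \<le> fact k * (fact (n + k) :: real)"
    by (intro mult_left_mono) (auto simp: fact_ge_1)
  then show ?thesis by (simp add: abs_mult power_abs frac_le)
qed

lemma clif_summable: "summable (\<lambda>k. (-1) ^ k / (fact k * fact (n + k)) * t ^ k :: real)"
  by (rule summable_dominated_by_exp[OF clif_coeff_bound])

lemma clif_deriv: "(clif n has_real_derivative - clif (Suc n) t) (at t)"
proof -
  have "(clif n has_real_derivative
      (\<Sum>k. diffs (\<lambda>k. (-1) ^ k / (fact k * fact (n + k))) k * t ^ k)) (at t)"
    unfolding clif_def by (rule termdiffs_strong_converges_everywhere) (rule clif_summable)
  also have "diffs (\<lambda>k. (-1) ^ k / (fact k * fact (n + k)) :: real)
      = (\<lambda>k. - ((-1) ^ k / (fact k * fact (Suc n + k))))"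
  proof
    fix k
    have "fact (Suc k) = real (Suc k) * fact k" "n + Suc k = Suc n + k" by simp_all
    then show "diffs (\<lambda>k. (-1) ^ k / (fact k * fact (n + k)) :: real) k
        = - ((-1) ^ k / (fact k * fact (Suc n + k)))"
      unfolding diffs_def by (simp del: of_nat_Suc fact_Suc)
  qed
  also have "(\<Sum>k. - ((-1) ^ k / (fact k * fact (Suc n + k))) * t ^ k) = - clif (Suc n) t"
    unfolding clif_def using suminf_minus[OF clif_summable[of "Suc n" t]] by simp
  finally show ?thesis .
qed

lemma clif_0 [simp]: "clif n 0 = 1 / fact n"
  unfolding clif_def by (subst suminf_finite[of "{0}"]) (auto simp: power_0_left)

lemma clif_rec: "t * clif (n + 2) t - real (n + 1) * clif (Suc n) t + clif n t = 0"
proof -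
  let ?c = "\<lambda>n k. (-1) ^ k / (fact k * fact (n + k)) :: real"
  have s: "(\<lambda>k. ?c n k * t ^ k) sums clif n t" for n
    unfolding clif_def by (rule summable_sums[OF clif_summable])
  have c: "real (Suc n) * ?c (Suc n) (Suc k) - ?c n (Suc k) = ?c (n + 2) k" for k
  proof -
    show ?thesis by (simp add: divide_simps) (simp add: field_simps)
  qed
  have "(\<lambda>k. real (Suc n) * (?c (Suc n) k * t ^ k) - ?c n k * t ^ k)
      sums (real (Suc n) * clif (Suc n) t - clif n t)"
    by (intro sums_diff sums_mult s)
  \<comment> \<open>The index shift costs nothing: the term k = 0 is (n + 1) / (n + 1)! - 1 / n! =
    0.\<close>
  then have "(\<lambda>k. (real (Suc n) * (?c (Suc n) (Suc k) * t ^ Suc k) - ?c n (Suc k) * t ^ Suc k))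
      sums (real (Suc n) * clif (Suc n) t - clif n t)"
    by (subst sums_Suc_iff) simp
  also have "(\<lambda>k. (real (Suc n) * (?c (Suc n) (Suc k) * t ^ Suc k) - ?c n (Suc k) * t ^ Suc k))
      = (\<lambda>k. t * (?c (n + 2) k * t ^ k))"
  proof
    fix k
    have "real (Suc n) * (?c (Suc n) (Suc k) * t ^ Suc k) - ?c n (Suc k) * t ^ Suc k
        = (real (Suc n) * ?c (Suc n) (Suc k) - ?c n (Suc k)) * t ^ Suc k"
      by (simp only: left_diff_distrib mult.assoc)
    then show "real (Suc n) * (?c (Suc n) (Suc k) * t ^ Suc k) - ?c n (Suc k) * t ^ Suc k
        = t * (?c (n + 2) k * t ^ k)"
      unfolding c by simp
  qed
  finally have "t * clif (n + 2) t = real (Suc n) * clif (Suc n) t - clif n t"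
    using sums_unique2 sums_mult[OF s] by blast
  then show ?thesis by simp
qed

text \<open>So \<open>clif n\<close> is the Bessel-Clifford function. It is entire in x^2 / 4 and
  takes the value 1 / n! at 0, which isolates the behaviour of J_n at the origin in the factor (x /
  2)^n.\<close>

lemma bessel_J_nat_clif: "bessel_J_nat n x = (x / 2) ^ n * clif n (x\<^sup>2 / 4)"
proof -
  have "(\<lambda>k. (-1) ^ k / (fact k * fact (n + k)) * (x / 2) ^ (2 * k + n))
      = (\<lambda>k. (x / 2) ^ n * ((-1) ^ k / (fact k * fact (n + k)) * (x\<^sup>2 / 4) ^ k))"
    (is "?f = ?g")
  proof
    fix k
    have "(x / 2) ^ (2 * k + n) = (x / 2) ^ n * ((x / 2)\<^sup>2) ^ k"
      using power_add[of "x / 2" "2 * k" n] power_mult[of "x / 2" 2 k] by simp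
    also have "(x / 2)\<^sup>2 = x\<^sup>2 / 4" by (simp add: power_divide)
    finally have "(x / 2) ^ (2 * k + n) = (x / 2) ^ n * (x\<^sup>2 / 4) ^ k" .
    then show "?f k = ?g k" by (simp only: mult_ac)
  qed
  then show ?thesis
    unfolding bessel_J_nat_def clif_def suminf_mult[OF clif_summable, symmetric] by (rule arg_cong)
qed

lemma bessel_J_nat_deriv:
  assumes "x \<noteq> 0"
  shows "(bessel_J_nat n has_real_derivative real n / x * bessel_J_nat n x - bessel_J_nat (Suc n) x) (at x)"
proof -
  have "((\<lambda>x. (x / 2) ^ n * clif n (x\<^sup>2 / 4)) has_real_derivative
      real n * (x / 2) ^ (n - 1) * (1 / 2) * clif n (x\<^sup>2 / 4)
        + (x / 2) ^ n * (- clif (Suc n) (x\<^sup>2 / 4) * (2 * x / 4))) (at x)"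
    by (auto intro!: derivative_eq_intros DERIV_chain2[OF clif_deriv])
  also have "real n * (x / 2) ^ (n - 1) * (1 / 2) * clif n (x\<^sup>2 / 4)
        + (x / 2) ^ n * (- clif (Suc n) (x\<^sup>2 / 4) * (2 * x / 4))
      = real n / x * ((x / 2) ^ n * clif n (x\<^sup>2 / 4)) - (x / 2) ^ Suc n * clif (Suc n) (x\<^sup>2 / 4)"
    using assms by (cases n) (simp_all add: field_simps)
  finally show ?thesis by (simp add: bessel_J_nat_clif[abs_def])
qed

lemma bessel_J_nat_rec:
  assumes "x \<noteq> 0"
  shows "bessel_J_nat (n + 2) x = 2 * real (n + 1) / x * bessel_J_nat (Suc n) x - bessel_J_nat n x"
proof -
  have "x\<^sup>2 / 4 * clif (n + 2) (x\<^sup>2 / 4) = real (n + 1) * clif (Suc n) (x\<^sup>2 / 4) - clif n (x\<^sup>2 / 4)"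
    using clif_rec[of "x\<^sup>2 / 4" n] by linarith
  then have "(x / 2) ^ n * (x\<^sup>2 / 4 * clif (n + 2) (x\<^sup>2 / 4))
      = (x / 2) ^ n * (real (n + 1) * clif (Suc n) (x\<^sup>2 / 4) - clif n (x\<^sup>2 / 4))" by simp
  moreover have "2 * real (n + 1) / x * ((x / 2) ^ Suc n * clif (Suc n) (x\<^sup>2 / 4))
      = (x / 2) ^ n * (real (n + 1) * clif (Suc n) (x\<^sup>2 / 4))"
    using assms by simp
  moreover have "(x / 2) ^ (n + 2) = (x / 2) ^ n * (x\<^sup>2 / 4)"
    by (simp add: power_add power2_eq_square)
  ultimately show ?thesis
    unfolding bessel_J_nat_clif by (simp only: right_diff_distrib mult.assoc)
qed

text \<open>All functions used for the expansions (first kind, outgoing, and their conjugates) share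
  the ladder relations, which imply Bessel's equation.\<close>

definition ladder :: "(nat \<Rightarrow> real \<Rightarrow> complex) \<Rightarrow> bool" where
  "ladder Z \<longleftrightarrow> (\<forall>n. \<forall>x>0.
     (Z n has_vector_derivative of_real (real n / x) * Z n x - Z (Suc n) x) (at x) \<and>
     (Z (Suc n) has_vector_derivative Z n x - of_real (real (n + 1) / x) * Z (Suc n) x) (at x))"

lemma ladder_J: "ladder (\<lambda>n x. complex_of_real (bessel_J_nat n x))"
  unfolding ladder_def
proof (intro allI impI conjI)
  fix n :: nat and x :: real assume x: "x > 0"
  then have nz: "x \<noteq> 0" by simp
  show "((\<lambda>x. complex_of_real (bessel_J_nat n x)) has_vector_derivative
      of_real (real n / x) * of_real (bessel_J_nat n x) - of_real (bessel_J_nat (Suc n) x)) (at x)"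
    using has_vector_derivative_of_real[OF bessel_J_nat_deriv[OF nz, of n]]
    by (simp only: of_real_diff of_real_mult)
  have e: "real (Suc n) / x * bessel_J_nat (Suc n) x - bessel_J_nat (Suc (Suc n)) x
      = bessel_J_nat n x - real (n + 1) / x * bessel_J_nat (Suc n) x"
    using bessel_J_nat_rec[of x n] x by (simp add: field_simps)
  show "((\<lambda>x. complex_of_real (bessel_J_nat (Suc n) x)) has_vector_derivative
      of_real (bessel_J_nat n x) - of_real (real (n + 1) / x) * of_real (bessel_J_nat (Suc n) x)) (at x)"
    using has_vector_derivative_of_real[OF bessel_J_nat_deriv[OF nz, of "Suc n", unfolded e]]
    by (simp only: of_real_diff of_real_mult)
qed

text \<open>Differentiating the three-term recurrence carries both relations from one order to the
  next, so a pair with h0' = - h1 and the matching equation for h1' generates the whole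
  sequence.\<close>

lemma ladder_recI:
  fixes h0 h1 :: "real \<Rightarrow> complex"
  assumes Z: "Z 0 = h0" "Z (Suc 0) = h1"
    "\<And>n x. Z (Suc (Suc n)) x = of_real (2 * real (n + 1) / x) * Z (Suc n) x - Z n x"
    and d0: "\<And>x. x > 0 \<Longrightarrow> (h0 has_vector_derivative - h1 x) (at x)"
    and d1: "\<And>x. x > 0 \<Longrightarrow> (h1 has_vector_derivative h0 x - h1 x / of_real x) (at x)"
  shows "ladder Z"
proof -
  have "(Z n has_vector_derivative of_real (real n / x) * Z n x - Z (Suc n) x) (at x) \<and>
     (Z (Suc n) has_vector_derivative Z n x - of_real (real (n + 1) / x) * Z (Suc n) x) (at x)"
    if x: "x > 0" for n x
  proof (induction n)
    case 0
    show ?case using d0[OF x] d1[OF x] by (simp add: Z(1,2))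
  next
    case (Suc n)
    note d = Suc[THEN conjunct1] Suc[THEN conjunct2]
    have "((\<lambda>x. of_real (2 * real (n + 1) / x) * Z (Suc n) x - Z n x) has_vector_derivative
        of_real (2 * real (n + 1) / x) * (Z n x - of_real (real (n + 1) / x) * Z (Suc n) x)
        + of_real (- 2 * real (n + 1) / x\<^sup>2) * Z (Suc n) x
        - (of_real (real n / x) * Z n x - Z (Suc n) x)) (at x)"
      using x by (intro derivative_intros d has_vector_derivative_of_real)
        (auto intro!: derivative_eq_intros simp: field_simps power2_eq_square)
    also have "(\<lambda>x. of_real (2 * real (n + 1) / x) * Z (Suc n) x - Z n x) = Z (Suc (Suc n))"
      using Z(3) by auto
    also have "of_real (2 * real (n + 1) / x) * (Z n x - of_real (real (n + 1) / x) * Z (Suc n) x)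
        + of_real (- 2 * real (n + 1) / x\<^sup>2) * Z (Suc n) x
        - (of_real (real n / x) * Z n x - Z (Suc n) x)
      = Z (Suc n) x - of_real (real (Suc n + 1) / x) * Z (Suc (Suc n)) x"
      using x unfolding Z(3) by (simp add: field_simps power2_eq_square)
    finally have D2: "(Z (Suc (Suc n)) has_vector_derivative
        Z (Suc n) x - of_real (real (Suc n + 1) / x) * Z (Suc (Suc n)) x) (at x)" .
    have "Z n x - of_real (real (n + 1) / x) * Z (Suc n) x
        = of_real (real (Suc n) / x) * Z (Suc n) x - Z (Suc (Suc n)) x"
      using x unfolding Z(3) by (simp add: field_simps)
    then have D1: "(Z (Suc n) has_vector_derivative
        of_real (real (Suc n) / x) * Z (Suc n) x - Z (Suc (Suc n)) x) (at x)"
      by (rule has_vector_derivative_eq_rhs[OF d(2)])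
    show ?case by (rule conjI[OF D1 D2])
  qed
  then show ?thesis unfolding ladder_def by (intro allI impI)
qed

lemma ladder_cnj: "ladder Z \<Longrightarrow> ladder (\<lambda>n x. cnj (Z n x))"
  unfolding ladder_def
proof (intro allI impI conjI, goal_cases)
  case (1 n x)
  then have "(Z n has_vector_derivative of_real (real n / x) * Z n x - Z (Suc n) x) (at x)" by blast
  from has_vector_derivative_cnj[OF this] show ?case by (simp only: complex_cnj_diff complex_cnj_mult complex_cnj_complex_of_real)
next
  case (2 n x)
  then have "(Z (Suc n) has_vector_derivative Z n x - of_real (real (n + 1) / x) * Z (Suc n) x) (at x)" by blast
  from has_vector_derivative_cnj[OF this] show ?case by (simp only: complex_cnj_diff complex_cnj_mult complex_cnj_complex_of_real)
qed

text \<open>Writing f and g for the members of order zero, this is x (f g' - f' g) once f' and g'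
  are replaced by minus the members of order one. The factor x makes it constant, by Abel's
  identity.\<close>

definition wronsk :: "(nat \<Rightarrow> real \<Rightarrow> complex) \<Rightarrow> (nat \<Rightarrow> real \<Rightarrow> complex) \<Rightarrow> real \<Rightarrow> complex" where
  "wronsk Z Z' x = of_real x * (Z (Suc 0) x * Z' 0 x - Z 0 x * Z' (Suc 0) x)"

lemma ladder_wronsk:
  "of_real x * (Z (Suc n) x * Z' n x - Z n x * Z' (Suc n) x) = wronsk Z Z' x"
  if "ladder Z" "ladder Z'" "x > 0"
proof (induction n)
  case 0
  show ?case by (simp add: wronsk_def)
next
  case (Suc n)
  \<comment> \<open>The recurrence is recovered by comparing the two expressions that
    \<open>ladder\<close> gives for the derivative of \<open>Z (Suc n)\<close>.\<close>
  have r: "Z (Suc (Suc n)) x = of_real (2 * real (n + 1) / x) * Z (Suc n) x - Z n x" if "ladder Z" for Z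
  proof -
    have "of_real (real (Suc n) / x) * Z (Suc n) x - Z (Suc (Suc n)) x
        = Z n x - of_real (real (n + 1) / x) * Z (Suc n) x"
      by (rule vector_derivative_unique_at) (use that \<open>x > 0\<close> in \<open>unfold ladder_def, blast\<close>)+
    then show ?thesis by (simp add: field_simps)
  qed
  have "Z (Suc (Suc n)) x * Z' (Suc n) x - Z (Suc n) x * Z' (Suc (Suc n)) x
      = Z (Suc n) x * Z' n x - Z n x * Z' (Suc n) x"
    unfolding r[OF that(1)] r[OF that(2)] by (simp add: algebra_simps)
  then show ?case using Suc by simp
qed

lemma ladder_wronsk_const:
  assumes "ladder Z" "ladder Z'" "x > 0" "y > 0"
  shows "wronsk Z Z' x = wronsk Z Z' y"
proof -
  have d: "(wronsk Z Z' has_vector_derivative 0) (at s)" if s: "s > 0" for s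
  proof -
    have z: "(Z 0 has_vector_derivative of_real (real 0 / s) * Z 0 s - Z (Suc 0) s) (at s)"
      "(Z (Suc 0) has_vector_derivative Z 0 s - of_real (real (0 + 1) / s) * Z (Suc 0) s) (at s)"
      if "ladder Z" for Z
      using that s unfolding ladder_def by blast+
    have id: "((\<lambda>s. complex_of_real s) has_vector_derivative 1) (at s)"
      using has_vector_derivative_of_real[OF DERIV_ident] by simp
    show ?thesis
      unfolding wronsk_def
      by (rule has_vector_derivative_eq_rhs,
          (rule derivative_intros id z[OF assms(1)] z[OF assms(2)])+)
        (use s in \<open>simp add: field_simps\<close>)
  qed
  show ?thesis
  proof (rule has_vector_derivative_zero_constant)
    show "convex {0::real<..}" by simp
    show "(wronsk Z Z' has_vector_derivative 0) (at s within {0<..})" if "s \<in> {0<..}" for s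
      using that by (auto intro: has_vector_derivative_at_within d)
    show ?thesis if "\<And>s. s \<in> {0<..} \<Longrightarrow> wronsk Z Z' s = c" for c
      using that assms(3,4) by simp
  qed
qed

subsection \<open>The Bessel function of the second kind of order zero\<close>

definition pser :: "(nat \<Rightarrow> real) \<Rightarrow> real \<Rightarrow> real" where
  "pser c t = (\<Sum>k. c k * t ^ k)"

lemma diffs_bound:
  assumes "\<And>k. \<bar>c k\<bar> \<le> 1 / fact k"
  shows "\<bar>diffs c k :: real\<bar> \<le> 1 / fact k"
proof -
  have "\<bar>diffs c k\<bar> = real (Suc k) * \<bar>c (Suc k)\<bar>" by (simp add: diffs_def abs_mult)
  also have "\<dots> \<le> real (Suc k) * (1 / fact (Suc k))" by (intro mult_left_mono assms) simp
  also have "\<dots> = 1 / fact k" by simp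
  finally show ?thesis .
qed

lemma pser_deriv:
  assumes "\<And>k. \<bar>c k\<bar> \<le> 1 / fact k"
  shows "(pser c has_real_derivative pser (diffs c) t) (at t)"
  unfolding pser_def
  by (rule termdiffs_strong_converges_everywhere, rule summable_dominated_by_exp) (rule assms)

text \<open>The point 1/4 is t = x^2 / 4 at x = 1. From k = 3 on the coefficients are at most 1/6,
  and the geometric tail (1/6) (4^(-3) + 4^(-4) + ...) sums to 1/288.\<close>

lemma pser_tail:
  assumes c: "\<And>k. \<bar>c k\<bar> \<le> 1 / fact k"
  shows "\<bar>pser c (1 / 4) - (c 0 + c 1 / 4 + c 2 / 16)\<bar> \<le> 1 / 288"
proof -
  have s: "summable (\<lambda>k. c k * (1 / 4) ^ k)" by (rule summable_dominated_by_exp[OF c])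
  have "pser c (1 / 4) = (\<Sum>k. c (k + 3) * (1 / 4) ^ (k + 3)) + (\<Sum>k<3. c k * (1 / 4) ^ k)"
    unfolding pser_def by (rule suminf_split_initial_segment[OF s])
  then have e: "pser c (1 / 4) - (c 0 + c 1 / 4 + c 2 / 16) = (\<Sum>k. c (k + 3) * (1 / 4) ^ (k + 3))"
    by (simp add: eval_nat_numeral)
  have b: "norm (c (k + 3) * (1 / 4) ^ (k + 3)) \<le> 1 / 384 * (1 / 4) ^ k" for k
  proof -
    have "(6::real) = fact 3" by (simp add: eval_nat_numeral)
    also have "\<dots> \<le> fact (k + 3)" by (rule fact_mono) simp
    finally have "1 / fact (k + 3) \<le> (1 / 6 :: real)" by (intro divide_left_mono) auto
    with c[of "k + 3"] have "\<bar>c (k + 3)\<bar> \<le> 1 / 6" by linarith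
    then have "\<bar>c (k + 3)\<bar> * (1 / 4) ^ (k + 3) \<le> 1 / 6 * (1 / 4) ^ (k + 3)"
      by (intro mult_right_mono) auto
    then show ?thesis by (simp add: abs_mult power_add eval_nat_numeral)
  qed
  have g: "(\<lambda>k. 1 / 384 * (1 / 4 :: real) ^ k) sums (1 / 384 * (1 / (1 - 1 / 4)))"
    by (intro sums_mult geometric_sums) simp
  have "norm (\<Sum>k. c (k + 3) * (1 / 4) ^ (k + 3)) \<le> (\<Sum>k. 1 / 384 * (1 / 4) ^ k)"
    by (rule norm_suminf_le[OF b sums_summable[OF g]])
  also have "\<dots> = 1 / 288" using sums_unique[OF g] by simp
  finally show ?thesis unfolding e by simp
qed

text \<open>Coefficients, in t = x^2 / 4, of the part of (pi / 2) Y_0 that is free of the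
  logarithm.\<close>

definition harm_coeff :: "nat \<Rightarrow> real" where
  "harm_coeff k = - (harm k * (-1) ^ k / (fact k)\<^sup>2)"

lemma harm_coeff_bound: "\<bar>harm_coeff k\<bar> \<le> 1 / fact k"
proof -
  have "harm k \<le> (\<Sum>i=1..k. 1 :: real)"
    unfolding harm_def by (intro sum_mono) (auto simp: field_simps)
  also have "\<dots> = real k" by simp
  also have "\<dots> \<le> real (fact k)" by (simp only: of_nat_le_iff fact_ge_self)
  also have "\<dots> = fact k" by (rule of_nat_fact)
  finally have "harm k / (fact k)\<^sup>2 \<le> (fact k / (fact k)\<^sup>2 :: real)"
    by (intro divide_right_mono) auto
  then show ?thesis
    using harm_nonneg[of k, where 'a = real]
    by (simp add: harm_coeff_def abs_mult power_abs power2_eq_square)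
qed

text \<open>The operator on the left is Bessel's operator of order zero in the variable t = x^2 / 4.
  Applied to the logarithmic part of (pi / 2) Y_0 it leaves - \<open>clif 1 t\<close>, and the
  harmonic series has to compensate this.\<close>

lemma harm_series_ode:
  "t * pser (diffs (diffs harm_coeff)) t + pser (diffs harm_coeff) t + pser harm_coeff t = clif 1 t"
proof -
  let ?c = harm_coeff
  note b = harm_coeff_bound diffs_bound[OF harm_coeff_bound]
    diffs_bound[OF diffs_bound[OF harm_coeff_bound]]
  have s: "(\<lambda>k. c k * t ^ k) sums pser c t" if "\<And>k. \<bar>c k\<bar> \<le> 1 / fact k" for c
    unfolding pser_def by (intro summable_sums summable_dominated_by_exp that)
  have "(\<lambda>k. t * (diffs (diffs ?c) k * t ^ k)) sums (t * pser (diffs (diffs ?c)) t)"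
    by (intro sums_mult s b)
  also have "(\<lambda>k. t * (diffs (diffs ?c) k * t ^ k)) = (\<lambda>k. real (Suc k) * diffs ?c (Suc k) * t ^ Suc k)"
    by (rule ext) (simp add: diffs_def[of "diffs ?c"])
  finally have "(\<lambda>k. real k * diffs ?c k * t ^ k) sums (t * pser (diffs (diffs ?c)) t)"
    by (subst (asm) sums_Suc_iff) simp
  then have "(\<lambda>k. real k * diffs ?c k * t ^ k + diffs ?c k * t ^ k + ?c k * t ^ k)
      sums (t * pser (diffs (diffs ?c)) t + pser (diffs ?c) t + pser ?c t)"
    by (intro sums_add s b)
  also have "(\<lambda>k. real k * diffs ?c k * t ^ k + diffs ?c k * t ^ k + ?c k * t ^ k)
      = (\<lambda>k. (-1) ^ k / (fact k * fact (1 + k)) * t ^ k)"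
  proof
    fix k
    have f: "fact (Suc k) = real (Suc k) * fact k" by simp
    have "real k * diffs ?c k + diffs ?c k + ?c k
        = (real (Suc k))\<^sup>2 * harm_coeff (Suc k) + harm_coeff k"
      by (simp add: diffs_def field_simps power2_eq_square)
    also have "(real (Suc k))\<^sup>2 * harm_coeff (Suc k) = harm (Suc k) * (-1) ^ k / (fact k)\<^sup>2"
      unfolding harm_coeff_def f power_mult_distrib by (simp del: of_nat_Suc)
    also have "harm (Suc k) * (-1) ^ k / (fact k)\<^sup>2 + harm_coeff k
        = (-1) ^ k / (fact k * fact (1 + k))"
    proof -
      have "harm (Suc k) = (harm k + 1 / real (Suc k) :: real)" by (simp add: harm_Suc inverse_eq_divide)
      then have "harm (Suc k) * (-1) ^ k / (fact k)\<^sup>2 + harm_coeff k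
          = 1 / real (Suc k) * (-1) ^ k / (fact k)\<^sup>2"
      proof -
        have "(h + 1 / m) * e / F + - (h * e / F) = 1 / m * e / F" for h m e F :: real
          by (simp add: distrib_right add_divide_distrib)
        then show ?thesis unfolding harm_coeff_def \<open>harm (Suc k) = _\<close> .
      qed
      also have "\<dots> = (-1) ^ k / (fact k * fact (Suc k))"
        unfolding f by (simp add: power2_eq_square)
      finally show ?thesis by simp
    qed
    finally show "real k * diffs ?c k * t ^ k + diffs ?c k * t ^ k + ?c k * t ^ k
        = (-1) ^ k / (fact k * fact (1 + k)) * t ^ k"
      by (simp only: distrib_right[symmetric])
  qed
  finally show ?thesis unfolding clif_def by (simp add: sums_iff)
qed

text \<open>\<open>Digamma\<close> at k + 1 is \<open>harm k - euler_mascheroni\<close>, so the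
  digamma series splits into the harmonic series and a multiple of J_0, which joins the
  logarithm.\<close>

lemma bessel_Y_nat_0:
  "bessel_Y_nat 0 x = 2 / pi * ((ln (x / 2) + euler_mascheroni) * bessel_J_nat 0 x + pser harm_coeff (x\<^sup>2 / 4))"
proof -
  let ?j = "\<lambda>k. (-1) ^ k / (fact k * fact (0 + k)) * (x\<^sup>2 / 4) ^ k :: real"
  have s1: "?j sums bessel_J_nat 0 x"
    using summable_sums[OF clif_summable[of 0 "x\<^sup>2 / 4"]] by (simp add: bessel_J_nat_clif clif_def)
  have s2: "(\<lambda>k. harm_coeff k * (x\<^sup>2 / 4) ^ k) sums pser harm_coeff (x\<^sup>2 / 4)"
    unfolding pser_def by (intro summable_sums summable_dominated_by_exp harm_coeff_bound)
  have "(\<lambda>k. (-2) * (harm_coeff k * (x\<^sup>2 / 4) ^ k) - 2 * euler_mascheroni * ?j k)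
      sums ((-2) * pser harm_coeff (x\<^sup>2 / 4) - 2 * euler_mascheroni * bessel_J_nat 0 x)"
    by (intro sums_diff sums_mult s1 s2)
  also have "(\<lambda>k. (-2) * (harm_coeff k * (x\<^sup>2 / 4) ^ k) - 2 * euler_mascheroni * ?j k)
      = (\<lambda>k. (Digamma (real (k + 1)) + Digamma (real (0 + k + 1)))
                    * ((-1) ^ k / (fact k * fact (0 + k)) * (x / 2) ^ (2 * k + 0)))"
  proof
    fix k
    have d: "Digamma (real (k + 1)) = harm k - euler_mascheroni"
      using Digamma_of_nat[of k, where 'a = real] by simp
    have p: "(x / 2) ^ (2 * k + 0) = (x\<^sup>2 / 4) ^ k" by (simp add: power_mult power_divide)
    show "(-2) * (harm_coeff k * (x\<^sup>2 / 4) ^ k) - 2 * euler_mascheroni * ?j k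
        = (Digamma (real (k + 1)) + Digamma (real (0 + k + 1)))
                    * ((-1) ^ k / (fact k * fact (0 + k)) * (x / 2) ^ (2 * k + 0))"
    proof -
      have "(-2) * (- (h * e / F\<^sup>2) * X) - 2 * g * (e / (F * F) * X) = ((h - g) + (h - g)) * (e / (F * F) * X)"
        for h e F X g :: real
        by (simp add: power2_eq_square divide_simps) (simp add: algebra_simps)
      then show ?thesis unfolding p add_0 d harm_coeff_def .
    qed
  qed
  finally have "(\<Sum>k. (Digamma (real (k + 1)) + Digamma (real (0 + k + 1)))
                    * ((-1) ^ k / (fact k * fact (0 + k)) * (x / 2) ^ (2 * k + 0)))
      = (-2) * pser harm_coeff (x\<^sup>2 / 4) - 2 * euler_mascheroni * bessel_J_nat 0 x"
    by (rule sums_unique[symmetric])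
  then show ?thesis
    unfolding bessel_Y_nat_def by (simp add: field_simps)
qed

text \<open>\<open>Y\<^sub>1 = - Y\<^sub>0'\<close>, by differentiating the logarithmic series of \<open>Y\<^sub>0\<close>.\<close>

definition bessel_Y1 :: "real \<Rightarrow> real" where
  "bessel_Y1 x = - (2 / pi * (bessel_J_nat 0 x / x - (ln (x / 2) + euler_mascheroni) * bessel_J_nat 1 x
      + x / 2 * pser (diffs harm_coeff) (x\<^sup>2 / 4)))"

lemma bessel_J_nat_0_deriv:
  "x > 0 \<Longrightarrow> (bessel_J_nat 0 has_real_derivative - bessel_J_nat 1 x) (at x)"
  using bessel_J_nat_deriv[of x 0] by simp

lemma bessel_J_nat_1_deriv:
  "x > 0 \<Longrightarrow> (bessel_J_nat 1 has_real_derivative bessel_J_nat 0 x - bessel_J_nat 1 x / x) (at x)"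
  using bessel_J_nat_deriv[of x 1] bessel_J_nat_rec[of x 0] by (simp add: numeral_2_eq_2)

lemma pser_sq_deriv:
  assumes "\<And>k. \<bar>c k\<bar> \<le> 1 / fact k"
  shows "((\<lambda>x. pser c (x\<^sup>2 / 4)) has_real_derivative pser (diffs c) (x\<^sup>2 / 4) * (x / 2)) (at x)"
  by (rule DERIV_chain2[OF pser_deriv]) (auto intro!: assms derivative_eq_intros)

lemma ln_half_deriv:
  "x > 0 \<Longrightarrow> ((\<lambda>x. ln (x / 2) + euler_mascheroni) has_real_derivative 1 / x) (at x)"
  by (auto intro!: derivative_eq_intros)

lemma bessel_Y_0_deriv:
  assumes "x > 0"
  shows "(bessel_Y_nat 0 has_real_derivative - bessel_Y1 x) (at x)"
  unfolding bessel_Y_nat_0[abs_def] bessel_Y1_def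
  by (rule DERIV_cong, (rule DERIV_cmult DERIV_add DERIV_mult ln_half_deriv[OF assms]
      bessel_J_nat_0_deriv[OF assms] pser_sq_deriv harm_coeff_bound)+) simp

lemma bessel_Y1_deriv:
  assumes x: "x > 0"
  shows "(bessel_Y1 has_real_derivative bessel_Y_nat 0 x - bessel_Y1 x / x) (at x)"
proof -
  define L S S1 S2 J0 J1 where defs: "L = ln (x / 2) + euler_mascheroni"
    "S = pser harm_coeff (x\<^sup>2 / 4)" "S1 = pser (diffs harm_coeff) (x\<^sup>2 / 4)"
    "S2 = pser (diffs (diffs harm_coeff)) (x\<^sup>2 / 4)"
    "J0 = bessel_J_nat 0 x" "J1 = bessel_J_nat 1 x"
  have nz: "x \<noteq> 0" using x by simp
  have "x\<^sup>2 / 4 * S2 + S1 + S = clif 1 (x\<^sup>2 / 4)"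
    using harm_series_ode[of "x\<^sup>2 / 4"] by (simp add: defs)
  also have "\<dots> = 2 * J1 / x" using x by (simp add: defs bessel_J_nat_clif)
  finally have ode: "S2 = (2 * J1 / x - S1 - S) * 4 / x\<^sup>2" using x by (simp add: field_simps)
  have h: "((\<lambda>x. x / 2) has_real_derivative 1 / 2) (at x)"
    by (auto intro!: derivative_eq_intros)
  have "(bessel_Y1 has_real_derivative
      - (2 / pi * ((- J1 * x - J0 * 1) / (x * x) - (1 / x * J1 + (J0 - J1 / x) * L) + (1 / 2 * S1 + S2 * (x / 2) * (x / 2))))) (at x)"
    unfolding bessel_Y1_def[abs_def] defs
    by (rule DERIV_minus DERIV_cmult DERIV_add DERIV_diff DERIV_divide DERIV_ident h nz
        DERIV_mult ln_half_deriv[OF x]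
      bessel_J_nat_0_deriv[OF x] bessel_J_nat_1_deriv[OF x] pser_sq_deriv harm_coeff_bound diffs_bound)+
  also have "- (2 / pi * ((- J1 * x - J0 * 1) / (x * x) - (1 / x * J1 + (J0 - J1 / x) * L) + (1 / 2 * S1 + S2 * (x / 2) * (x / 2))))
      = bessel_Y_nat 0 x - bessel_Y1 x / x"
    unfolding ode bessel_Y_nat_0 bessel_Y1_def defs(1-3,5,6)[symmetric]
    using x by (simp add: divide_simps) (simp add: algebra_simps power2_eq_square)
  finally show ?thesis .
qed

fun cyl :: "complex \<Rightarrow> complex \<Rightarrow> nat \<Rightarrow> real \<Rightarrow> complex" where
  "cyl a b 0 x = a * of_real (bessel_J_nat 0 x) + b * of_real (bessel_Y_nat 0 x)"
| "cyl a b (Suc 0) x = a * of_real (bessel_J_nat 1 x) + b * of_real (bessel_Y1 x)"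
| "cyl a b (Suc (Suc n)) x = of_real (2 * real (n + 1) / x) * cyl a b (Suc n) x - cyl a b n x"

lemma ladder_cyl: "ladder (cyl a b)"
proof (rule ladder_recI[where Z = "cyl a b"])
  show "cyl a b 0 = (\<lambda>x. a * of_real (bessel_J_nat 0 x) + b * of_real (bessel_Y_nat 0 x))"
    "cyl a b (Suc 0) = (\<lambda>x. a * of_real (bessel_J_nat 1 x) + b * of_real (bessel_Y1 x))"
    by auto
  show "cyl a b (Suc (Suc n)) x = of_real (2 * real (n + 1) / x) * cyl a b (Suc n) x - cyl a b n x" for n x
    by simp
  fix x :: real assume x: "x > 0"
  show "((\<lambda>x. a * of_real (bessel_J_nat 0 x) + b * of_real (bessel_Y_nat 0 x)) has_vector_derivative
      - (a * of_real (bessel_J_nat 1 x) + b * of_real (bessel_Y1 x))) (at x)"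
    by (rule has_vector_derivative_eq_rhs, (rule derivative_intros has_vector_derivative_of_real
        bessel_J_nat_0_deriv[OF x] bessel_Y_0_deriv[OF x])+) simp
  show "((\<lambda>x. a * of_real (bessel_J_nat 1 x) + b * of_real (bessel_Y1 x)) has_vector_derivative
      a * of_real (bessel_J_nat 0 x) + b * of_real (bessel_Y_nat 0 x)
      - (a * of_real (bessel_J_nat 1 x) + b * of_real (bessel_Y1 x)) / of_real x) (at x)"
    by (rule has_vector_derivative_eq_rhs, (rule derivative_intros has_vector_derivative_of_real
        bessel_J_nat_1_deriv[OF x] bessel_Y1_deriv[OF x])+) (simp add: field_simps add_divide_distrib)
qed

text \<open>The left-hand side is constant, so its value is the limit at 0 from the right.\<close>

lemma bessel_wronskian:
  assumes x: "x > 0"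
  shows "x * (bessel_J_nat 1 x * bessel_Y_nat 0 x - bessel_J_nat 0 x * bessel_Y1 x) = 2 / pi"
proof -
  let ?W = "\<lambda>x. x * (bessel_J_nat 1 x * bessel_Y_nat 0 x - bessel_J_nat 0 x * bessel_Y1 x)"
  \<comment> \<open>\<open>?F\<close> is \<open>?W\<close> after the logarithmic terms, both
    multiples of J_0 J_1, have cancelled. Unlike \<open>?W\<close> it is continuous at 0, with value
    2 / pi.\<close>
  let ?F = "\<lambda>x. 2 / pi * (x * bessel_J_nat 1 x * pser harm_coeff (x\<^sup>2 / 4) + (bessel_J_nat 0 x)\<^sup>2
      + bessel_J_nat 0 x * x\<^sup>2 / 2 * pser (diffs harm_coeff) (x\<^sup>2 / 4))"
  have WF: "?W y = ?F y" if "y > 0" for y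
    using that unfolding bessel_Y_nat_0 bessel_Y1_def
    by (simp add: divide_simps) (simp add: algebra_simps power2_eq_square)
  have const: "?W y = ?W x" if "y > 0" for y
  proof -
    have w: "wronsk (cyl 1 0) (cyl 0 1) z = of_real (?W z)" for z
      by (simp add: wronsk_def)
    show ?thesis
      using ladder_wronsk_const[OF ladder_cyl[of 1 0] ladder_cyl[of 0 1] that x] unfolding w
      by (simp only: of_real_eq_iff)
  qed
  have ctsJ: "isCont (bessel_J_nat n) 0" for n
    unfolding bessel_J_nat_clif[abs_def]
    by (intro continuous_intros isCont_o2[where g = "clif n", OF _ DERIV_isCont[OF clif_deriv]]) auto
  have "isCont ?F 0"
    by (intro continuous_intros ctsJ isCont_o2[where g = "pser _", OF _ DERIV_isCont[OF pser_deriv]]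
        harm_coeff_bound diffs_bound) auto
  then have "(?F \<longlongrightarrow> ?F 0) (at_right 0)"
    unfolding isCont_def by (rule tendsto_within_subset) auto
  moreover have "\<forall>\<^sub>F y in at_right 0. ?F y = ?W x"
    by (rule eventually_mono[OF eventually_at_right_less[of 0]]) (rule trans[OF WF[symmetric] const])
  ultimately have "((\<lambda>_. ?W x) \<longlongrightarrow> ?F 0) (at_right (0::real))"
    by (rule Lim_transform_eventually)
  then have "?W x = ?F 0"
    by (rule tendsto_unique[OF trivial_limit_at_right_real tendsto_const])
  also have "\<dots> = 2 / pi" by (simp add: bessel_J_nat_clif)
  finally show ?thesis .
qed

lemma harm_coeff_values:
  "harm_coeff 0 = 0" "harm_coeff 1 = 1" "harm_coeff 2 = - 3 / 8" "harm_coeff 3 = 11 / 216"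
  by (simp_all add: harm_coeff_def harm_def eval_nat_numeral)

text \<open>Three terms of each series at t = 1/4, widened by the tail bound and rounded. The point
  x = 1 serves twice: it bounds the first zero of Y_0 from above, and the energy estimate for the
  outgoing solution starts there.\<close>

lemma series_values:
  "bessel_J_nat 0 1 \<in> {761/1000..770/1000}" "bessel_J_nat 1 1 \<in> {438/1000..443/1000}"
  "pser harm_coeff (1 / 4) \<in> {223/1000..231/1000}" "pser (diffs harm_coeff) (1 / 4) \<in> {818/1000..826/1000}"
proof -
  have cl: "clif n t = pser (\<lambda>k. (-1) ^ k / (fact k * fact (n + k))) t" for n t
    by (simp add: clif_def pser_def)
  have "\<bar>clif 0 (1 / 4) - (1 - 1 / 4 + 1 / 64)\<bar> \<le> 1 / 288"
    using pser_tail[OF clif_coeff_bound[of _ 0]] unfolding cl by (simp add: eval_nat_numeral)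
  then show "bessel_J_nat 0 1 \<in> {761/1000..770/1000}"
    unfolding bessel_J_nat_clif abs_le_iff by simp
  have "\<bar>clif 1 (1 / 4) - (1 - 1 / 8 + 1 / 192)\<bar> \<le> 1 / 288"
    using pser_tail[OF clif_coeff_bound[of _ 1]] unfolding cl by (simp add: eval_nat_numeral)
  then show "bessel_J_nat 1 1 \<in> {438/1000..443/1000}"
    unfolding bessel_J_nat_clif abs_le_iff by simp
  have "\<bar>pser harm_coeff (1 / 4) - (1 / 4 - 3 / 128)\<bar> \<le> 1 / 288"
    using pser_tail[of harm_coeff, OF harm_coeff_bound] by (simp only: harm_coeff_values)
  then show "pser harm_coeff (1 / 4) \<in> {223/1000..231/1000}"
    unfolding abs_le_iff by simp
  have d: "diffs harm_coeff 0 = 1" "diffs harm_coeff 1 = - 3 / 4" "diffs harm_coeff 2 = 11 / 72"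
    using harm_coeff_values by (simp_all add: diffs_def eval_nat_numeral)
  have "\<bar>pser (diffs harm_coeff) (1 / 4) - (1 - 3 / 16 + 11 / 1152)\<bar> \<le> 1 / 288"
    using pser_tail[of "diffs harm_coeff", OF diffs_bound[OF harm_coeff_bound], unfolded d] by simp
  then show "pser (diffs harm_coeff) (1 / 4) \<in> {818/1000..826/1000}"
    unfolding abs_le_iff by simp
qed

text \<open>Positivity of Y_0(1) will place the first zero of Y_0 below 1; the upper bounds enter
  the energy of Y_0 at 1.\<close>

lemma bessel_Y_values:
  "bessel_Y_nat 0 1 \<in> {0<..116/1000}" "- bessel_Y1 1 \<in> {0..824/1000}"
proof -
  define L where "L = ln (1 / 2 :: real) + euler_mascheroni"
  have L: "- 119 / 1000 \<le> L" "L \<le> - 75 / 1000"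
    using ln2_ge_two_thirds ln2_le_25_over_36 euler_mascheroni_gt_19_over_33 euler_mascheroni_less_13_over_22
    unfolding L_def by (auto simp: ln_div)
  note v = series_values[unfolded atLeastAtMost_iff]
  have M: "75 / 1000 \<le> - L" "- L \<le> 119 / 1000" using L by simp_all
  have LJ: "- L * bessel_J_nat 0 1 \<le> 119 / 1000 * (770 / 1000)"
    "75 / 1000 * (761 / 1000) \<le> - L * bessel_J_nat 0 1"
    "- L * bessel_J_nat 1 1 \<le> 119 / 1000 * (443 / 1000)" "0 * 0 \<le> - L * bessel_J_nat 1 1"
    by (rule mult_mono; use v M in linarith)+
  let ?A = "L * bessel_J_nat 0 1 + pser harm_coeff (1 / 4)"
  let ?B = "bessel_J_nat 0 1 - L * bessel_J_nat 1 1 + 1 / 2 * pser (diffs harm_coeff) (1 / 4)"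
  have A: "?A > 0" "?A \<le> 174 / 1000" and B: "?B \<ge> 0" "?B \<le> 1236 / 1000"
    using LJ v by simp_all
  have pi: "0 < 2 / pi" "2 / pi \<le> 2 / 3" using pi_gt3 by (auto simp: field_simps)
  have Y: "bessel_Y_nat 0 1 = 2 / pi * ?A" "- bessel_Y1 1 = 2 / pi * ?B"
    by (simp_all add: bessel_Y_nat_0 bessel_Y1_def L_def)
  have "2 / pi * ?A \<le> 2 / 3 * (174 / 1000)" "2 / pi * ?B \<le> 2 / 3 * (1236 / 1000)"
    using A B pi by (intro mult_mono; simp)+
  moreover have "2 / pi * ?A > 0" "2 / pi * ?B \<ge> 0"
    using A B pi by (auto intro: mult_pos_pos mult_nonneg_nonneg)
  ultimately show "bessel_Y_nat 0 1 \<in> {0<..116/1000}" "- bessel_Y1 1 \<in> {0..824/1000}"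
    unfolding Y by auto
qed

subsection \<open>Asymptotics of solutions of Bessel's equation\<close>

text \<open>Liouville's normal form: \<open>\<phi> = \<surd>s Z\<^sub>n\<close> solves \<open>\<phi>'' + Q \<phi> = 0\<close> with \<open>Q = liou_pot n\<close>;
  \<open>dliou\<close> is \<open>\<phi>'\<close>, written by means of the ladder relations.\<close>

definition liou :: "(nat \<Rightarrow> real \<Rightarrow> complex) \<Rightarrow> nat \<Rightarrow> real \<Rightarrow> complex" where
  "liou Z n s = of_real (sqrt s) * Z n s"

definition dliou :: "(nat \<Rightarrow> real \<Rightarrow> complex) \<Rightarrow> nat \<Rightarrow> real \<Rightarrow> complex" where
  "dliou Z n s = of_real (sqrt s) * (of_real ((real n + 1/2) / s) * Z n s - Z (Suc n) s)"

definition liou_pot :: "nat \<Rightarrow> real \<Rightarrow> real" where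
  "liou_pot n s = 1 - ((real n)\<^sup>2 - 1/4) / s\<^sup>2"

lemma sqrt_deriv: "s > 0 \<Longrightarrow> ((\<lambda>s. complex_of_real (sqrt s)) has_vector_derivative of_real (sqrt s / (2 * s))) (at s)"
proof -
  assume s: "s > 0"
  then have "inverse (sqrt s) / 2 = sqrt s / (2 * s)"
    using real_sqrt_mult_self[of s] by (simp add: divide_simps)
  then show ?thesis using has_vector_derivative_of_real[OF DERIV_real_sqrt[OF s]] by metis
qed

lemma liou_deriv:
  assumes "ladder Z" "s > 0"
  shows "(liou Z n has_vector_derivative dliou Z n s) (at s)"
proof -
  have z: "(Z n has_vector_derivative of_real (real n / s) * Z n s - Z (Suc n) s) (at s)"
    using assms unfolding ladder_def by blast
  show ?thesis unfolding liou_def[abs_def] dliou_def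
    by (rule has_vector_derivative_eq_rhs, (rule derivative_intros sqrt_deriv z assms)+)
      (use assms in \<open>simp add: field_simps\<close>)
qed

lemma dliou_deriv:
  assumes "ladder Z" "s > 0"
  shows "(dliou Z n has_vector_derivative - of_real (liou_pot n s) * liou Z n s) (at s)"
proof -
  have z: "(Z n has_vector_derivative of_real (real n / s) * Z n s - Z (Suc n) s) (at s)"
    "(Z (Suc n) has_vector_derivative Z n s - of_real (real (n + 1) / s) * Z (Suc n) s) (at s)"
    using assms unfolding ladder_def by blast+
  have d: "((\<lambda>s. complex_of_real ((real n + 1/2) / s)) has_vector_derivative of_real (- (real n + 1/2) / s\<^sup>2)) (at s)"
    by (rule has_vector_derivative_of_real)
      (use assms in \<open>auto intro!: derivative_eq_intros simp: power2_eq_square\<close>)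
  show ?thesis unfolding dliou_def[abs_def] liou_def liou_pot_def
    by (rule has_vector_derivative_eq_rhs, (rule derivative_intros sqrt_deriv d z assms)+)
      (use assms in \<open>simp add: field_simps power2_eq_square\<close>)
qed

lemma liou_wronsk:
  assumes "ladder Z" "ladder Z'" "s > 0"
  shows "liou Z n s * dliou Z' n s - dliou Z n s * liou Z' n s = wronsk Z Z' s"
proof -
  have q: "complex_of_real (sqrt s) * of_real (sqrt s) = of_real s"
    using assms by (simp flip: of_real_mult)
  have "liou Z n s * dliou Z' n s - dliou Z n s * liou Z' n s
    = of_real (sqrt s) * of_real (sqrt s) * (Z (Suc n) s * Z' n s - Z n s * Z' (Suc n) s)"
    unfolding liou_def dliou_def by (simp add: algebra_simps)
  then show ?thesis unfolding q ladder_wronsk[OF assms] .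
qed

lemma norm_sq_deriv:
  fixes f :: "real \<Rightarrow> complex"
  assumes "(f has_vector_derivative f') (at s)"
  shows "((\<lambda>s. (cmod (f s))\<^sup>2) has_real_derivative 2 * Re (cnj (f s) * f')) (at s)"
proof -
  have r: "((\<lambda>s. Re (f s)) has_real_derivative Re f') (at s)" "((\<lambda>s. Im (f s)) has_real_derivative Im f') (at s)"
    using bounded_linear.has_vector_derivative[OF bounded_linear_Re assms]
      bounded_linear.has_vector_derivative[OF bounded_linear_Im assms]
    by (simp_all add: has_real_derivative_iff_has_vector_derivative)
  show ?thesis unfolding cmod_power2
    by (rule DERIV_cong, (rule DERIV_add DERIV_power r)+) simp
qed

definition liou_energy :: "(nat \<Rightarrow> real \<Rightarrow> complex) \<Rightarrow> real \<Rightarrow> real" where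
  "liou_energy Z s = (cmod (dliou Z 0 s))\<^sup>2 + liou_pot 0 s * (cmod (liou Z 0 s))\<^sup>2"

text \<open>From phi'' = - Q phi the derivative of |phi'|^2 + Q |phi|^2 is Q' |phi|^2. At order zero
  Q = 1 + 1 / (4 s^2) decreases; for n >= 1 it increases, which is why bounds at infinity start from
  order zero.\<close>

lemma liou_energy_antimono:
  assumes Z: "ladder Z" and s: "0 < r" "r \<le> s"
  shows "liou_energy Z s \<le> liou_energy Z r"
proof (rule DERIV_nonpos_imp_nonincreasing[OF s(2)])
  fix x assume "r \<le> x" "x \<le> s"
  then have x: "x > 0" using s by simp
  have q: "(liou_pot 0 has_real_derivative - 1 / (2 * x ^ 3)) (at x)"
    unfolding liou_pot_def[abs_def] using x
    by (auto intro!: derivative_eq_intros simp: field_simps eval_nat_numeral)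
  have "(liou_energy Z has_real_derivative
      2 * Re (cnj (dliou Z 0 x) * (- of_real (liou_pot 0 x) * liou Z 0 x)) +
      ((- 1 / (2 * x ^ 3)) * (cmod (liou Z 0 x))\<^sup>2 + 2 * Re (cnj (liou Z 0 x) * dliou Z 0 x) * liou_pot 0 x)) (at x)"
    unfolding liou_energy_def[abs_def]
    by (intro DERIV_add DERIV_mult norm_sq_deriv q liou_deriv dliou_deriv Z x)
  also have "2 * Re (cnj (dliou Z 0 x) * (- of_real (liou_pot 0 x) * liou Z 0 x)) +
      ((- 1 / (2 * x ^ 3)) * (cmod (liou Z 0 x))\<^sup>2 + 2 * Re (cnj (liou Z 0 x) * dliou Z 0 x) * liou_pot 0 x)
      = (- 1 / (2 * x ^ 3)) * (cmod (liou Z 0 x))\<^sup>2"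
    by (simp add: algebra_simps)
  finally show "\<exists>y. (liou_energy Z has_real_derivative y) (at x) \<and> y \<le> 0"
    using x by (intro exI conjI) (auto simp: mult_nonpos_nonneg)
qed

lemma liou_pot_0_ge: "liou_pot 0 s \<ge> 1"
  by (simp add: liou_pot_def)

lemma liou_le_energy:
  "(cmod (dliou Z 0 s))\<^sup>2 + (cmod (liou Z 0 s))\<^sup>2 \<le> liou_energy Z s"
  unfolding liou_energy_def using mult_right_mono[OF liou_pot_0_ge[of s], of "(cmod (liou Z 0 s))\<^sup>2"] by simp

text \<open>The bound on f' is the derivative of - M / s^p, so the mean value inequality compares f
  with that function.\<close>

lemma decay_diff:
  fixes f :: "real \<Rightarrow> complex"
  assumes r0: "r0 > 0" "r0 \<le> s" "s \<le> t" and p: "p > 0"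
    and d: "\<And>s. s \<ge> r0 \<Longrightarrow> (f has_vector_derivative f' s) (at s)"
    and b: "\<And>s. s \<ge> r0 \<Longrightarrow> cmod (f' s) \<le> M * real p / s ^ Suc p"
  shows "cmod (f t - f s) \<le> M / s ^ p - M / t ^ p"
proof (cases "s = t")
  case False
  have phi: "((\<lambda>x. - (M / x ^ p)) has_real_derivative M * real p / x ^ Suc p) (at x)" if "x > 0" for x
  proof -
    obtain k where k: "p = Suc k" using p by (cases p) auto
    have "((\<lambda>x. x ^ Suc k) has_real_derivative real (Suc k) * x ^ k) (at x)"
      using DERIV_pow[of "Suc k" x] by simp
    then have "((\<lambda>x. - (M / x ^ Suc k)) has_real_derivative
        - ((0 * x ^ Suc k - M * (real (Suc k) * x ^ k)) / (x ^ Suc k * x ^ Suc k))) (at x)"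
      using that by (intro DERIV_minus DERIV_divide DERIV_const) auto
    moreover have "- ((0 * x ^ Suc k - M * (real (Suc k) * x ^ k)) / (x ^ Suc k * x ^ Suc k))
        = M * real (Suc k) / x ^ Suc (Suc k)"
      using that by (simp add: divide_simps)
    ultimately show ?thesis unfolding k by metis
  qed
  have "norm (f t - f s) \<le> - (M / t ^ p) - - (M / s ^ p)"
  proof (rule differentiable_bound_general)
    show "s < t" using False r0 by simp
    show "continuous_on {s..t} f"
      by (intro continuous_at_imp_continuous_on ballI has_vector_derivative_continuous[OF d])
        (use r0 in auto)
    show "continuous_on {s..t} (\<lambda>x. - (M / x ^ p))"
      using r0 by (intro continuous_intros) auto
    fix x assume x: "s < x" "x < t"
    show "(f has_vector_derivative f' x) (at x)" using d x r0 by simp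
    show "((\<lambda>x. - (M / x ^ p)) has_vector_derivative M * real p / x ^ Suc p) (at x)"
      using phi x r0 by (simp add: has_real_derivative_iff_has_vector_derivative)
    show "norm (f' x) \<le> M * real p / x ^ Suc p" using b x r0 by simp
  qed
  then show ?thesis by simp
qed simp

lemma decay_tendsto_0: "p > 0 \<Longrightarrow> ((\<lambda>s. M / s ^ p) \<longlongrightarrow> (0::real)) at_top"
  by (intro tendsto_divide_0[OF tendsto_const] filterlim_at_top_imp_at_infinity filterlim_pow_at_top filterlim_ident)

lemma decay_limit:
  fixes f :: "real \<Rightarrow> complex"
  assumes r0: "r0 > 0" and p: "p > 0" and M: "M \<ge> 0"
    and d: "\<And>s. s \<ge> r0 \<Longrightarrow> (f has_vector_derivative f' s) (at s)"
    and b: "\<And>s. s \<ge> r0 \<Longrightarrow> cmod (f' s) \<le> M * real p / s ^ Suc p"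
  shows "\<exists>L. \<forall>s\<ge>r0. cmod (f s - L) \<le> M / s ^ p"
proof -
  note dd = decay_diff[OF r0 _ _ p d b]
  have bound: "cmod (f t - f s) \<le> M / s ^ p" if "r0 \<le> s" "s \<le> t" for s t
  proof -
    have "cmod (f t - f s) \<le> M / s ^ p - M / t ^ p" by (rule dd) (use that in auto)
    moreover have "0 \<le> M / t ^ p" using M that r0 by simp
    ultimately show ?thesis by linarith
  qed
  define X where "X n = f (r0 + real n)" for n
  have lim0: "(\<lambda>n. M / (r0 + real n) ^ p) \<longlonglongrightarrow> 0"
    by (rule filterlim_compose[OF decay_tendsto_0[OF p]])
      (intro filterlim_tendsto_add_at_top[OF tendsto_const] filterlim_real_sequentially)
  have "Cauchy X"
  proof (rule metric_CauchyI)
    fix e :: real assume e: "e > 0"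
    from order_tendstoD(2)[OF lim0, of "e / 2"] e
    obtain N where N: "M / (r0 + real N) ^ p < e / 2" by (auto simp: eventually_sequentially)
    show "\<exists>N. \<forall>m\<ge>N. \<forall>n\<ge>N. dist (X m) (X n) < e"
    proof (intro exI allI impI)
      fix m n assume mn: "N \<le> m" "N \<le> n"
      have "dist (X k) (X N) < e / 2" if "N \<le> k" for k
        unfolding dist_norm X_def by (rule le_less_trans[OF bound N]) (use that r0 in auto)
      from this[OF mn(1)] this[OF mn(2)] show "dist (X m) (X n) < e"
        by (rule dist_triangle_half_l)
    qed
  qed
  then obtain L where L: "X \<longlonglongrightarrow> L" using Cauchy_convergent_iff convergent_def by blast
  have "cmod (f s - L) \<le> M / s ^ p" if s: "s \<ge> r0" for s
  proof -
    have "(\<lambda>n. cmod (f s - X n)) \<longlonglongrightarrow> cmod (f s - L)" by (intro tendsto_intros L)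
    moreover have "\<forall>\<^sub>F n in sequentially. cmod (f s - X n) \<le> M / s ^ p"
      using eventually_ge_at_top[of "nat \<lceil>s\<rceil>"]
    proof eventually_elim
      case (elim n)
      then have "s \<le> r0 + real n" using r0 by linarith
      from bound[OF s this] show ?case by (simp add: X_def norm_minus_commute)
    qed
    ultimately show ?thesis by (rule tendsto_upperbound) simp
  qed
  then show ?thesis by blast
qed

text \<open>This quantity has a limit at infinity, which is zero exactly for the outgoing solutions.\<close>

definition incoming_part :: "(nat \<Rightarrow> real \<Rightarrow> complex) \<Rightarrow> nat \<Rightarrow> real \<Rightarrow> complex" where
  "incoming_part Z n s = cis s * (dliou Z n s - \<i> * liou Z n s)"

lemma cis_deriv: "(cis has_vector_derivative \<i> * cis s) (at s)"
proof -
  have "((\<lambda>s. exp (of_real s * \<i>)) has_vector_derivative \<i> * exp (of_real s * \<i>)) (at s)"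
    by (rule has_vector_derivative_eq_rhs[OF exp_scaleR_has_vector_derivative_right[of \<i>, unfolded scaleR_conv_of_real]]) simp
  then show ?thesis by (simp add: cis_conv_exp[abs_def] mult.commute)
qed

text \<open>The terms with phi' cancel and phi'' + phi = (1 - Q) phi. As 1 - Q is of order s^(-2),
  the derivative is integrable wherever phi is bounded, and a limit exists.\<close>

lemma incoming_part_deriv:
  assumes "ladder Z" "s > 0"
  shows "(incoming_part Z n has_vector_derivative cis s * of_real (1 - liou_pot n s) * liou Z n s) (at s)"
  unfolding incoming_part_def[abs_def]
  by (rule has_vector_derivative_eq_rhs, (rule derivative_intros cis_deriv liou_deriv dliou_deriv assms)+)
    (simp add: algebra_simps)

lemma liou_bounded_0:
  assumes "ladder Z"
  shows "\<exists>C\<ge>0. \<forall>s\<ge>1. cmod (liou Z 0 s) \<le> C \<and> cmod (dliou Z 0 s) \<le> C"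
proof (intro exI conjI allI impI)
  show "0 \<le> sqrt (liou_energy Z 1)" using liou_le_energy[of Z 1] by (auto intro: order_trans[rotated])
  fix s :: real assume s: "s \<ge> 1"
  have e: "(cmod (dliou Z 0 s))\<^sup>2 + (cmod (liou Z 0 s))\<^sup>2 \<le> liou_energy Z 1"
    using liou_energy_antimono[OF assms, of 1 s] liou_le_energy[of Z s] s by simp
  show "cmod (liou Z 0 s) \<le> sqrt (liou_energy Z 1)" "cmod (dliou Z 0 s) \<le> sqrt (liou_energy Z 1)"
    by (rule real_le_rsqrt, use e zero_le_power2[of "cmod (dliou Z 0 s)"]
      zero_le_power2[of "cmod (liou Z 0 s)"] in linarith)+
qed

lemma incoming_part_limit:
  assumes Z: "ladder Z"
  shows "\<exists>M\<ge>0. \<exists>L. \<forall>s\<ge>1. cmod (incoming_part Z 0 s - L) \<le> M / s"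
proof -
  obtain C where C: "C \<ge> 0" "\<And>s. s \<ge> 1 \<Longrightarrow> cmod (liou Z 0 s) \<le> C"
    using liou_bounded_0[OF Z] by blast
  have "\<exists>L. \<forall>s\<ge>1. cmod (incoming_part Z 0 s - L) \<le> C / s ^ 1"
  proof (rule decay_limit[of 1 1 C])
    fix s :: real assume s: "s \<ge> 1"
    show "(incoming_part Z 0 has_vector_derivative cis s * of_real (1 - liou_pot 0 s) * liou Z 0 s) (at s)"
      by (rule incoming_part_deriv[OF Z]) (use s in simp)
    have p: "\<bar>1 - liou_pot 0 s\<bar> \<le> 1 / s\<^sup>2" using s by (simp add: liou_pot_def divide_simps)
    have "cmod (cis s * of_real (1 - liou_pot 0 s) * liou Z 0 s) = \<bar>1 - liou_pot 0 s\<bar> * cmod (liou Z 0 s)"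
      by (simp add: norm_mult del: of_real_diff)
    also have "\<dots> \<le> 1 / s\<^sup>2 * C" using p C s by (intro mult_mono) auto
    finally show "cmod (cis s * of_real (1 - liou_pot 0 s) * liou Z 0 s) \<le> C * real 1 / s ^ Suc 1"
      by (simp add: power2_eq_square)
  qed (use C in auto)
  then show ?thesis using C(1) by auto
qed

text \<open>The quadratic rate is stronger than a radiation condition. It ensures that s times the
  derivative of |phi|^2 tends to zero, as \<open>eventually_slow\<close> requires.\<close>

definition outgoing_at :: "(nat \<Rightarrow> real \<Rightarrow> complex) \<Rightarrow> nat \<Rightarrow> bool" where
  "outgoing_at Z n \<longleftrightarrow> (\<exists>C. \<forall>s\<ge>1. cmod (liou Z n s) \<le> C \<and> cmod (dliou Z n s - \<i> * liou Z n s) \<le> C / s\<^sup>2)"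

text \<open>An integration by parts improves the rate 1 / s to 1 / s^2: the derivative of the
  incoming part oscillates like exp (2 i s) / s^2, so its integral is smaller than its modulus
  suggests.\<close>

lemma outgoing_at_0:
  assumes Z: "ladder Z" and L: "\<And>s. s \<ge> 1 \<Longrightarrow> cmod (incoming_part Z 0 s) \<le> M / s"
  shows "outgoing_at Z 0"
proof -
  obtain C where C: "C \<ge> 0" "\<And>s. s \<ge> 1 \<Longrightarrow> cmod (liou Z 0 s) \<le> C"
    using liou_bounded_0[OF Z] by blast
  have M: "M \<ge> 0" using L[of 1] norm_ge_zero[of "incoming_part Z 0 1"] by linarith
  \<comment> \<open>The derivative of the incoming part is - exp (i s) phi / (4 s^2). Integrating
    the oscillation of exp (i s) phi divides by 2 i, whence the correction with 8 i; what remains of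
    \<open>K'\<close> is of order s^(-3).\<close>
  define K where "K s = incoming_part Z 0 s + cis s * liou Z 0 s * of_real (1 / s\<^sup>2) / (8 * \<i>)" for s
  define K' where "K' s = incoming_part Z 0 s * of_real (1 / s\<^sup>2) / (8 * \<i>)
    - cis s * liou Z 0 s * of_real (2 / s ^ 3) / (8 * \<i>)" for s
  have dK: "(K has_vector_derivative K' s) (at s)" if s: "s > 0" for s
  proof -
    have inv: "((\<lambda>s. complex_of_real (1 / s\<^sup>2)) has_vector_derivative of_real (- 2 / s ^ 3)) (at s)"
      by (rule has_vector_derivative_of_real)
        (use s in \<open>auto intro!: derivative_eq_intros simp: field_simps eval_nat_numeral\<close>)
    have "(K has_vector_derivative cis s * of_real (1 - liou_pot 0 s) * liou Z 0 s +
       (cis s * liou Z 0 s * of_real (- 2 / s ^ 3) + (cis s * dliou Z 0 s + \<i> * cis s * liou Z 0 s) * of_real (1 / s\<^sup>2)) / (8 * \<i>)) (at s)"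
      unfolding K_def[abs_def]
      by (rule derivative_intros incoming_part_deriv cis_deriv liou_deriv inv Z s)+
    also have "cis s * of_real (1 - liou_pot 0 s) * liou Z 0 s +
       (cis s * liou Z 0 s * of_real (- 2 / s ^ 3) + (cis s * dliou Z 0 s + \<i> * cis s * liou Z 0 s) * of_real (1 / s\<^sup>2)) / (8 * \<i>)
       = K' s"
    proof -
      have e: "c * (- (1 / 4) * q) * f + (c * f * (- t) + (c * g + \<i> * c * f) * q) / (8 * \<i>)
          = c * (g - \<i> * f) * q / (8 * \<i>) - c * f * t / (8 * \<i>)" for c f g q t :: complex
        by (simp add: field_simps)
      have "1 - liou_pot 0 s = - (1 / 4) * (1 / s\<^sup>2)" by (simp add: liou_pot_def)
      then have p: "complex_of_real (1 - liou_pot 0 s) = - (1 / 4) * of_real (1 / s\<^sup>2)"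
        by (simp only: of_real_mult of_real_minus) simp
      have t: "complex_of_real (- 2 / s ^ 3) = - of_real (2 / s ^ 3)" by simp
      show ?thesis unfolding K'_def incoming_part_def p t by (rule e)
    qed
    finally show ?thesis .
  qed
  have bK: "cmod (K' s) \<le> (M + C) * real 2 / s ^ Suc 2" if s: "s \<ge> 1" for s
  proof -
    have "cmod (incoming_part Z 0 s * of_real (1 / s\<^sup>2) / (8 * \<i>)) = cmod (incoming_part Z 0 s) * (1 / s\<^sup>2) / 8"
      using s by (simp add: norm_mult norm_divide norm_power)
    also have "\<dots> \<le> (M / s) * (1 / s\<^sup>2) / 8"
      using L[OF s] s by (intro divide_right_mono mult_right_mono) auto
    also have "\<dots> \<le> M * 2 / s ^ 3" using M s by (simp add: field_simps eval_nat_numeral)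
    finally have 1: "cmod (incoming_part Z 0 s * of_real (1 / s\<^sup>2) / (8 * \<i>)) \<le> M * 2 / s ^ 3" .
    have "cmod (cis s * liou Z 0 s * of_real (2 / s ^ 3) / (8 * \<i>)) = cmod (liou Z 0 s) * (2 / s ^ 3) / 8"
      using s by (simp add: norm_mult norm_divide norm_power)
    also have "\<dots> \<le> C * (2 / s ^ 3) / 8"
      using C(2)[OF s] s by (intro divide_right_mono mult_right_mono) auto
    also have "\<dots> \<le> C * 2 / s ^ 3" using C s by (simp add: field_simps)
    finally have 2: "cmod (cis s * liou Z 0 s * of_real (2 / s ^ 3) / (8 * \<i>)) \<le> C * 2 / s ^ 3" .
    have "cmod (K' s) \<le> M * 2 / s ^ 3 + C * 2 / s ^ 3"
      unfolding K'_def using 1 2 norm_triangle_ineq4 by (smt (verit))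
    then show ?thesis by (simp add: add_divide_distrib distrib_right eval_nat_numeral)
  qed
  obtain l where l: "\<And>s. s \<ge> 1 \<Longrightarrow> cmod (K s - l) \<le> (M + C) / s ^ 2"
    using decay_limit[of 1 2 "M + C" K K'] dK bK M C(1) by force
  have Kb: "cmod (K s - incoming_part Z 0 s) \<le> C / s\<^sup>2" if s: "s \<ge> 1" for s
  proof -
    have "cmod (K s - incoming_part Z 0 s) = cmod (liou Z 0 s) * (1 / s\<^sup>2) / 8"
      unfolding K_def using s by (simp add: norm_mult norm_divide norm_power)
    also have "\<dots> \<le> C * (1 / s\<^sup>2) / 8"
      using C(2)[OF s] s by (intro divide_right_mono mult_right_mono) auto
    also have "\<dots> \<le> C / s\<^sup>2" using C s by (simp add: field_simps)
    finally show ?thesis .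
  qed
  have "l = 0"
  proof -
    have "((\<lambda>s. (M + C) / s ^ 2 + C / s ^ 2 + M / s ^ 1) \<longlongrightarrow> 0 + 0 + 0) at_top"
      by (intro tendsto_add decay_tendsto_0) auto
    moreover have "\<forall>\<^sub>F s in at_top. cmod l \<le> (M + C) / s ^ 2 + C / s ^ 2 + M / s ^ 1"
      using eventually_ge_at_top[of 1]
    proof eventually_elim
      case (elim s)
      have "cmod l \<le> cmod (K s - l) + cmod (K s - incoming_part Z 0 s) + cmod (incoming_part Z 0 s)"
        using norm_triangle_ineq4[of "K s - incoming_part Z 0 s + incoming_part Z 0 s" "K s - l"]
          norm_triangle_ineq[of "K s - incoming_part Z 0 s" "incoming_part Z 0 s"] by simp
      then show ?case using l[OF elim] Kb[OF elim] L[OF elim] by simp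
    qed
    ultimately have "cmod l \<le> 0 + 0 + 0" by (intro tendsto_lowerbound) auto
    then show ?thesis by simp
  qed
  show ?thesis unfolding outgoing_at_def
  proof (intro exI allI impI conjI)
    fix s :: real assume s: "s \<ge> 1"
    show "cmod (liou Z 0 s) \<le> M + 2 * C" using C(1) C(2)[OF s] M by linarith
    have "cmod (dliou Z 0 s - \<i> * liou Z 0 s) = cmod (incoming_part Z 0 s)"
      by (simp add: incoming_part_def norm_mult)
    also have "\<dots> \<le> cmod (K s) + cmod (K s - incoming_part Z 0 s)"
      using norm_triangle_ineq4[of "K s" "K s - incoming_part Z 0 s"] by simp
    also have "\<dots> \<le> (M + C) / s\<^sup>2 + C / s\<^sup>2"
      using l[OF s] Kb[OF s] \<open>l = 0\<close> by simp
    also have "\<dots> = (M + 2 * C) / s\<^sup>2" by (simp add: add_divide_distrib)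
    finally show "cmod (dliou Z 0 s - \<i> * liou Z 0 s) \<le> (M + 2 * C) / s\<^sup>2" .
  qed
qed

lemma liou_Suc:
  assumes Z: "ladder Z" and s: "s > 0"
  shows "liou Z (Suc n) s = of_real ((real n + 1/2) / s) * liou Z n s - dliou Z n s"
    and "dliou Z (Suc n) s = of_real (- (real n + 1/2) / s\<^sup>2) * liou Z n s
      + of_real ((real n + 1/2) / s) * dliou Z n s + of_real (liou_pot n s) * liou Z n s"
proof -
  have l: "liou Z (Suc n) = (\<lambda>s. of_real ((real n + 1/2) / s) * liou Z n s - dliou Z n s)"
    by (rule ext) (simp add: liou_def dliou_def algebra_simps)
  then show "liou Z (Suc n) s = of_real ((real n + 1/2) / s) * liou Z n s - dliou Z n s" by simp
  have d: "((\<lambda>s. complex_of_real ((real n + 1/2) / s)) has_vector_derivative of_real (- (real n + 1/2) / s\<^sup>2)) (at s)"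
    by (rule has_vector_derivative_of_real)
      (use assms in \<open>auto intro!: derivative_eq_intros simp: power2_eq_square\<close>)
  have "(liou Z (Suc n) has_vector_derivative
    (of_real ((real n + 1/2) / s) * dliou Z n s + of_real (- (real n + 1/2) / s\<^sup>2) * liou Z n s) -
      (- of_real (liou_pot n s) * liou Z n s)) (at s)"
    unfolding l by (rule derivative_intros d liou_deriv dliou_deriv Z s)+
  with liou_deriv[OF Z s, of "Suc n"] show "dliou Z (Suc n) s = of_real (- (real n + 1/2) / s\<^sup>2) * liou Z n s
      + of_real ((real n + 1/2) / s) * dliou Z n s + of_real (liou_pot n s) * liou Z n s"
    by (metis (no_types, lifting) vector_derivative_unique_at add.commute diff_minus_eq_add minus_mult_left)
qed

text \<open>The ladder relations express order n + 1 through f = phi and e = phi' - i phi of order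
  n. In the new residual all contributions of f of order 1 and 1 / s cancel.\<close>

lemma outgoing_at_Suc:
  assumes Z: "ladder Z" and o: "outgoing_at Z n"
  shows "outgoing_at Z (Suc n)"
proof -
  obtain C where C: "\<And>s. s \<ge> 1 \<Longrightarrow> cmod (liou Z n s) \<le> C"
      "\<And>s. s \<ge> 1 \<Longrightarrow> cmod (dliou Z n s - \<i> * liou Z n s) \<le> C / s\<^sup>2"
    using o unfolding outgoing_at_def by blast
  have C0: "C \<ge> 0" using C(1)[of 1] norm_ge_zero[of "liou Z n 1"] by linarith
  \<comment> \<open>Large enough for both estimates below, which need n + 5/2 and n^2 + 2 n +
    7/4.\<close>
  define N where "N = (real n)\<^sup>2 + 2 * real n + 3"
  have N: "N \<ge> 3" by (simp add: N_def)
  show ?thesis unfolding outgoing_at_def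
  proof (intro exI allI impI conjI)
    fix s :: real assume s: "s \<ge> 1"
    then have s0: "s > 0" by simp
    define f e where "f = liou Z n s" and "e = dliou Z n s - \<i> * liou Z n s"
    have g: "dliou Z n s = e + \<i> * f" by (simp add: e_def f_def)
    have f: "cmod f \<le> C" and e: "cmod e \<le> C / s\<^sup>2" using C[OF s] by (auto simp: f_def e_def)
    have e': "cmod e \<le> C"
    proof -
      have "C / s\<^sup>2 \<le> C / 1" using C0 s by (intro divide_left_mono) auto
      then show ?thesis using e by simp
    qed
    define m0 where "m0 = complex_of_real ((real n + 1/2) / s)"
    have m: "cmod m0 \<le> real n + 1 / 2"
    proof -
      have "(real n + 1 / 2) / s \<le> (real n + 1 / 2) / 1" using s by (intro divide_left_mono) auto
      then show ?thesis using s0 unfolding m0_def by (simp only: norm_of_real) simp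
    qed
    have "liou Z (Suc n) s = m0 * f - e - \<i> * f" unfolding liou_Suc(1)[OF Z s0] g f_def[symmetric] m0_def[symmetric] by simp
    then have "cmod (liou Z (Suc n) s) \<le> cmod m0 * cmod f + cmod e + cmod f"
      using norm_triangle_ineq4[of "m0 * f - e" "\<i> * f"] norm_triangle_ineq4[of "m0 * f" e] by (simp add: norm_mult)
    also have "\<dots> \<le> (real n + 1/2) * C + C + C" using m f e' by (intro add_mono mult_mono) auto
    also have "\<dots> = (real n + 1/2 + 2) * C" by (simp add: algebra_simps)
    also have "\<dots> \<le> N * C" using C0 unfolding N_def by (intro mult_right_mono) auto
    finally show "cmod (liou Z (Suc n) s) \<le> N * C" .
    have p: "complex_of_real (liou_pot n s) = 1 - of_real (((real n)\<^sup>2 - 1/4) / s\<^sup>2)" by (simp add: liou_pot_def)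
    have "dliou Z (Suc n) s - \<i> * liou Z (Suc n) s =
      of_real (- (real n + 1/2) / s\<^sup>2) * f - of_real (((real n)\<^sup>2 - 1/4) / s\<^sup>2) * f + m0 * e + \<i> * e"
      unfolding liou_Suc[OF Z s0] g f_def[symmetric] m0_def[symmetric] p by (simp add: algebra_simps)
    also have "\<dots> = of_real (- (((real n)\<^sup>2 + real n + 1/4) / s\<^sup>2)) * f + m0 * e + \<i> * e"
      using s0 by (simp add: field_simps)
    finally have "cmod (dliou Z (Suc n) s - \<i> * liou Z (Suc n) s)
        \<le> cmod (of_real (- (((real n)\<^sup>2 + real n + 1/4) / s\<^sup>2)) * f) + cmod (m0 * e) + cmod (\<i> * e)"
      by (metis (no_types, lifting) norm_triangle_le norm_triangle_ineq add_mono order_refl)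
    also have "\<dots> = ((real n)\<^sup>2 + real n + 1/4) / s\<^sup>2 * cmod f + cmod m0 * cmod e + cmod e"
      using s0 by (simp add: norm_mult del: of_real_divide of_real_add)
    also have "\<dots> \<le> ((real n)\<^sup>2 + real n + 1/4) / s\<^sup>2 * C + (real n + 1/2) * (C / s\<^sup>2) + C / s\<^sup>2"
      using m f e s0 by (intro add_mono mult_mono) auto
    also have "\<dots> = ((real n)\<^sup>2 + real n + 1/4 + (real n + 1/2) + 1) * C / s\<^sup>2"
      using s0 by (simp add: field_simps)
    also have "\<dots> \<le> N * C / s\<^sup>2"
      using C0 s0 unfolding N_def by (intro divide_right_mono mult_right_mono) auto
    finally show "cmod (dliou Z (Suc n) s - \<i> * liou Z (Suc n) s) \<le> N * C / s\<^sup>2" .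
  qed
qed

lemma outgoing_at_all: "ladder Z \<Longrightarrow> outgoing_at Z 0 \<Longrightarrow> outgoing_at Z n"
  by (induction n) (auto intro: outgoing_at_Suc)

text \<open>Let Lu and Lv be the limits of the incoming parts of J_0 and Y_0. The choice tau = - Lu
  / Lv removes the incoming part. The Wronskian survives in the limit as Im (cnj Lu * Lv) = 2 / pi,
  so Lv is nonzero and Im tau = (2 / pi) / |Lv|^2; the decreasing energy bounds |Lu| and |Lv| by
  data at 1. For comparison, the Hankel function corresponds to tau = i.\<close>

lemma ex_outgoing_cyl:
  "\<exists>\<tau>. Im \<tau> > 0 \<and> (1 + (cmod \<tau>)\<^sup>2) * (2 / pi)\<^sup>2 \<le> 5 / 4 * (Im \<tau>)\<^sup>2 \<and> (\<forall>n. outgoing_at (cyl 1 \<tau>) n)"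
proof -
  let ?u = "cyl 1 0" and ?v = "cyl 0 1"
  obtain Mu Lu Mv Lv where M: "Mu \<ge> 0" "Mv \<ge> 0"
    and u: "\<And>s. s \<ge> 1 \<Longrightarrow> cmod (incoming_part ?u 0 s - Lu) \<le> Mu / s"
    and v: "\<And>s. s \<ge> 1 \<Longrightarrow> cmod (incoming_part ?v 0 s - Lv) \<le> Mv / s"
    using incoming_part_limit[OF ladder_cyl] by meson
  have lim: "((\<lambda>s. f s) \<longlongrightarrow> L) at_top" if "\<And>s. s \<ge> 1 \<Longrightarrow> cmod (f s - L) \<le> M / s" for f L M
  proof (subst Lim_null, rule Lim_null_comparison)
    show "\<forall>\<^sub>F s in at_top. norm (f s - L) \<le> M / s ^ 1"
      using eventually_ge_at_top[of 1] by eventually_elim (use that in simp)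
    show "((\<lambda>s. M / s ^ 1) \<longlongrightarrow> 0) at_top" by (rule decay_tendsto_0) simp
  qed
  note lu = lim[OF u] and lv = lim[OF v]
  have sq: "(cmod (incoming_part ?u 0 s))\<^sup>2 \<le> liou_energy ?u 1" "(cmod (incoming_part ?v 0 s))\<^sup>2 \<le> liou_energy ?v 1"
    if s: "s \<ge> 1" for s
  proof -
    \<comment> \<open>J_0 and Y_0 are real, so |phi' - i phi|^2 = phi'^2 + phi^2, which the energy
      dominates.\<close>
    have e: "(cmod (a - \<i> * b))\<^sup>2 = (cmod a)\<^sup>2 + (cmod b)\<^sup>2" if "Im a = 0" "Im b = 0" for a b
      using that by (simp add: cmod_power2)
    have im: "Im (liou ?u 0 s) = 0" "Im (dliou ?u 0 s) = 0" "Im (liou ?v 0 s) = 0" "Im (dliou ?v 0 s) = 0"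
      by (simp_all add: liou_def dliou_def)
    show "(cmod (incoming_part ?u 0 s))\<^sup>2 \<le> liou_energy ?u 1" "(cmod (incoming_part ?v 0 s))\<^sup>2 \<le> liou_energy ?v 1"
      unfolding incoming_part_def norm_mult using e im
        order_trans[OF liou_le_energy liou_energy_antimono[OF ladder_cyl _ s]] by simp_all
  qed
  have U: "(cmod Lu)\<^sup>2 \<le> liou_energy ?u 1"
    by (rule tendsto_upperbound[OF tendsto_power[OF tendsto_norm[OF lu]]])
      (auto intro: eventually_mono[OF eventually_ge_at_top[of 1]] sq)
  have V: "(cmod Lv)\<^sup>2 \<le> liou_energy ?v 1"
    by (rule tendsto_upperbound[OF tendsto_power[OF tendsto_norm[OF lv]]])
      (auto intro: eventually_mono[OF eventually_ge_at_top[of 1]] sq)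
  \<comment> \<open>The phases cancel in the product, and Im ((u' + i u) (v' - i v)) = u v' - u' v
    for real u and v.\<close>
  have w: "Im (cnj (incoming_part ?u 0 s) * incoming_part ?v 0 s) = 2 / pi" if s: "s \<ge> 1" for s
  proof -
    have s0: "s > 0" using s by simp
    have "Re (liou ?u 0 s) * Re (dliou ?v 0 s) - Re (dliou ?u 0 s) * Re (liou ?v 0 s) = Re (wronsk ?u ?v s)"
      unfolding liou_wronsk[OF ladder_cyl ladder_cyl s0, where n = 0, symmetric]
      by (simp add: liou_def dliou_def)
    also have "\<dots> = 2 / pi" using bessel_wronskian[OF s0] by (simp add: wronsk_def)
    finally have w: "Re (liou ?u 0 s) * Re (dliou ?v 0 s) - Re (dliou ?u 0 s) * Re (liou ?v 0 s) = 2 / pi" .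
    have "cnj (incoming_part ?u 0 s) * incoming_part ?v 0 s
        = (cnj (cis s) * cis s) * (cnj (dliou ?u 0 s - \<i> * liou ?u 0 s) * (dliou ?v 0 s - \<i> * liou ?v 0 s))"
      by (simp add: incoming_part_def)
    also have "cnj (cis s) * cis s = 1" by (simp add: cis_cnj cis_mult)
    finally show ?thesis using w by (simp add: liou_def dliou_def)
  qed
  have W: "Im (cnj Lu * Lv) = 2 / pi"
  proof (rule tendsto_unique[OF trivial_limit_at_top_linorder])
    show "((\<lambda>s. Im (cnj (incoming_part ?u 0 s) * incoming_part ?v 0 s)) \<longlongrightarrow> Im (cnj Lu * Lv)) at_top"
      by (intro tendsto_intros lu lv)
    show "((\<lambda>s. Im (cnj (incoming_part ?u 0 s) * incoming_part ?v 0 s)) \<longlongrightarrow> 2 / pi) at_top"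
      by (rule tendsto_eventually, rule eventually_mono[OF eventually_ge_at_top[of 1]]) (rule w)
  qed
  then have Lv: "Lv \<noteq> 0" using pi_gt_zero by auto
  define \<tau> where "\<tau> = - Lu / Lv"
  define u1 v1 where "u1 = (cmod Lu)\<^sup>2" and "v1 = (cmod Lv)\<^sup>2"
  have v1: "v1 > 0" using Lv by (simp add: v1_def)
  have "\<tau> = - (Lu * cnj Lv) / of_real v1"
    using Lv unfolding \<tau>_def v1_def complex_norm_square by (simp add: field_simps)
  moreover have "Im (- (Lu * cnj Lv)) = 2 / pi" using W by (simp add: algebra_simps)
  ultimately have im: "Im \<tau> = 2 / pi / v1" by (simp only: Im_divide_of_real)
  have md: "(cmod \<tau>)\<^sup>2 = u1 / v1" by (simp add: \<tau>_def norm_divide power_divide u1_def v1_def)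
  have J: "bessel_J_nat 0 1 \<le> 77/100" "bessel_J_nat 0 1 \<ge> 76/100" "\<bar>bessel_J_nat 0 1 / 2 - bessel_J_nat 1 1\<bar> \<le> 7/100"
    using series_values by auto
  have Y: "bessel_Y_nat 0 1 \<le> 12/100" "bessel_Y_nat 0 1 \<ge> 0" "\<bar>bessel_Y_nat 0 1 / 2 - bessel_Y1 1\<bar> \<le> 8825/10000"
    using bessel_Y_values by auto
  have "liou_energy ?u 1 = (bessel_J_nat 0 1 / 2 - bessel_J_nat 1 1)\<^sup>2 + 5 / 4 * (bessel_J_nat 0 1)\<^sup>2"
    by (simp add: liou_energy_def liou_def dliou_def liou_pot_def cmod_power2)
  also have "\<dots> \<le> (7/100)\<^sup>2 + 5 / 4 * (77/100)\<^sup>2"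
    using J by (intro add_mono mult_left_mono power_mono abs_le_square_iff[THEN iffD1]) auto
  finally have u1: "u1 \<le> 75/100" using U unfolding u1_def by (simp add: power2_eq_square)
  have "liou_energy ?v 1 = (bessel_Y_nat 0 1 / 2 - bessel_Y1 1)\<^sup>2 + 5 / 4 * (bessel_Y_nat 0 1)\<^sup>2"
    by (simp add: liou_energy_def liou_def dliou_def liou_pot_def cmod_power2)
  also have "\<dots> \<le> (8825/10000)\<^sup>2 + 5 / 4 * (12/100)\<^sup>2"
    using Y by (intro add_mono mult_left_mono power_mono abs_le_square_iff[THEN iffD1]) auto
  finally have v1': "v1 \<le> 80/100" using V unfolding v1_def by (simp add: power2_eq_square)
  \<comment> \<open>Multiplied by |Lv|^4 and divided by (2 / pi)^2, the claimed bound on tau reads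
    v1 (u1 + v1) <= 5/4; the numerical bounds give 1.24.\<close>
  have "v1 * (u1 + v1) \<le> 80/100 * (75/100 + 80/100)"
    using u1 v1 v1' by (intro mult_mono add_mono) (auto simp: u1_def)
  then have "v1 * (u1 + v1) \<le> 5 / 4" by simp
  then have "v1 * (u1 + v1) * ((2 / pi)\<^sup>2 / v1\<^sup>2) \<le> 5 / 4 * ((2 / pi)\<^sup>2 / v1\<^sup>2)"
    by (intro mult_right_mono) auto
  moreover have "v1 * (u1 + v1) * ((2 / pi)\<^sup>2 / v1\<^sup>2) = (1 + u1 / v1) * (2 / pi)\<^sup>2"
    using v1 by (simp add: field_simps power2_eq_square)
  ultimately have bound: "(1 + (cmod \<tau>)\<^sup>2) * (2 / pi)\<^sup>2 \<le> 5 / 4 * (Im \<tau>)\<^sup>2"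
    unfolding md im by (simp add: power_divide power_mult_distrib)
  have lin: "incoming_part (cyl 1 \<tau>) 0 s = incoming_part ?u 0 s + \<tau> * incoming_part ?v 0 s" for s
    by (simp add: incoming_part_def liou_def dliou_def algebra_simps)
  have "outgoing_at (cyl 1 \<tau>) 0"
  proof (rule outgoing_at_0[OF ladder_cyl, where M = "Mu + cmod \<tau> * Mv"])
    fix s :: real assume s: "s \<ge> 1"
    have "incoming_part (cyl 1 \<tau>) 0 s = (incoming_part ?u 0 s - Lu) + \<tau> * (incoming_part ?v 0 s - Lv)"
      unfolding lin using Lv by (simp add: \<tau>_def algebra_simps)
    then have "cmod (incoming_part (cyl 1 \<tau>) 0 s)
        \<le> cmod (incoming_part ?u 0 s - Lu) + cmod \<tau> * cmod (incoming_part ?v 0 s - Lv)"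
      by (metis norm_mult norm_triangle_ineq)
    also have "\<dots> \<le> Mu / s + cmod \<tau> * (Mv / s)"
      using u[OF s] v[OF s] by (intro add_mono mult_left_mono) auto
    finally show "cmod (incoming_part (cyl 1 \<tau>) 0 s) \<le> (Mu + cmod \<tau> * Mv) / s"
      by (simp add: add_divide_distrib)
  qed
  then have "\<forall>n. outgoing_at (cyl 1 \<tau>) n" using outgoing_at_all[OF ladder_cyl] by blast
  moreover have "Im \<tau> > 0" using im v1 by simp
  ultimately show ?thesis using bound by blast
qed

subsection \<open>Monotonicity of the modulus of the outgoing functions\<close>

lemma liou_cnj: "liou (\<lambda>n x. cnj (Z n x)) n s = cnj (liou Z n s)"
  by (simp add: liou_def)

lemma dliou_cnj: "dliou (\<lambda>n x. cnj (Z n x)) n s = cnj (dliou Z n s)"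
  by (simp add: dliou_def)

text \<open>The Wronskian of the conjugate sequence with Z is 2 i Im (cnj phi * phi'), twice the
  radiated energy flux up to the factor i. It depends neither on the point nor on the order, so
  evaluation at 1 is as good as any.\<close>

definition flux :: "(nat \<Rightarrow> real \<Rightarrow> complex) \<Rightarrow> real" where
  "flux Z = Im (wronsk (\<lambda>n x. cnj (Z n x)) Z 1) / 2"

lemma liou_flux:
  assumes "ladder Z" "s > 0"
  shows "Im (cnj (liou Z n s) * dliou Z n s) = flux Z"
proof -
  have "Im (wronsk (\<lambda>n x. cnj (Z n x)) Z s) = 2 * Im (cnj (liou Z n s) * dliou Z n s)"
    unfolding liou_wronsk[OF ladder_cnj[OF assms(1)] assms, of n, symmetric] liou_cnj dliou_cnj by simp
  moreover have "wronsk (\<lambda>n x. cnj (Z n x)) Z s = wronsk (\<lambda>n x. cnj (Z n x)) Z 1"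
    by (rule ladder_wronsk_const[OF ladder_cnj]) (use assms in auto)
  ultimately show ?thesis by (simp add: flux_def)
qed

lemma flux_cyl: "flux (cyl 1 \<tau>) = 2 / pi * Im \<tau>"
proof -
  have "Im (wronsk (\<lambda>n x. cnj (cyl 1 \<tau> n x)) (cyl 1 \<tau>) 1)
      = 2 * Im \<tau> * (bessel_J_nat 1 1 * bessel_Y_nat 0 1 - bessel_J_nat 0 1 * bessel_Y1 1)"
    by (simp add: wronsk_def algebra_simps)
  then show ?thesis using bessel_wronskian[of 1] by (simp add: flux_def)
qed

text \<open>Both follow from cnj p * d = w1 / 2 + i c, the first after multiplying a p d by |p|^2.
  In \<open>w1_nonpos_if\<close> the first makes the derivative of \<open>N\<close> collapse to one
  term of known sign, the second evaluates \<open>N\<close> at r.\<close>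

lemma wave_identities:
  fixes p d a :: complex and c w1 :: real
  assumes c: "c = Im (cnj p * d)" and w1: "w1 = 2 * Re (cnj p * d)"
  shows "2 * c * Im (a * p\<^sup>2) - w1 * Re (a * p\<^sup>2) + 2 * (cmod p)\<^sup>2 * Re (a * p * d) = 0"
    and "Im ((cnj p)\<^sup>2 * d\<^sup>2) = c * w1"
proof -
  have pd: "cnj p * d = Complex (w1 / 2) c" by (simp add: complex_eq_iff c w1)
  have "of_real ((cmod p)\<^sup>2) * (a * p * d) = a * p\<^sup>2 * (cnj p * d)"
    unfolding complex_norm_square by (simp only: power2_eq_square mult_ac)
  then have "Re (of_real ((cmod p)\<^sup>2) * (a * p * d)) = Re (a * p\<^sup>2 * Complex (w1 / 2) c)"
    unfolding pd by (rule arg_cong)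
  then have "(cmod p)\<^sup>2 * Re (a * p * d) = Re (a * p\<^sup>2) * (w1 / 2) - Im (a * p\<^sup>2) * c" 
  proof -
    have "Re (of_real t * z) = t * Re z" "Re (z * Complex x y) = Re z * x - Im z * y" for t x y z by simp_all
    with \<open>Re _ = Re _\<close> show ?thesis by (simp only:)
  qed
  then show "2 * c * Im (a * p\<^sup>2) - w1 * Re (a * p\<^sup>2) + 2 * (cmod p)\<^sup>2 * Re (a * p * d) = 0" by argo
  have "(cnj p)\<^sup>2 * d\<^sup>2 = (Complex (w1 / 2) c)\<^sup>2" unfolding pd[symmetric] by (simp add: power_mult_distrib)
  then show "Im ((cnj p)\<^sup>2 * d\<^sup>2) = c * w1" by (simp add: power2_eq_square)
qed

locale outgoing_wave =
  fixes Z :: "nat \<Rightarrow> real \<Rightarrow> complex" and n :: nat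
  assumes Z: "ladder Z" and outgoing: "outgoing_at Z n" and n: "n \<ge> 1" and flux_pos: "flux Z > 0"
begin

abbreviation "p \<equiv> liou Z n"
abbreviation "d \<equiv> dliou Z n"
definition w where "w s = (cmod (p s))\<^sup>2"
definition w1 where "w1 s = 2 * Re (cnj (p s) * d s)"
definition mu where "mu = (real n)\<^sup>2 - 1 / 4"

lemma mu_pos: "mu > 0"
proof -
  have "1\<^sup>2 \<le> (real n)\<^sup>2" using n by (intro power_mono) auto
  then show ?thesis by (simp add: mu_def)
qed

lemma w_deriv: "s > 0 \<Longrightarrow> (w has_real_derivative w1 s) (at s)"
  unfolding w_def[abs_def] w1_def by (intro norm_sq_deriv liou_deriv Z)

lemma w_pos: "s > 0 \<Longrightarrow> w s > 0"
  using liou_flux[OF Z, of s n] flux_pos by (auto simp: w_def)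

lemma cont_p: "s > 0 \<Longrightarrow> isCont p s" and cont_d: "s > 0 \<Longrightarrow> isCont d s"
  using has_vector_derivative_continuous[OF liou_deriv[OF Z]]
    has_vector_derivative_continuous[OF dliou_deriv[OF Z]] by blast+

lemma ex_bound: "\<exists>C\<ge>0. \<forall>s\<ge>1. cmod (p s) \<le> C \<and> cmod (d s - \<i> * p s) \<le> C / s\<^sup>2"
proof -
  obtain C where C: "\<forall>s\<ge>1. cmod (p s) \<le> C \<and> cmod (d s - \<i> * p s) \<le> C / s\<^sup>2"
    using outgoing unfolding outgoing_at_def by blast
  moreover have "C \<ge> 0" using C norm_ge_zero[of "p 1"] by (meson order_refl order_trans)
  ultimately show ?thesis by blast
qed

text \<open>At infinity |phi|^2 tends to the flux, which is positive, while s times its derivative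
  tends to 0.\<close>

lemma eventually_slow: "\<forall>\<^sub>F s in at_top. 2 * s * w1 s < 3 * w s"
proof -
  obtain C where C0: "C \<ge> 0" and C: "\<And>s. s \<ge> 1 \<Longrightarrow> cmod (p s) \<le> C" "\<And>s. s \<ge> 1 \<Longrightarrow> cmod (d s - \<i> * p s) \<le> C / s\<^sup>2"
    using ex_bound by blast
  have "((\<lambda>s. 4 * C\<^sup>2 / s ^ 1 + 3 * C\<^sup>2 / s ^ 2) \<longlongrightarrow> 0 + 0) at_top"
    by (intro tendsto_add decay_tendsto_0) auto
  then have "\<forall>\<^sub>F s in at_top. 4 * C\<^sup>2 / s ^ 1 + 3 * C\<^sup>2 / s ^ 2 < 3 * flux Z"
    by (rule order_tendstoD) (use flux_pos in simp)
  with eventually_ge_at_top[of 1] show ?thesis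
  proof eventually_elim
    case (elim s)
    define e where "e = d s - \<i> * p s"
    have de: "d s = e + \<i> * p s" by (simp add: e_def)
    have pe: "cmod (cnj (p s) * e) \<le> C * (C / s\<^sup>2)"
      using C[OF elim(1)] C0 elim unfolding e_def norm_mult complex_mod_cnj by (intro mult_mono) auto
    have "w1 s = 2 * Re (cnj (p s) * e)"
      unfolding w1_def de by (simp add: algebra_simps)
    then have "w1 s \<le> 2 * (C * (C / s\<^sup>2))" using pe abs_Re_le_cmod[of "cnj (p s) * e"] by linarith
    then have "2 * s * w1 s \<le> 2 * s * (2 * (C * (C / s\<^sup>2)))" using elim by (intro mult_left_mono) auto
    also have "\<dots> = 4 * C\<^sup>2 / s" using elim by (simp add: field_simps power2_eq_square)
    finally have 1: "2 * s * w1 s \<le> 4 * C\<^sup>2 / s" .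
    have "flux Z = w s + Im (cnj (p s) * e)"
      using liou_flux[OF Z, of s n] elim unfolding de w_def cmod_power2
      by (simp add: algebra_simps power2_eq_square)
    then have "w s \<ge> flux Z - C * (C / s\<^sup>2)" using pe abs_Im_le_cmod[of "cnj (p s) * e"] by linarith
    then have "3 * w s \<ge> 3 * flux Z - 3 * C\<^sup>2 / s\<^sup>2" by (simp add: power2_eq_square)
    with 1 elim(2) show ?case by simp
  qed
qed

text \<open>\<open>N\<close> below vanishes at infinity, equals a positive multiple of \<open>w'\<close> at \<open>r\<close>, and is
  increasing as long as \<open>2 s w' \<le> 3 w\<close>.\<close>

lemma w1_nonpos_if:
  assumes r: "r > 0" and slow: "\<And>s. s > r \<Longrightarrow> 2 * s * w1 s \<le> 3 * w s"
  shows "w1 r \<le> 0"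
proof -
  define c where "c = flux Z"
  have c: "c > 0" using flux_pos by (simp add: c_def)
  define A where "A = (cnj (p r))\<^sup>2"
  \<comment> \<open>With z = cnj (p r) * p s this is |z|^2 - Re (z^2) = 2 (Im z)^2: it is
    nonnegative and vanishes at s = r.\<close>
  define K where "K s = w r * w s - Re (A * (p s)\<^sup>2)" for s
  \<comment> \<open>As phi'' = - Q phi, the first term has derivative 2 mu / s^3 * Im (A p^2), which
    has no fixed sign. The second term is the correction that makes the derivative a multiple of
    \<open>K\<close>.\<close>
  define N where "N s = Im (A * ((d s)\<^sup>2 + of_real (liou_pot n s) * (p s)\<^sup>2)) - mu / c * (1 / s ^ 3 * (w s * K s))" for s
  have A: "cmod A = w r" by (simp add: A_def w_def norm_power)
  have K0: "K s \<ge> 0" for s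
    using complex_Re_le_cmod[of "A * (p s)\<^sup>2"] by (simp add: K_def norm_mult A w_def norm_power)
  have dN: "(N has_real_derivative - (mu / c) * ((2 * s * w1 s - 3 * w s) / s ^ 4 * K s)) (at s)"
    if s: "s > 0" for s
  proof -
    have q: "((\<lambda>s. complex_of_real (liou_pot n s)) has_vector_derivative of_real (2 * mu / s ^ 3)) (at s)"
      unfolding liou_pot_def mu_def
      by (rule has_vector_derivative_of_real)
        (use s in \<open>auto intro!: derivative_eq_intros simp: field_simps eval_nat_numeral\<close>)
    have i: "((\<lambda>s. 1 / s ^ 3) has_real_derivative - 3 / s ^ 4) (at s)"
      using s by (auto intro!: derivative_eq_intros simp: field_simps eval_nat_numeral)
    have "((\<lambda>s. A * (d s * d s + of_real (liou_pot n s) * (p s * p s))) has_vector_derivative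
        A * ((d s * (- of_real (liou_pot n s) * p s) + (- of_real (liou_pot n s) * p s) * d s)
          + (of_real (liou_pot n s) * (p s * d s + d s * p s) + of_real (2 * mu / s ^ 3) * (p s * p s)))) (at s)"
      by (rule derivative_intros liou_deriv dliou_deriv q Z s)+
    note I0 = bounded_linear.has_vector_derivative[OF bounded_linear_Im this]
    have I: "((\<lambda>s. Im (A * ((d s)\<^sup>2 + of_real (liou_pot n s) * (p s)\<^sup>2))) has_real_derivative
        2 * mu / s ^ 3 * Im (A * (p s)\<^sup>2)) (at s)"
      unfolding has_real_derivative_iff_has_vector_derivative power2_eq_square
    proof (rule has_vector_derivative_eq_rhs[OF I0])
      have "A * ((d s * (- of_real (liou_pot n s) * p s) + (- of_real (liou_pot n s) * p s) * d s)
          + (of_real (liou_pot n s) * (p s * d s + d s * p s) + of_real (2 * mu / s ^ 3) * (p s * p s)))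
          = of_real (2 * mu / s ^ 3) * (A * (p s * p s))" by (simp add: algebra_simps)
      moreover have "Im (of_real t * z) = t * Im z" for t z by simp
      ultimately show "Im (A * ((d s * (- of_real (liou_pot n s) * p s) + (- of_real (liou_pot n s) * p s) * d s)
          + (of_real (liou_pot n s) * (p s * d s + d s * p s) + of_real (2 * mu / s ^ 3) * (p s * p s))))
          = 2 * mu / s ^ 3 * Im (A * (p s * p s))" by (simp only:)
    qed
    have "((\<lambda>s. A * (p s * p s)) has_vector_derivative A * (p s * d s + d s * p s)) (at s)"
      by (rule derivative_intros liou_deriv Z s)+
    from bounded_linear.has_vector_derivative[OF bounded_linear_Re this]
    have "((\<lambda>s. Re (A * (p s)\<^sup>2)) has_real_derivative 2 * Re (A * p s * d s)) (at s)"
      unfolding has_real_derivative_iff_has_vector_derivative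
      by (simp add: power2_eq_square algebra_simps)
    then have dK: "(K has_real_derivative w r * w1 s - 2 * Re (A * p s * d s)) (at s)"
      unfolding K_def[abs_def] by (intro DERIV_diff DERIV_cmult w_deriv s)
    have id: "2 * c * Im (A * (p s)\<^sup>2) - w1 s * Re (A * (p s)\<^sup>2) + 2 * w s * Re (A * p s * d s) = 0"
      unfolding w_def by (rule wave_identities(1)) (simp_all only: w1_def c_def liou_flux[OF Z s])
    have "(N has_real_derivative 2 * mu / s ^ 3 * Im (A * (p s)\<^sup>2)
      - mu / c * (- 3 / s ^ 4 * (w s * K s) + (w1 s * K s + (w r * w1 s - 2 * Re (A * p s * d s)) * w s) * (1 / s ^ 3))) (at s)"
      unfolding N_def[abs_def]
      by (intro DERIV_diff DERIV_cmult DERIV_mult I i w_deriv dK s)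
    also have "2 * mu / s ^ 3 * Im (A * (p s)\<^sup>2)
      - mu / c * (- 3 / s ^ 4 * (w s * K s) + (w1 s * K s + (w r * w1 s - 2 * Re (A * p s * d s)) * w s) * (1 / s ^ 3))
      = - (mu / c) * ((2 * s * w1 s - 3 * w s) / s ^ 4 * K s)"
    proof -
      have ring: "2 * mu / s ^ 3 * I - mu / c * (- 3 / s ^ 4 * (x * k) + (y * k + (v * y - 2 * t) * x) * (1 / s ^ 3))
          - (- (mu / c) * ((2 * s * y - 3 * x) / s ^ 4 * k))
          = mu / (c * s ^ 3) * (2 * c * I + y * k - v * y * x + 2 * x * t)" for I x y k v t
        using s c by (simp add: field_simps eval_nat_numeral)
      have "2 * c * Im (A * (p s)\<^sup>2) + w1 s * K s - w r * w1 s * w s + 2 * w s * Re (A * p s * d s) = 0"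
        using id unfolding K_def by (simp add: algebra_simps)
      then show ?thesis using ring[of "Im (A * (p s)\<^sup>2)" "w s" "K s" "w1 s" "w r" "Re (A * p s * d s)"] by simp
    qed
    finally show ?thesis .
  qed
  have mono: "N r \<le> N t" if t: "t \<ge> r" for t
  proof (rule DERIV_nonneg_imp_increasing_open[OF t])
    fix s assume s: "r < s" "s < t"
    have "(2 * s * w1 s - 3 * w s) / s ^ 4 \<le> 0"
      using slow[OF s(1)] s r by (intro divide_nonpos_pos) auto
    then have "(2 * s * w1 s - 3 * w s) / s ^ 4 * K s \<le> 0" using K0 by (rule mult_nonpos_nonneg)
    then have "0 \<le> - (mu / c) * ((2 * s * w1 s - 3 * w s) / s ^ 4 * K s)"
      using mu_pos c by (intro mult_nonpos_nonpos) auto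
    moreover have "s > 0" using s r by simp
    ultimately show "\<exists>y. (N has_real_derivative y) (at s) \<and> 0 \<le> y" using dN by blast
  next
    show "continuous_on {r..t} N"
      by (intro continuous_at_imp_continuous_on ballI DERIV_isCont[OF dN]) (use r in auto)
  qed
  obtain C where C0: "C \<ge> 0" and C: "\<And>s. s \<ge> 1 \<Longrightarrow> cmod (p s) \<le> C" "\<And>s. s \<ge> 1 \<Longrightarrow> cmod (d s - \<i> * p s) \<le> C / s\<^sup>2"
    using ex_bound by blast
  define D where "D = w r * (3 * C\<^sup>2 + mu * C\<^sup>2)"
  have bd: "N s \<le> D / s ^ 2" if s: "s \<ge> 1" for s
  proof -
    have w2: "w s \<le> C\<^sup>2" unfolding w_def using C(1)[OF s] by (intro power_mono) auto
    have "C / s\<^sup>2 \<le> C / 1" using C0 s by (intro divide_left_mono) auto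
    then have "cmod (d s + \<i> * p s) \<le> 3 * C"
      using norm_triangle_ineq[of "d s - \<i> * p s" "2 * \<i> * p s"] C[OF s] by (simp add: norm_mult add.commute)
    then have m1: "cmod ((d s - \<i> * p s) * (d s + \<i> * p s)) \<le> C / s\<^sup>2 * (3 * C)"
      unfolding norm_mult using C(2)[OF s] C0 s by (intro mult_mono) auto
    have "cmod (of_real (mu / s\<^sup>2) * (p s)\<^sup>2) = mu / s\<^sup>2 * w s"
      using mu_pos s by (simp add: norm_mult norm_power w_def norm_divide)
    also have "\<dots> \<le> mu / s\<^sup>2 * C\<^sup>2" using w2 mu_pos s by (intro mult_left_mono) auto
    finally have m2: "cmod (of_real (mu / s\<^sup>2) * (p s)\<^sup>2) \<le> mu / s\<^sup>2 * C\<^sup>2" .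
    \<comment> \<open>Since Q tends to 1, d^2 + Q p^2 is close to (d - i p) (d + i p), and the first
      factor decays for outgoing solutions.\<close>
    have e: "(d s)\<^sup>2 + of_real (liou_pot n s) * (p s)\<^sup>2
      = (d s - \<i> * p s) * (d s + \<i> * p s) - of_real (mu / s\<^sup>2) * (p s)\<^sup>2"
      by (simp add: liou_pot_def mu_def power2_eq_square algebra_simps)
    have "cmod ((d s)\<^sup>2 + of_real (liou_pot n s) * (p s)\<^sup>2) \<le> C / s\<^sup>2 * (3 * C) + mu / s\<^sup>2 * C\<^sup>2"
      unfolding e using m1 m2 norm_triangle_ineq4 by (smt (verit))
    then have "cmod A * cmod ((d s)\<^sup>2 + of_real (liou_pot n s) * (p s)\<^sup>2) \<le> w r * (C / s\<^sup>2 * (3 * C) + mu / s\<^sup>2 * C\<^sup>2)"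
      unfolding A by (intro mult_left_mono) (auto simp: w_def)
    also have "\<dots> = D / s ^ 2" unfolding D_def using s by (simp add: field_simps power2_eq_square)
    finally have "Im (A * ((d s)\<^sup>2 + of_real (liou_pot n s) * (p s)\<^sup>2)) \<le> D / s ^ 2"
      using abs_Im_le_cmod[of "A * ((d s)\<^sup>2 + of_real (liou_pot n s) * (p s)\<^sup>2)"] by (simp add: norm_mult)
    moreover have "0 \<le> mu / c * (1 / s ^ 3 * (w s * K s))"
      using mu_pos c K0 s by (intro mult_nonneg_nonneg) (auto simp: w_def)
    ultimately show ?thesis by (simp add: N_def)
  qed
  have "N r \<le> 0"
  proof (rule tendsto_lowerbound)
    show "((\<lambda>s. D / s ^ 2) \<longlongrightarrow> 0) at_top" by (rule decay_tendsto_0) simp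
    show "\<forall>\<^sub>F s in at_top. N r \<le> D / s ^ 2"
      using eventually_ge_at_top[of 1] eventually_ge_at_top[of r]
      by eventually_elim (use mono bd order_trans in blast)
  qed simp
  moreover have "N r = c * w1 r"
  proof -
    have "A * (p r)\<^sup>2 = of_real (w r ^ 2)"
    proof -
      have "complex_of_real (w r) = p r * cnj (p r)" unfolding w_def by (rule complex_norm_square)
      then show ?thesis unfolding A_def by (simp only: of_real_power power_mult_distrib mult.commute)
    qed
    moreover from this have "A * (of_real (liou_pot n r) * (p r)\<^sup>2) = of_real (liou_pot n r * w r ^ 2)"
      by (simp only: mult.left_commute[of A] of_real_mult)
    ultimately have "K r = 0" "Im (A * (of_real (liou_pot n r) * (p r)\<^sup>2)) = 0"
      unfolding K_def by (simp_all only: Re_complex_of_real Im_complex_of_real power2_eq_square diff_self)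
    moreover have "Im (A * (d r)\<^sup>2) = c * w1 r"
      unfolding A_def by (rule wave_identities(2)) (simp_all only: w1_def c_def liou_flux[OF Z r])
    ultimately show ?thesis by (simp add: N_def distrib_left)
  qed
  ultimately show ?thesis using c by (simp add: mult_le_0_iff)
qed

text \<open>Let r be the last point where the inequality fails. Beyond r it holds, so
  \<open>w1_nonpos_if\<close> gives w1 r <= 0, contrary to 2 r w1 r >= 3 w r > 0.\<close>

lemma slow_everywhere:
  assumes "s > 0"
  shows "2 * s * w1 s < 3 * w s"
proof (rule ccontr)
  assume neg: "\<not> 2 * s * w1 s < 3 * w s"
  obtain S where S: "\<And>t. t \<ge> S \<Longrightarrow> 2 * t * w1 t < 3 * w t"
    using eventually_slow unfolding eventually_at_top_linorder by blast
  let ?V = "{s..S} \<inter> {t \<in> {s..S}. 2 * t * w1 t - 3 * w t \<in> {0..}}"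
  have "continuous_on {s..S} (\<lambda>t. 2 * t * w1 t - 3 * w t)"
    unfolding w1_def w_def
    by (intro continuous_intros continuous_at_imp_continuous_on ballI cont_p cont_d) (use assms in auto)
  then have "compact ?V"
    by (intro compact_Int_closed compact_Icc continuous_closed_preimage[unfolded vimage_def Int_def, simplified]) auto
  moreover have "s \<in> ?V" using neg S[of s] by force
  ultimately obtain r where r: "r \<in> ?V" "\<And>t. t \<in> ?V \<Longrightarrow> t \<le> r"
    using compact_attains_sup[of ?V] by blast
  have r0: "r > 0" using r(1) assms by simp
  have "2 * t * w1 t \<le> 3 * w t" if "t > r" for t
    using r(2)[of t] S[of t] that r(1) by force
  then have "w1 r \<le> 0" by (rule w1_nonpos_if[OF r0])
  moreover have "2 * r * w1 r \<ge> 3 * w r" using r(1) by simp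
  moreover have "2 * r * w1 r \<le> 0" using \<open>w1 r \<le> 0\<close> r0 by (simp add: mult_nonneg_nonpos)
  ultimately show False using w_pos[OF r0] by linarith
qed

lemma w1_nonpos: "s > 0 \<Longrightarrow> w1 s \<le> 0"
  by (rule w1_nonpos_if) (simp_all add: less_imp_le slow_everywhere)

lemma w_antimono:
  assumes "0 < r" "r \<le> s"
  shows "w s \<le> w r"
proof (rule DERIV_nonpos_imp_nonincreasing[OF assms(2)])
  fix x assume "r \<le> x" "x \<le> s"
  then have "x > 0" using assms(1) by simp
  then show "\<exists>y. (w has_real_derivative y) (at x) \<and> y \<le> 0"
    using w_deriv w1_nonpos by blast
qed

end

subsection \<open>Logarithmic derivatives of the Bessel functions of the first kind\<close>

lemma isCont_J: "isCont (bessel_J_nat n) x"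
  unfolding bessel_J_nat_clif[abs_def]
  by (intro continuous_intros isCont_o2[where g = "clif n", OF _ DERIV_isCont[OF clif_deriv]]) auto

text \<open>\<open>euler_J n x = x J\<^sub>n'(x)\<close>.\<close>

definition euler_J :: "nat \<Rightarrow> real \<Rightarrow> real" where
  "euler_J n x = real n * bessel_J_nat n x - x * bessel_J_nat (Suc n) x"

lemma isCont_euler_J: "isCont (euler_J n) x"
  unfolding euler_J_def[abs_def] by (intro continuous_intros isCont_J)

lemma J_deriv: "x > 0 \<Longrightarrow> (bessel_J_nat n has_real_derivative euler_J n x / x) (at x)"
  using bessel_J_nat_deriv[of x n] by (simp add: euler_J_def diff_divide_distrib)

lemma euler_J_deriv:
  assumes x: "x > 0"
  shows "(euler_J n has_real_derivative ((real n)\<^sup>2 / x - x) * bessel_J_nat n x) (at x)"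
proof -
  have d1: "(bessel_J_nat (Suc n) has_real_derivative bessel_J_nat n x - real (n + 1) / x * bessel_J_nat (Suc n) x) (at x)"
  proof -
    have e: "real (Suc n) / x * bessel_J_nat (Suc n) x - bessel_J_nat (Suc (Suc n)) x
        = bessel_J_nat n x - real (n + 1) / x * bessel_J_nat (Suc n) x"
      using bessel_J_nat_rec[of x n] x by (simp add: field_simps)
    show ?thesis using bessel_J_nat_deriv[of x "Suc n", unfolded e] x by simp
  qed
  show ?thesis unfolding euler_J_def[abs_def]
    by (rule DERIV_cong, (rule DERIV_diff DERIV_cmult DERIV_mult DERIV_ident d1 bessel_J_nat_deriv[OF less_imp_neq[OF x, symmetric]])+)
      (use x in \<open>simp_all add: field_simps power2_eq_square\<close>)
qed

lemma J_pos_near_0: "\<exists>\<delta>>0. \<forall>x. 0 < x \<and> x < \<delta> \<longrightarrow> bessel_J_nat n x > 0"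
proof -
  have "isCont (\<lambda>x. clif n (x\<^sup>2 / 4)) 0"
    by (intro continuous_intros isCont_o2[where g = "clif n", OF _ DERIV_isCont[OF clif_deriv]]) auto
  then have "((\<lambda>x. clif n (x\<^sup>2 / 4)) \<longlongrightarrow> 1 / fact n) (at 0)" by (simp add: isCont_def)
  then have "\<forall>\<^sub>F x in at 0. clif n (x\<^sup>2 / 4) > 0" by (rule order_tendstoD) simp
  then obtain \<delta> where "\<delta> > 0" "\<And>x. x \<noteq> 0 \<Longrightarrow> \<bar>x\<bar> < \<delta> \<Longrightarrow> clif n (x\<^sup>2 / 4) > 0"
    unfolding eventually_at by (auto simp: dist_real_def)
  then show ?thesis unfolding bessel_J_nat_clif by (intro exI[of _ \<delta>]) auto
qed

lemma J_0 [simp]: "n > 0 \<Longrightarrow> bessel_J_nat n 0 = 0" "euler_J n 0 = 0"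
  by (cases n; simp add: bessel_J_nat_clif euler_J_def)+

text \<open>Up to a first zero below n, Bessel's equation (x J')' = (n^2 / x - x) J makes x J'
  nondecreasing from its value 0 at the origin. So J is nondecreasing and cannot return to
  0.\<close>

lemma J_pos:
  assumes n: "n \<ge> 1" and x: "0 < x" "x \<le> real n"
  shows "bessel_J_nat n x > 0"
proof (rule ccontr)
  let ?J = "bessel_J_nat n"
  assume neg: "\<not> ?J x > 0"
  obtain \<delta> where \<delta>: "\<delta> > 0" "\<And>y. 0 < y \<Longrightarrow> y < \<delta> \<Longrightarrow> ?J y > 0" using J_pos_near_0 by blast
  define a where "a = min (\<delta> / 2) (x / 2)"
  have a: "0 < a" "a < \<delta>" "a \<le> x" using \<delta> x by (auto simp: a_def)
  have "closed ({a..x} \<inter> ?J -` {..0})"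
    by (intro continuous_closed_preimage continuous_at_imp_continuous_on ballI isCont_J) auto
  then have "compact ({a..x} \<inter> ({a..x} \<inter> ?J -` {..0}))" by (intro compact_Int_closed compact_Icc)
  moreover have "x \<in> {a..x} \<inter> ({a..x} \<inter> ?J -` {..0})" using neg a by auto
  ultimately obtain z where z': "z \<in> {a..x} \<inter> ({a..x} \<inter> ?J -` {..0})"
    and zmin': "\<forall>t \<in> {a..x} \<inter> ({a..x} \<inter> ?J -` {..0}). z \<le> t"
    using compact_attains_inf[of "{a..x} \<inter> ({a..x} \<inter> ?J -` {..0})"] by blast
  from z' have z: "z \<in> {a..x} \<inter> ?J -` {..0}" by blast
  from zmin' have zmin: "z \<le> t" if "t \<in> {a..x} \<inter> ?J -` {..0}" for t using that by blast
  have az: "a < z" using z \<delta>(2)[OF a(1,2)] by (cases "a = z") auto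
  have pos: "?J t > 0" if "0 < t" "t < z" for t
    using that \<delta>(2)[of t] zmin[of t] z a by (cases "t < a") (force, force)
  have T: "euler_J n t \<ge> 0" if t: "0 < t" "t < z" for t
  proof -
    have "euler_J n 0 \<le> euler_J n t"
    proof (rule DERIV_nonneg_imp_increasing_open[where f = "euler_J n"])
      fix s assume s: "0 < s" "s < t"
      have "s * s \<le> real n * real n" using s t z x by (intro mult_mono) auto
      then have "(real n)\<^sup>2 / s - s \<ge> 0" using s by (simp add: field_simps power2_eq_square)
      then show "\<exists>y. (euler_J n has_real_derivative y) (at s) \<and> 0 \<le> y"
        using euler_J_deriv[OF s(1)] pos[of s] s t by (intro exI conjI) (auto intro: mult_nonneg_nonneg)
    qed (use t in \<open>auto intro!: continuous_at_imp_continuous_on isCont_euler_J\<close>)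
    then show ?thesis by simp
  qed
  have "?J a \<le> ?J z"
  proof (rule DERIV_nonneg_imp_increasing_open[where f = ?J])
    fix s assume s: "a < s" "s < z"
    then have "0 < s" using a by simp
    then show "\<exists>y. (?J has_real_derivative y) (at s) \<and> 0 \<le> y"
      using J_deriv[of s n] T[of s] s by (intro exI[of _ "euler_J n s / s"] conjI) auto
  qed (use az in \<open>auto intro!: continuous_at_imp_continuous_on isCont_J\<close>)
  then show False using z \<delta>(2)[OF a(1,2)] by auto
qed

lemma euler_J_pos:
  assumes n: "n \<ge> 1" and x: "0 < x" "x \<le> real n"
  shows "euler_J n x > 0"
proof -
  have "euler_J n 0 < euler_J n x"
  proof (rule DERIV_pos_imp_increasing_open[where f = "euler_J n"])
    fix s assume s: "0 < s" "s < x"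
    have "s * s < real n * real n" using s x by (intro mult_strict_mono) auto
    then have "(real n)\<^sup>2 / s - s > 0" using s by (simp add: field_simps power2_eq_square)
    then have "0 < ((real n)\<^sup>2 / s - s) * bessel_J_nat n s" using J_pos[OF n s(1)] s x by simp
    then show "\<exists>y. (euler_J n has_real_derivative y) (at s) \<and> 0 < y"
      using euler_J_deriv[OF s(1)] by blast
  qed (use x in \<open>auto intro!: continuous_at_imp_continuous_on isCont_euler_J\<close>)
  then show ?thesis by simp
qed

definition logd :: "nat \<Rightarrow> real \<Rightarrow> real" where
  "logd n x = euler_J n x / bessel_J_nat n x"

text \<open>By the Riccati equation x g' = n^2 - x^2 - g^2 for g = \<open>logd n\<close>, this is -
  g'. The sign is chosen to make it nonnegative.\<close>

definition dlogd :: "nat \<Rightarrow> real \<Rightarrow> real" where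
  "dlogd n x = ((logd n x)\<^sup>2 + x\<^sup>2 - (real n)\<^sup>2) / x"

lemma logd_deriv:
  assumes "n \<ge> 1" "0 < x" "x \<le> real n"
  shows "(logd n has_real_derivative - dlogd n x) (at x)"
proof -
  have J: "bessel_J_nat n x > 0" by (rule J_pos[OF assms])
  show ?thesis unfolding logd_def[abs_def] dlogd_def
    by (rule DERIV_cong, (rule DERIV_divide J_deriv euler_J_deriv assms)+)
      (use J assms in \<open>simp_all add: field_simps power2_eq_square\<close>)
qed

lemma logd_le: "n \<ge> 1 \<Longrightarrow> 0 < x \<Longrightarrow> x \<le> real n \<Longrightarrow> logd n x \<le> real n"
  using J_pos[of n x] J_pos[of "Suc n" x] by (simp add: logd_def euler_J_def field_simps)

lemma logd_pos: "n \<ge> 1 \<Longrightarrow> 0 < x \<Longrightarrow> x \<le> real n \<Longrightarrow> logd n x > 0"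
  using J_pos euler_J_pos by (simp add: logd_def)

context
  fixes n :: nat
  assumes n: "n \<ge> 1"
begin

text \<open>This is - g' times x J_n^2, with the denominators cleared so that it is also meaningful
  at 0. Its derivative 2 x J_n^2 is nonnegative, which settles the sign of - g'.\<close>

definition "Mfun x = (euler_J n x)\<^sup>2 + (x\<^sup>2 - (real n)\<^sup>2) * (bessel_J_nat n x)\<^sup>2" for x

lemma Mfun_deriv: "x > 0 \<Longrightarrow> (Mfun has_real_derivative 2 * x * (bessel_J_nat n x)\<^sup>2) (at x)"
  unfolding Mfun_def[abs_def] power2_eq_square
  by (rule DERIV_cong, (rule DERIV_add DERIV_diff DERIV_mult DERIV_const DERIV_ident J_deriv euler_J_deriv; assumption?)+)
    (simp add: field_simps power2_eq_square)

lemma isCont_Mfun: "isCont Mfun x"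
  unfolding Mfun_def[abs_def] by (intro continuous_intros isCont_J isCont_euler_J)

lemma Mfun_0: "Mfun 0 = 0"
  using n by (simp add: Mfun_def)

lemma Mfun_nonneg:
  assumes "x > 0"
  shows "Mfun x \<ge> 0"
proof -
  have "Mfun 0 \<le> Mfun x"
  proof (rule DERIV_nonneg_imp_increasing_open[where f = Mfun])
    fix s assume s: "0 < s" "s < x"
    then have "0 \<le> 2 * s * (bessel_J_nat n s)\<^sup>2" by simp
    then show "\<exists>y. (Mfun has_real_derivative y) (at s) \<and> 0 \<le> y" using Mfun_deriv[OF s(1)] by blast
  qed (use assms in \<open>auto intro!: continuous_at_imp_continuous_on isCont_Mfun\<close>)
  then show ?thesis by (simp add: Mfun_0)
qed

lemma Mfun_eq: "0 < x \<Longrightarrow> x \<le> real n \<Longrightarrow> Mfun x = dlogd n x * (x * (bessel_J_nat n x)\<^sup>2)"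
  using J_pos[OF n, of x] by (simp add: Mfun_def dlogd_def logd_def field_simps power2_eq_square)

lemma dlogd_nonneg:
  assumes "0 < x" "x \<le> real n"
  shows "dlogd n x \<ge> 0"
proof -
  have "0 < x * (bessel_J_nat n x)\<^sup>2" using J_pos[OF n assms] assms by simp
  then show ?thesis using Mfun_nonneg[OF assms(1)] unfolding Mfun_eq[OF assms] by (simp add: zero_le_mult_iff)
qed

text \<open>Writing P for - g', one has x P' = 2 x - P (2 g + 1), so the inequality expresses that P
  increases. \<open>Zf\<close> is x J_n^2 times the difference of the two sides; it is nonincreasing
  and starts from a limit that is not positive.\<close>

lemma dlogd_le:
  assumes x: "0 < x" "x \<le> real n"
  shows "dlogd n x * (2 * logd n x + 1) \<le> 2 * x"
proof -
  define Zf where "Zf x = Mfun x * (2 * logd n x + 1) - 2 * (x * bessel_J_nat n x)\<^sup>2" for x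
  have dZ: "(Zf has_real_derivative - 2 * s * (bessel_J_nat n s)\<^sup>2 - 2 * Mfun s * dlogd n s) (at s)"
    if s: "0 < s" "s \<le> real n" for s
  proof -
    have J: "bessel_J_nat n s > 0" by (rule J_pos[OF n s])
    have T: "euler_J n s = logd n s * bessel_J_nat n s" using J by (simp add: logd_def)
    show ?thesis unfolding Zf_def[abs_def] power2_eq_square
      by (rule DERIV_cong, (rule DERIV_add DERIV_diff DERIV_cmult DERIV_mult DERIV_const DERIV_ident J_deriv
            Mfun_deriv logd_deriv n s)+)
        (use s in \<open>simp add: T field_simps power2_eq_square\<close>)
  qed
  have mono: "Zf x \<le> Zf y" if y: "0 < y" "y \<le> x" for y
  proof (rule DERIV_nonpos_imp_nonincreasing[OF y(2)])
    fix s assume s: "y \<le> s" "s \<le> x"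
    then have s': "0 < s" "s \<le> real n" using x y by auto
    have "- 2 * s * (bessel_J_nat n s)\<^sup>2 - 2 * Mfun s * dlogd n s \<le> 0"
    proof -
      have "0 \<le> s * (bessel_J_nat n s)\<^sup>2" using s' by simp
      moreover have "0 \<le> Mfun s * dlogd n s" by (rule mult_nonneg_nonneg[OF Mfun_nonneg[OF s'(1)] dlogd_nonneg[OF s']])
      ultimately show ?thesis by (simp add: mult.assoc)
    qed
    then show "\<exists>z. (Zf has_real_derivative z) (at s) \<and> z \<le> 0" using dZ[OF s'] by blast
  qed
  have "Zf x \<le> 0"
  proof (rule tendsto_lowerbound)
    \<comment> \<open>Near 0 the bound g <= n controls the factor 2 g + 1, so the upper bound for
      \<open>Zf\<close> inherits the limit 0 of \<open>Mfun\<close>.\<close>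
    have "(Mfun \<longlongrightarrow> 0) (at_right 0)"
      using isCont_Mfun[of 0] unfolding isCont_def Mfun_0 by (rule tendsto_within_subset) auto
    then show "((\<lambda>y. Mfun y * (2 * real n + 1)) \<longlongrightarrow> 0) (at_right 0)" by (rule tendsto_mult_left_zero)
    show "\<forall>\<^sub>F y in at_right 0. Zf x \<le> Mfun y * (2 * real n + 1)"
      unfolding eventually_at_right_field
    proof (intro exI[of _ x] conjI allI impI)
      fix y assume y: "0 < y" "y < x"
      have "Zf x \<le> Zf y" using mono y by simp
      also have "\<dots> \<le> Mfun y * (2 * logd n y + 1)" by (simp add: Zf_def)
      also have "\<dots> \<le> Mfun y * (2 * real n + 1)"
        using logd_le[OF n, of y] y x Mfun_nonneg[of y] by (intro mult_left_mono) auto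
      finally show "Zf x \<le> Mfun y * (2 * real n + 1)" .
    qed (rule x)
  qed simp
  then have "x * (bessel_J_nat n x)\<^sup>2 * (dlogd n x * (2 * logd n x + 1) - 2 * x) \<le> 0"
    unfolding Zf_def Mfun_eq[OF x] by (simp add: algebra_simps power2_eq_square)
  moreover have "0 < x * (bessel_J_nat n x)\<^sup>2" using J_pos[OF n x] x by simp
  ultimately have "dlogd n x * (2 * logd n x + 1) - 2 * x \<le> 0"
    by (metis mult_pos_pos not_le)
  then show ?thesis by simp
qed

lemma dlogd_mono:
  assumes x: "0 < x" "x \<le> y" "y \<le> real n"
  shows "dlogd n x \<le> dlogd n y"
proof (rule DERIV_nonneg_imp_nondecreasing[OF x(2)])
  fix s assume "x \<le> s" "s \<le> y"
  then have s: "0 < s" "s \<le> real n" using x by auto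
  have "(dlogd n has_real_derivative (2 * s - dlogd n s * (2 * logd n s + 1)) / s) (at s)"
  proof -
    have m: "(logd n s)\<^sup>2 + s\<^sup>2 - (real n)\<^sup>2 = dlogd n s * s" using s by (simp add: dlogd_def)
    have "((\<lambda>s. (logd n s * logd n s + s * s - (real n)\<^sup>2) / s) has_real_derivative
      ((- dlogd n s * logd n s + - dlogd n s * logd n s + (1 * s + 1 * s) - 0) * s
        - (logd n s * logd n s + s * s - (real n)\<^sup>2) * 1) / (s * s)) (at s)"
      by (rule DERIV_divide DERIV_diff DERIV_add DERIV_mult DERIV_ident DERIV_const logd_deriv n s)+ (use s in simp)
    moreover have "logd n s * logd n s + s * s - (real n)\<^sup>2 = dlogd n s * s" using m by (simp add: power2_eq_square)
    ultimately have "(dlogd n has_real_derivative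
      ((- dlogd n s * logd n s + - dlogd n s * logd n s + (1 * s + 1 * s) - 0) * s - dlogd n s * s * 1) / (s * s)) (at s)"
      by (simp add: dlogd_def[abs_def] power2_eq_square)
    then show ?thesis by (rule DERIV_cong) (use s in \<open>simp add: field_simps\<close>)
  qed
  then show "\<exists>z. (dlogd n has_real_derivative z) (at s) \<and> 0 \<le> z"
    using dlogd_le[OF s] s by (intro exI conjI) auto
qed

lemma logd_diff_bound:
  assumes x: "0 < x" "x \<le> real n" and l: "0 < l" "l \<le> 1"
  shows "0 \<le> logd n (l * x) - logd n x"
    "logd n (l * x) - logd n x \<le> (1 - l) * x * real n powr (- 1/3) * (logd n (l * x) + 1 / 2)"
proof -
  have lx: "0 < l * x" "l * x \<le> x" using x l by (auto simp: mult_le_cancel_right2)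
  have anti: "logd n t \<le> logd n s" if "0 < s" "s \<le> t" "t \<le> real n" for s t
  proof (rule DERIV_nonpos_imp_nonincreasing[OF that(2)])
    fix u assume "s \<le> u" "u \<le> t"
    then have "0 < u" "u \<le> real n" using that by auto
    then show "\<exists>y. (logd n has_real_derivative y) (at u) \<and> y \<le> 0"
      using logd_deriv[OF n] dlogd_nonneg by force
  qed
  show "0 \<le> logd n (l * x) - logd n x" using anti[OF lx x(2)] by simp
  have n0: "0 < real n" using n by simp
  define G where "G = logd n (real n)"
  have G: "0 < G" using logd_pos[OF n n0] by (simp add: G_def)
  \<comment> \<open>At x = n the terms x^2 and n^2 cancel. Inserted into \<open>dlogd_le\<close>
    this gives G^2 (2 G + 1) <= 2 n^2, hence G^3 <= n^2.\<close>
  have PG: "dlogd n (real n) = G\<^sup>2 / real n" by (simp add: dlogd_def G_def)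
  have "G\<^sup>2 / real n * (2 * G + 1) \<le> 2 * real n"
    using dlogd_le[OF n0 order_refl] unfolding PG G_def by simp
  then have "G\<^sup>2 * (2 * G + 1) \<le> 2 * (real n)\<^sup>2" using n0 by (simp add: field_simps power2_eq_square)
  then have "2 * G ^ 3 + G\<^sup>2 \<le> 2 * (real n)\<^sup>2" by (simp add: algebra_simps eval_nat_numeral)
  then have "G ^ 3 \<le> (real n)\<^sup>2" using zero_le_power2[of G] by linarith
  then have "(G ^ 3) powr (1 / 3) \<le> ((real n)\<^sup>2) powr (1 / 3)" using G by (intro powr_mono2) auto
  moreover have "(G ^ 3) powr (1 / 3) = G" using G by (simp add: powr_powr flip: powr_numeral)
  moreover have "((real n)\<^sup>2) powr (1 / 3) = real n * real n powr (- 1 / 3)"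
  proof -
    have "((real n)\<^sup>2) powr (1 / 3) = real n powr (2 / 3)" using n0 by (simp add: powr_powr flip: powr_numeral)
    also have "\<dots> = real n powr (1 + (- 1/3))" by simp
    also have "\<dots> = real n * real n powr (- 1/3)" using n0 unfolding powr_add by simp
    finally show ?thesis .
  qed
  ultimately have Gn: "G / real n \<le> real n powr (- 1/3)" using n0 by (simp add: field_simps)
  have "logd n (l * x) - logd n x \<le> (1 - l) * x * (G\<^sup>2 / real n)"
  proof (cases "l * x = x")
    case True
    then show ?thesis using l x by simp
  next
    case False
    then have lt: "l * x < x" using lx False by linarith
    have "\<exists>z>l * x. z < x \<and> logd n x - logd n (l * x) = (x - l * x) * (- dlogd n z)"
      by (rule MVT2[OF lt]) (use lx x n logd_deriv in auto)
    then obtain z where z: "l * x < z" "z < x" "logd n x - logd n (l * x) = (x - l * x) * (- dlogd n z)" by blast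
    have "dlogd n z \<le> G\<^sup>2 / real n" unfolding PG[symmetric] using z lx x by (intro dlogd_mono) auto
    then have "(x - l * x) * dlogd n z \<le> (x - l * x) * (G\<^sup>2 / real n)" using lx by (intro mult_left_mono) auto
    moreover have "x - l * x = (1 - l) * x" by (simp add: algebra_simps)
    ultimately show ?thesis using z(3) by simp
  qed
  also have "\<dots> = (1 - l) * x * (G / real n * G)" by (simp add: power2_eq_square)
  also have "\<dots> \<le> (1 - l) * x * (real n powr (- 1/3) * (logd n (l * x) + 1 / 2))"
  proof -
    have "G \<le> logd n (l * x)" unfolding G_def using lx(1) order_trans[OF lx(2) x(2)] by (intro anti) auto
    then show ?thesis using Gn G l x n0 by (intro mult_left_mono mult_mono) auto
  qed
  finally show "logd n (l * x) - logd n x \<le> (1 - l) * x * real n powr (- 1/3) * (logd n (l * x) + 1 / 2)"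
    by (simp add: mult.assoc)
qed

end

subsection \<open>Bounds for the scattered modes\<close>

text \<open>The Euler derivative \<open>x Z\<^sub>n'(x)\<close>.\<close>

definition euler :: "(nat \<Rightarrow> real \<Rightarrow> complex) \<Rightarrow> nat \<Rightarrow> real \<Rightarrow> complex" where
  "euler Z n x = of_nat n * Z n x - of_real x * Z (Suc n) x"

text \<open>From phi = sqrt x * Z one gets cnj phi * phi' = cnj Z * x Z' + |Z|^2 / 2. The half is
  the source of the 1/2 in \<open>impedance_bound\<close>.\<close>

lemma euler_flux:
  assumes "ladder Z" "x > 0"
  shows "Im (cnj (Z n x) * euler Z n x) = flux Z"
    and "Re (cnj (Z n x) * euler Z n x) = Re (cnj (liou Z n x) * dliou Z n x) - (cmod (Z n x))\<^sup>2 / 2"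
proof -
  have q: "complex_of_real (sqrt x) * of_real (sqrt x) = of_real x"
    using assms by (simp flip: of_real_mult)
  have "cnj (liou Z n x) * dliou Z n x
      = (of_real (sqrt x) * of_real (sqrt x)) * cnj (Z n x) * (of_real ((real n + 1/2) / x) * Z n x - Z (Suc n) x)"
    by (simp add: liou_def dliou_def)
  also have "\<dots> = cnj (Z n x) * euler Z n x + cnj (Z n x) * Z n x / 2"
    unfolding q euler_def using assms by (simp add: field_simps)
  also have "cnj (Z n x) * Z n x = of_real ((cmod (Z n x))\<^sup>2)" unfolding complex_norm_square by (simp add: mult.commute)
  finally have e: "cnj (liou Z n x) * dliou Z n x = cnj (Z n x) * euler Z n x + of_real ((cmod (Z n x))\<^sup>2) / 2" .
  show "Im (cnj (Z n x) * euler Z n x) = flux Z"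
    using liou_flux[OF assms, of n] unfolding e by simp
  show "Re (cnj (Z n x) * euler Z n x) = Re (cnj (liou Z n x) * dliou Z n x) - (cmod (Z n x))\<^sup>2 / 2"
    unfolding e by simp
qed

context outgoing_wave
begin

lemma modulus_decay:
  assumes "0 < x" "x \<le> y"
  shows "cmod (Z n y) \<le> sqrt (x / y) * cmod (Z n x)"
proof -
  have "w y \<le> w x" by (rule w_antimono[OF assms])
  then have "y * (cmod (Z n y))\<^sup>2 \<le> x * (cmod (Z n x))\<^sup>2"
    using assms by (simp add: w_def liou_def norm_mult power_mult_distrib)
  then have "(cmod (Z n y))\<^sup>2 \<le> x / y * (cmod (Z n x))\<^sup>2" using assms by (simp add: field_simps)
  then have "sqrt ((cmod (Z n y))\<^sup>2) \<le> sqrt (x / y * (cmod (Z n x))\<^sup>2)" by (rule real_sqrt_le_mono)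
  then show ?thesis by (simp only: real_sqrt_mult real_sqrt_abs abs_norm_cancel)
qed

lemma impedance_bound:
  assumes "x > 0" "g \<ge> 0"
  shows "(g + 1 / 2) * cmod (Z n x) \<le> cmod (of_real g * Z n x - euler Z n x)"
proof (cases "Z n x = 0")
  case False
  have "Re (cnj (Z n x) * euler Z n x) \<le> - (cmod (Z n x))\<^sup>2 / 2"
    using euler_flux(2)[OF Z assms(1), of n] w1_nonpos[OF assms(1)] by (simp add: w1_def)
  moreover have "Re (cnj (Z n x) * (of_real g * Z n x - euler Z n x))
      = g * (cmod (Z n x))\<^sup>2 - Re (cnj (Z n x) * euler Z n x)"
    unfolding cmod_power2 by (simp add: algebra_simps power2_eq_square)
  ultimately have "(g + 1 / 2) * (cmod (Z n x))\<^sup>2 \<le> Re (cnj (Z n x) * (of_real g * Z n x - euler Z n x))"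
    by (simp add: distrib_right)
  also have "\<dots> \<le> cmod (Z n x) * cmod (of_real g * Z n x - euler Z n x)"
    using complex_Re_le_cmod[of "cnj (Z n x) * (of_real g * Z n x - euler Z n x)"] by (simp add: norm_mult)
  finally have "cmod (Z n x) * ((g + 1 / 2) * cmod (Z n x)) \<le> cmod (Z n x) * cmod (of_real g * Z n x - euler Z n x)"
    by (simp add: power2_eq_square mult_ac)
  then show ?thesis using False by simp
qed simp

text \<open>The matching condition says that \<open>a J\<^sub>n + b Z\<^sub>n\<close> has at \<open>x\<close> the logarithmic derivative
  of the interior solution \<open>J\<^sub>n(l x)\<close>.\<close>

lemma mode_bound:
  assumes x: "0 < x" "x \<le> real n" and l: "0 < l" "l \<le> 1" and y: "x \<le> y"
    and match: "(a * of_real (bessel_J_nat n x) + b * Z n x) * of_real (euler_J n (l * x))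
      = of_real (bessel_J_nat n (l * x)) * (a * of_real (euler_J n x) + b * euler Z n x)"
  shows "cmod (b * Z n y) \<le> sqrt (x / y) * ((1 - l) * x * real n powr (- 1/3) * cmod (a * of_real (bessel_J_nat n x)))"
proof -
  let ?J = "bessel_J_nat n"
  have "l * x \<le> 1 * x" using x l by (intro mult_right_mono) auto
  then have "l * x \<le> real n" using x(2) by linarith
  then have lx: "0 < l * x" "l * x \<le> real n" using x l by auto
  have J: "?J x > 0" "?J (l * x) > 0" using J_pos[OF n] x lx by auto
  define gl g where "gl = logd n (l * x)" and "g = logd n x"
  have T: "euler_J n (l * x) = gl * ?J (l * x)" "euler_J n x = g * ?J x" using J by (auto simp: logd_def gl_def g_def)
  have gl: "gl \<ge> 0" using logd_pos[OF n lx] by (simp add: gl_def)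
  have "of_real (?J (l * x)) * ((a * of_real (?J x) + b * Z n x) * of_real gl)
      = of_real (?J (l * x)) * (a * of_real (g * ?J x) + b * euler Z n x)"
    using match unfolding T by (simp add: mult_ac)
  then have "(a * of_real (?J x) + b * Z n x) * of_real gl = a * of_real (g * ?J x) + b * euler Z n x"
    using J by simp
  then have m: "b * (of_real gl * Z n x - euler Z n x) = - (of_real (gl - g) * (a * of_real (?J x)))"
    by (simp add: algebra_simps)
  have "cmod b * ((gl + 1 / 2) * cmod (Z n x)) \<le> cmod b * cmod (of_real gl * Z n x - euler Z n x)"
    using impedance_bound[OF x(1) gl] by (intro mult_left_mono) auto
  also have "\<dots> = cmod (b * (of_real gl * Z n x - euler Z n x))" by (rule norm_mult[symmetric])
  also have "\<dots> = \<bar>gl - g\<bar> * cmod (a * of_real (?J x))" unfolding m by (simp only: norm_minus_cancel norm_mult norm_of_real)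
  also have "\<dots> \<le> (1 - l) * x * real n powr (- 1/3) * (gl + 1 / 2) * cmod (a * of_real (?J x))"
    using logd_diff_bound[OF n x l] by (intro mult_right_mono) (auto simp: gl_def g_def)
  finally have "(gl + 1 / 2) * (cmod b * cmod (Z n x))
      \<le> (gl + 1 / 2) * ((1 - l) * x * real n powr (- 1/3) * cmod (a * of_real (?J x)))"
    by (simp add: mult_ac)
  then have b: "cmod b * cmod (Z n x) \<le> (1 - l) * x * real n powr (- 1/3) * cmod (a * of_real (?J x))"
    using gl by simp
  have "cmod (b * Z n y) \<le> cmod b * (sqrt (x / y) * cmod (Z n x))"
    unfolding norm_mult using modulus_decay[OF x(1) y] by (intro mult_left_mono) auto
  also have "\<dots> = sqrt (x / y) * (cmod b * cmod (Z n x))" by simp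
  also have "\<dots> \<le> sqrt (x / y) * ((1 - l) * x * real n powr (- 1/3) * cmod (a * of_real (?J x)))"
    using b x y by (intro mult_left_mono) auto
  finally show ?thesis .
qed

end

text \<open>Uniqueness for a mode without incident field. If b were nonzero, multiplying by
  \<open>cnj\<close> of the outgoing solution and taking imaginary parts would leave J_n(y) times
  the flux equal to 0. Then J_n and its derivative both vanish at y, against the nonzero Wronskian
  of J and the outgoing solution.\<close>

lemma mode_determined:
  assumes x: "x > 0" and y: "y > 0" and tau: "\<tau> \<noteq> 0" and fl: "flux (cyl 1 \<tau>) > 0"
    and match: "b * cyl 1 \<tau> n x * of_real (euler_J n y) = of_real (bessel_J_nat n y) * (b * euler (cyl 1 \<tau>) n x)"
  shows "b = 0"
proof (rule ccontr)
  let ?Z = "cyl 1 \<tau>"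
  assume "b \<noteq> 0"
  then have m: "?Z n x * of_real (euler_J n y) = of_real (bessel_J_nat n y) * euler ?Z n x"
    using match by (simp add: mult.left_commute mult.assoc)
  have "cnj (?Z n x) * ?Z n x = of_real ((cmod (?Z n x))\<^sup>2)"
    unfolding complex_norm_square by (simp add: mult.commute)
  then have "of_real ((cmod (?Z n x))\<^sup>2 * euler_J n y) = of_real (bessel_J_nat n y) * (cnj (?Z n x) * euler ?Z n x)"
  proof -
    have "cnj (?Z n x) * (?Z n x * of_real (euler_J n y)) = cnj (?Z n x) * (of_real (bessel_J_nat n y) * euler ?Z n x)"
      unfolding m ..
    then show ?thesis using \<open>cnj (?Z n x) * ?Z n x = _\<close>
      by (simp only: of_real_mult mult.assoc[symmetric] mult.commute[of _ "of_real (bessel_J_nat n y)"])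
  qed
  then have "Im (of_real ((cmod (?Z n x))\<^sup>2 * euler_J n y)) = bessel_J_nat n y * Im (cnj (?Z n x) * euler ?Z n x)"
    by (simp only: Im_complex_of_real) simp
  then have J: "bessel_J_nat n y = 0" using euler_flux(1)[OF ladder_cyl x, of 1 \<tau> n] fl by (simp only: Im_complex_of_real) simp
  moreover have "?Z n x \<noteq> 0" using euler_flux(1)[OF ladder_cyl x, of 1 \<tau> n] fl by auto
  ultimately have "euler_J n y = 0" using m by simp
  then have "bessel_J_nat (Suc n) y = 0" using J y by (simp add: euler_J_def)
  then have "wronsk (\<lambda>n x. of_real (bessel_J_nat n x)) ?Z y = 0"
    using ladder_wronsk[OF ladder_J ladder_cyl y, of n 1 \<tau>] J by simp
  moreover have "wronsk (\<lambda>n x. of_real (bessel_J_nat n x)) ?Z y = \<tau> * of_real (2 / pi)"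
    unfolding bessel_wronskian[OF y, symmetric] by (simp add: wronsk_def algebra_simps)
  ultimately show False using tau by simp
qed

section \<open>The mode of order zero\<close>

lemma bessel_J_nat_0_0 [simp]: "bessel_J_nat 0 0 = 1"
  by (simp add: bessel_J_nat_clif)

text \<open>The sum is 1 at the origin and its derivative is - 2 J_1^2 / x.\<close>

lemma J0_J1_le_1:
  assumes "x \<ge> 0"
  shows "(bessel_J_nat 0 x)\<^sup>2 + (bessel_J_nat 1 x)\<^sup>2 \<le> 1"
proof -
  let ?f = "\<lambda>x. - ((bessel_J_nat 0 x)\<^sup>2 + (bessel_J_nat 1 x)\<^sup>2)"
  have "?f 0 \<le> ?f x"
  proof (rule DERIV_nonneg_imp_increasing_open[where f = ?f, OF assms])
    fix s assume s: "0 < s" "s < x"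
    have "(?f has_real_derivative 2 * (bessel_J_nat 1 s)\<^sup>2 / s) (at s)"
      unfolding power2_eq_square
      by (rule DERIV_cong, (rule DERIV_minus DERIV_add DERIV_mult bessel_J_nat_0_deriv[OF s(1)] bessel_J_nat_1_deriv[OF s(1)])+)
        (use s in \<open>simp add: field_simps\<close>)
    moreover have "0 \<le> 2 * (bessel_J_nat 1 s)\<^sup>2 / s" using s by simp
    ultimately show "\<exists>y. (?f has_real_derivative y) (at s) \<and> 0 \<le> y" by blast
  qed (auto intro!: continuous_intros continuous_at_imp_continuous_on isCont_J)
  then show ?thesis by simp
qed

context
  fixes y01 :: real
  assumes y01: "first_positive_zero (bessel_Y 0) y01"
begin

lemma Y0_eq: "bessel_Y 0 x = bessel_Y_nat 0 x"
  by (simp add: bessel_Y_def)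

lemma isCont_Y0: "x > 0 \<Longrightarrow> isCont (bessel_Y_nat 0) x"
  using bessel_Y_0_deriv DERIV_isCont by blast

lemma Y0_neg_near_0: "\<forall>\<^sub>F x in at_right 0. bessel_Y_nat 0 x < 0"
proof -
  have within: "(f \<longlongrightarrow> f 0) (at_right 0)" if "isCont f 0" for f :: "real \<Rightarrow> real"
    using that unfolding isCont_def by (rule tendsto_within_subset) simp
  have J: "\<forall>\<^sub>F x in at_right 0. bessel_J_nat 0 x > 1 / 2"
    by (rule order_tendstoD(1)[OF within[OF isCont_J]]) simp
  have "isCont (\<lambda>x. pser harm_coeff (x\<^sup>2 / 4)) 0"
    by (rule DERIV_isCont[OF pser_sq_deriv[OF harm_coeff_bound]])
  from within[OF this] have S: "\<forall>\<^sub>F x in at_right 0. pser harm_coeff (x\<^sup>2 / 4) < 1"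
    by (rule order_tendstoD(2)) (simp add: pser_def harm_coeff_values(1))
  have "\<forall>\<^sub>F x in at_right (0::real). x < 2 * exp (- 2 - euler_mascheroni)"
    unfolding eventually_at_right_field by (intro exI[of _ "2 * exp (- 2 - euler_mascheroni)"]) auto
  with J S eventually_at_right_less[of 0] show ?thesis
  proof eventually_elim
    case (elim x)
    \<comment> \<open>The threshold makes ln (x / 2) + gamma less than -2. As J_0 > 1/2, the product
      lies below -1 and outweighs the series, which is below 1.\<close>
    have "x / 2 < exp (- 2 - euler_mascheroni)" using elim by simp
    then have "ln (x / 2) < ln (exp (- 2 - euler_mascheroni))"
      using elim by (subst ln_less_cancel_iff) auto
    then have "ln (x / 2) < - 2 - euler_mascheroni" by simp
    then have "(ln (x / 2) + euler_mascheroni) * bessel_J_nat 0 x < (- 2) * bessel_J_nat 0 x"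
      using elim by (intro mult_strict_right_mono) auto
    then have "(ln (x / 2) + euler_mascheroni) * bessel_J_nat 0 x + pser harm_coeff (x\<^sup>2 / 4) < 0"
      using elim by linarith
    then show ?case unfolding bessel_Y_nat_0 by (intro mult_pos_neg) auto
  qed
qed

lemma Y0_neg:
  assumes "0 < x" "x < y01"
  shows "bessel_Y_nat 0 x < 0"
proof (rule ccontr)
  assume "\<not> bessel_Y_nat 0 x < 0"
  moreover have "\<forall>\<^sub>F s in at_right 0. bessel_Y_nat 0 s < 0 \<and> s < x \<and> 0 < s"
    using Y0_neg_near_0 eventually_at_right_less[of 0] eventually_at_right_field[of "\<lambda>s. s < x" 0] assms
    by (auto intro!: eventually_conj)
  then obtain s where s: "bessel_Y_nat 0 s < 0" "s < x" "0 < s"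
    using eventually_happens'[OF trivial_limit_at_right_real] by blast
  ultimately obtain t where "s \<le> t" "t \<le> x" "bessel_Y_nat 0 t = 0"
    using IVT[of "bessel_Y_nat 0" s 0 x] isCont_Y0 by force
  then show False using y01 assms s unfolding first_positive_zero_def Y0_eq by auto
qed

lemma y01_less_1: "y01 < 1"
proof (rule ccontr)
  assume "\<not> y01 < 1"
  moreover have "y01 \<noteq> 1" "bessel_Y_nat 0 1 > 0"
    using y01 bessel_Y_values(1) unfolding first_positive_zero_def Y0_eq by auto
  ultimately show False using Y0_neg[of 1] by simp
qed

text \<open>On (0, 1] J_1 is positive, so J_0 decreases to J_0(1) > 0. The sign of Y_1 is then
  forced by the Wronskian: J_1 Y_0 - J_0 Y_1 is positive although J_1 Y_0 is not.\<close>

lemma low_mode_signs: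
  assumes x: "0 < x" "x < y01"
  shows "bessel_J_nat 0 x \<ge> 0" "bessel_J_nat 1 x \<ge> 0" "bessel_Y_nat 0 x \<le> 0" "bessel_Y1 x \<le> 0"
proof -
  have x1: "x < 1" using x y01_less_1 by simp
  have J1: "bessel_J_nat 1 s > 0" if "0 < s" "s \<le> 1" for s using J_pos[of 1 s] that by simp
  have "bessel_J_nat 0 1 \<le> bessel_J_nat 0 x"
  proof (rule DERIV_nonpos_imp_nonincreasing[OF less_imp_le[OF x1]])
    fix s assume s: "x \<le> s" "s \<le> 1"
    then have s0: "0 < s" using x by simp
    show "\<exists>y. (bessel_J_nat 0 has_real_derivative y) (at s) \<and> y \<le> 0"
      using bessel_J_nat_0_deriv[OF s0] J1[OF s0 s(2)] by (intro exI[of _ "- bessel_J_nat 1 s"]) simp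
  qed
  then have J0: "bessel_J_nat 0 x > 0" using series_values(1) by simp
  then show "bessel_J_nat 0 x \<ge> 0" by simp
  show J1': "bessel_J_nat 1 x \<ge> 0" using J1[of x] x x1 by simp
  show Y0: "bessel_Y_nat 0 x \<le> 0" using Y0_neg[OF x] by simp
  have "0 < bessel_J_nat 1 x * bessel_Y_nat 0 x - bessel_J_nat 0 x * bessel_Y1 x"
    using bessel_wronskian[OF x(1)] x(1) by (metis zero_less_mult_pos divide_pos_pos pi_gt_zero zero_less_numeral)
  moreover have "bessel_J_nat 1 x * bessel_Y_nat 0 x \<le> 0" using J1' Y0 by (rule mult_nonneg_nonpos)
  ultimately have "bessel_J_nat 0 x * bessel_Y1 x < 0" by linarith
  then show "bessel_Y1 x \<le> 0" using J0 by (simp add: mult_less_0_iff)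
qed

lemma euler_J_0: "euler_J 0 x = - (x * bessel_J_nat 1 x)"
  by (simp add: euler_J_def)

text \<open>Matching reads b D = a k(l) with the real determinant \<open>k\<close>, and Im D = - Im
  tau * f(l). In l, k vanishes at 1 and has slope at most x^2, while \<open>f\<close> decreases to
  the Wronskian value f(1) = 2 / pi. Taking imaginary parts removes Re tau from the estimate of
  D.\<close>

lemma low_mode_bound:
  assumes x: "0 < x" "x < y01" and l: "0 < l" "l \<le> 1" and tau: "Im \<tau> > 0"
    and match: "(a * of_real (bessel_J_nat 0 x) + b * cyl 1 \<tau> 0 x) * of_real (euler_J 0 (l * x))
      = of_real (bessel_J_nat 0 (l * x)) * (a * of_real (euler_J 0 x) + b * euler (cyl 1 \<tau>) 0 x)"
  shows "cmod b * (Im \<tau> * (2 / pi)) \<le> cmod a * ((1 - l) * x\<^sup>2)"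
proof -
  define k where "k l = bessel_J_nat 0 (l * x) * euler_J 0 x - bessel_J_nat 0 x * euler_J 0 (l * x)" for l
  define f where "f l = - (bessel_J_nat 0 (l * x) * (x * bessel_Y1 x)) - bessel_Y_nat 0 x * euler_J 0 (l * x)" for l
  note sg = low_mode_signs
  have dJ: "((\<lambda>l. bessel_J_nat 0 (l * x)) has_real_derivative - bessel_J_nat 1 (s * x) * x) (at s)"
    "((\<lambda>l. euler_J 0 (l * x)) has_real_derivative - (s * x * bessel_J_nat 0 (s * x)) * x) (at s)" if "s > 0" for s
  proof -
    have sx: "s * x > 0" using that x by simp
    have m: "((\<lambda>l. l * x) has_real_derivative x) (at s)" by (auto intro!: derivative_eq_intros)
    show "((\<lambda>l. bessel_J_nat 0 (l * x)) has_real_derivative - bessel_J_nat 1 (s * x) * x) (at s)"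
      by (rule DERIV_chain2[OF bessel_J_nat_0_deriv[OF sx] m])
    have "(euler_J 0 has_real_derivative - (s * x * bessel_J_nat 0 (s * x))) (at (s * x))"
      using euler_J_deriv[OF sx, of 0] by simp
    from DERIV_chain2[OF this m]
    show "((\<lambda>l. euler_J 0 (l * x)) has_real_derivative - (s * x * bessel_J_nat 0 (s * x)) * x) (at s)" .
  qed
  have dk: "(k has_real_derivative x\<^sup>2 * (bessel_J_nat 1 (s * x) * bessel_J_nat 1 x + s * (bessel_J_nat 0 x * bessel_J_nat 0 (s * x)))) (at s)"
    if "s > 0" for s
    unfolding k_def[abs_def]
    by (rule DERIV_cong, (rule DERIV_diff DERIV_cmult DERIV_cmult_right dJ that)+)
      (simp add: euler_J_0 algebra_simps power2_eq_square)
  have df: "(f has_real_derivative x\<^sup>2 * (bessel_J_nat 1 (s * x) * bessel_Y1 x + s * (bessel_Y_nat 0 x * bessel_J_nat 0 (s * x)))) (at s)"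
    if "s > 0" for s
    unfolding f_def[abs_def]
    by (rule DERIV_cong, (rule DERIV_diff DERIV_minus DERIV_cmult DERIV_cmult_right dJ that)+)
      (simp add: algebra_simps power2_eq_square)
  have sx: "0 < s * x" "s * x < y01" if "0 < s" "s \<le> 1" for s
  proof -
    have "s * x \<le> 1 * x" using that x by (intro mult_right_mono) auto
    then show "s * x < y01" using x by linarith
    show "0 < s * x" using that x by simp
  qed
  have "f 1 \<le> f l"
  proof (rule DERIV_nonpos_imp_nonincreasing[OF l(2)])
    fix s assume s: "l \<le> s" "s \<le> 1"
    then have s0: "s > 0" using l by simp
    have "bessel_J_nat 1 (s * x) * bessel_Y1 x \<le> 0" "bessel_Y_nat 0 x * bessel_J_nat 0 (s * x) \<le> 0"
      using sg[OF x] sg[OF sx[OF s0 s(2)]] by (auto intro: mult_nonneg_nonpos mult_nonpos_nonneg)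
    then have "x\<^sup>2 * (bessel_J_nat 1 (s * x) * bessel_Y1 x + s * (bessel_Y_nat 0 x * bessel_J_nat 0 (s * x))) \<le> 0"
    proof -
      have "s * (bessel_Y_nat 0 x * bessel_J_nat 0 (s * x)) \<le> 0"
        by (rule mult_nonneg_nonpos) (use s0 \<open>bessel_Y_nat 0 x * bessel_J_nat 0 (s * x) \<le> 0\<close> in simp_all)
      with \<open>bessel_J_nat 1 (s * x) * bessel_Y1 x \<le> 0\<close> show ?thesis
        by (intro mult_nonneg_nonpos zero_le_power2) linarith
    qed
    then show "\<exists>y. (f has_real_derivative y) (at s) \<and> y \<le> 0" using df[OF s0] by blast
  qed
  moreover have "f 1 = 2 / pi" using bessel_wronskian[OF x(1)] by (simp add: f_def euler_J_0 algebra_simps)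
  ultimately have f: "f l \<ge> 2 / pi" by simp
  \<comment> \<open>Cauchy-Schwarz in the plane, to be applied to the vectors (J_1, J_0) at two
    points; both have length at most 1.\<close>
  have cs: "\<bar>a * b + c * d\<bar> \<le> 1" if "a\<^sup>2 + c\<^sup>2 \<le> 1" "b\<^sup>2 + d\<^sup>2 \<le> 1" for a b c d :: real
  proof -
    have "0 \<le> (a - b)\<^sup>2 + (c - d)\<^sup>2" "0 \<le> (a + b)\<^sup>2 + (c + d)\<^sup>2" by simp_all
    then show ?thesis using that unfolding abs_le_iff by (simp add: power2_eq_square algebra_simps)
  qed
  have kb: "\<bar>k l\<bar> \<le> (1 - l) * x\<^sup>2"
  proof (cases "l = 1")
    case True
    then show ?thesis by (simp add: k_def)
  next
    case False
    then have "\<exists>z>l. z < 1 \<and> k 1 - k l = (1 - l) * (x\<^sup>2 * (bessel_J_nat 1 (z * x) * bessel_J_nat 1 x + z * (bessel_J_nat 0 x * bessel_J_nat 0 (z * x))))"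
      using l by (intro MVT2 dk) auto
    then obtain z where z: "l < z" "z < 1" and kz: "k 1 - k l = (1 - l) * (x\<^sup>2 * (bessel_J_nat 1 (z * x) * bessel_J_nat 1 x + z * (bessel_J_nat 0 x * bessel_J_nat 0 (z * x))))" by blast
    have z0: "0 < z" "z \<le> 1" using z l by auto
    note s1 = sg[OF x] and s2 = sg[OF sx[OF z0]]
    have p: "0 \<le> bessel_J_nat 0 x * bessel_J_nat 0 (z * x)" "0 \<le> bessel_J_nat 1 (z * x) * bessel_J_nat 1 x"
      using s1 s2 by (auto intro: mult_nonneg_nonneg)
    \<comment> \<open>Both products are nonnegative, so replacing the weight z by 1 only increases
      the sum and brings it to the form of \<open>cs\<close>.\<close>
    have "z * (bessel_J_nat 0 x * bessel_J_nat 0 (z * x)) \<le> 1 * (bessel_J_nat 0 x * bessel_J_nat 0 (z * x))"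
      using p z0 by (intro mult_right_mono) auto
    moreover have "\<bar>bessel_J_nat 1 (z * x) * bessel_J_nat 1 x + bessel_J_nat 0 (z * x) * bessel_J_nat 0 x\<bar> \<le> 1"
      by (rule cs) (use J0_J1_le_1[of x] J0_J1_le_1[of "z * x"] x z0 in auto)
    moreover have "0 \<le> z * (bessel_J_nat 0 x * bessel_J_nat 0 (z * x))" using p z0 by simp
    ultimately have b: "\<bar>bessel_J_nat 1 (z * x) * bessel_J_nat 1 x + z * (bessel_J_nat 0 x * bessel_J_nat 0 (z * x))\<bar> \<le> 1"
      using p by (simp add: abs_le_iff mult.commute)
    have "k 1 = 0" by (simp add: k_def)
    then have "\<bar>k l\<bar> = (1 - l) * (x\<^sup>2 * \<bar>bessel_J_nat 1 (z * x) * bessel_J_nat 1 x + z * (bessel_J_nat 0 x * bessel_J_nat 0 (z * x))\<bar>)"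
      using kz l by (simp add: abs_mult abs_minus_commute[of 0] flip: abs_minus_cancel[of "k l"])
    also have "\<dots> \<le> (1 - l) * (x\<^sup>2 * 1)" using b l by (intro mult_left_mono) auto
    finally show ?thesis by simp
  qed
  define D where "D = cyl 1 \<tau> 0 x * of_real (euler_J 0 (l * x)) - of_real (bessel_J_nat 0 (l * x)) * euler (cyl 1 \<tau>) 0 x"
  have "b * D = a * of_real (k l)" using match by (simp add: D_def k_def algebra_simps)
  then have "cmod b * cmod D = cmod a * \<bar>k l\<bar>" by (metis norm_mult norm_of_real)
  also have "\<dots> \<le> cmod a * ((1 - l) * x\<^sup>2)" using kb by (intro mult_left_mono) auto
  finally have 1: "cmod b * cmod D \<le> cmod a * ((1 - l) * x\<^sup>2)" .
  have "Im D = - (Im \<tau> * f l)"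
    by (simp add: D_def f_def euler_def euler_J_0 algebra_simps)
  then have "Im \<tau> * f l \<le> cmod D" using abs_Im_le_cmod[of D] by simp
  moreover have "Im \<tau> * (2 / pi) \<le> Im \<tau> * f l" using f tau by (intro mult_left_mono) auto
  ultimately have "cmod b * (Im \<tau> * (2 / pi)) \<le> cmod b * cmod D" by (intro mult_left_mono) auto
  then show ?thesis using 1 by simp
qed

end

text \<open>arctan y <= y at y = 1 / sqrt 3, where arctan equals pi / 6; this gives 2 sqrt 3, which
  is less than 3.47.\<close>

lemma pi_upper: "pi \<le> 3.47"
proof -
  have "pi / 6 = arctan (1 / sqrt 3)"
    using arctan_tan[of "pi / 6"] pi_gt_zero unfolding tan_30 by simp
  also have "\<dots> \<le> 1 / sqrt 3"
  proof -
    have "0 - arctan 0 \<le> 1 / sqrt 3 - arctan (1 / sqrt 3)"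
    proof (rule DERIV_nonneg_imp_nondecreasing[where f = "\<lambda>y. y - arctan y"])
      fix y :: real
      have "((\<lambda>y. y - arctan y) has_real_derivative 1 - inverse (1 + y\<^sup>2)) (at y)"
        by (intro DERIV_diff DERIV_ident DERIV_arctan)
      moreover have "0 \<le> 1 - inverse (1 + y\<^sup>2)" by (simp add: inverse_le_1_iff)
      ultimately show "\<exists>z. ((\<lambda>y. y - arctan y) has_real_derivative z) (at y) \<and> 0 \<le> z" by blast
    qed simp
    then show ?thesis by simp
  qed
  finally have "pi \<le> 6 / sqrt 3" by simp
  also have "\<dots> \<le> 3.47"
  proof -
    have "1.7295 \<le> sqrt 3" by (rule real_le_rsqrt) (simp add: power2_eq_square)
    then show ?thesis by (simp add: field_simps)
  qed
  finally show ?thesis by simp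
qed

text \<open>Cauchy-Schwarz gives |J_0 + tau Y_0|^2 <= (1 + |tau|^2) |H_0|^2. With the bound on tau
  the squared constant becomes 5/32 pi^5, which is below 81 because pi^5 <= 518.\<close>

lemma low_mode_const:
  assumes tau: "Im \<tau> > 0" and c: "(1 + (cmod \<tau>)\<^sup>2) * (2 / pi)\<^sup>2 \<le> 5 / 4 * (Im \<tau>)\<^sup>2"
  shows "sqrt (2 * pi) * cmod (cyl 1 \<tau> 0 y) \<le> 9 * (Im \<tau> * (2 / pi)) * cmod (hankel1 0 y)"
proof -
  let ?J = "bessel_J_nat 0 y" and ?Y = "bessel_Y_nat 0 y"
  have H: "(cmod (hankel1 0 y))\<^sup>2 = ?J\<^sup>2 + ?Y\<^sup>2"
    unfolding hankel1_def bessel_J_def bessel_Y_def cmod_power2 by simp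
  have "cmod (cyl 1 \<tau> 0 y) \<le> \<bar>?J\<bar> + cmod \<tau> * \<bar>?Y\<bar>"
    using norm_triangle_ineq[of "of_real ?J" "\<tau> * of_real ?Y"] by (simp add: norm_mult)
  then have "(cmod (cyl 1 \<tau> 0 y))\<^sup>2 \<le> (\<bar>?J\<bar> + cmod \<tau> * \<bar>?Y\<bar>)\<^sup>2" by (intro power_mono) auto
  also have "\<dots> \<le> (1 + (cmod \<tau>)\<^sup>2) * (?J\<^sup>2 + ?Y\<^sup>2)"
  proof -
    have "0 \<le> (cmod \<tau> * \<bar>?J\<bar> - \<bar>?Y\<bar>)\<^sup>2" by simp
    then show ?thesis by (simp add: power2_eq_square algebra_simps)
  qed
  finally have 1: "(cmod (cyl 1 \<tau> 0 y))\<^sup>2 \<le> (1 + (cmod \<tau>)\<^sup>2) * (cmod (hankel1 0 y))\<^sup>2" unfolding H .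
  have "pi ^ 5 \<le> 3.47 ^ 5" using pi_upper by (intro power_mono) auto
  also have "\<dots> \<le> 518" by (simp add: eval_nat_numeral)
  finally have p5: "pi ^ 5 \<le> 518" .
  have c': "1 + (cmod \<tau>)\<^sup>2 \<le> 5 / 4 * (Im \<tau>)\<^sup>2 * (pi / 2)\<^sup>2"
    using c by (simp add: field_simps)
  have "(sqrt (2 * pi) * cmod (cyl 1 \<tau> 0 y))\<^sup>2 = 2 * pi * (cmod (cyl 1 \<tau> 0 y))\<^sup>2"
    by (simp add: power_mult_distrib)
  also have "\<dots> \<le> 2 * pi * ((1 + (cmod \<tau>)\<^sup>2) * (cmod (hankel1 0 y))\<^sup>2)"
    using 1 by (intro mult_left_mono) auto
  also have "\<dots> \<le> 2 * pi * ((5 / 4 * (Im \<tau>)\<^sup>2 * (pi / 2)\<^sup>2) * (cmod (hankel1 0 y))\<^sup>2)"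
    using c' by (intro mult_left_mono mult_right_mono) auto
  also have "\<dots> = 5 / 32 * pi ^ 5 * ((Im \<tau> * (2 / pi)) * cmod (hankel1 0 y))\<^sup>2"
    by (simp add: field_simps eval_nat_numeral)
  also have "\<dots> \<le> 81 * ((Im \<tau> * (2 / pi)) * cmod (hankel1 0 y))\<^sup>2"
    using p5 by (intro mult_right_mono) auto
  also have "\<dots> = (9 * (Im \<tau> * (2 / pi)) * cmod (hankel1 0 y))\<^sup>2"
    by (simp only: mult.assoc power_mult_distrib) simp
  finally show ?thesis by (rule power2_le_imp_le) (use tau in simp)
qed

subsection \<open>Integration in polar coordinates\<close>

lemma lborel_Complex: "distr (lborel \<Otimes>\<^sub>M lborel) borel (\<lambda>p. Complex (fst p) (snd p)) = lborel"
proof (rule lborel_eqI[symmetric])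
  have [measurable]: "(\<lambda>p. Complex (fst p) (snd p)) \<in> borel_measurable (lborel \<Otimes>\<^sub>M lborel)"
    unfolding Complex_eq by measurable
  fix l u :: complex assume lu: "\<And>b. b \<in> Basis \<Longrightarrow> l \<bullet> b \<le> u \<bullet> b"
  have le: "Re l \<le> Re u" "Im l \<le> Im u" using lu[of 1] lu[of \<i>] by (auto simp: Basis_complex_def)
  have "(\<lambda>p. Complex (fst p) (snd p)) -` box l u \<inter> space (lborel \<Otimes>\<^sub>M lborel)
      = {Re l<..<Re u} \<times> {Im l<..<Im u}"
    by (auto simp: box_def Basis_complex_def space_pair_measure)
  then have "emeasure (distr (lborel \<Otimes>\<^sub>M lborel) borel (\<lambda>p. Complex (fst p) (snd p))) (box l u)
      = emeasure lborel {Re l<..<Re u} * emeasure lborel {Im l<..<Im u}"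
    by (simp add: emeasure_distr lborel.emeasure_pair_measure_Times)
  also have "\<dots> = ennreal (Re u - Re l) * ennreal (Im u - Im l)" using le by simp
  also have "\<dots> = ennreal (\<Prod>b\<in>Basis. (u - l) \<bullet> b)"
    using le by (simp add: Basis_complex_def ennreal_mult)
  finally show "emeasure (distr (lborel \<Otimes>\<^sub>M lborel) borel (\<lambda>p. Complex (fst p) (snd p))) (box l u)
      = (\<Prod>b\<in>Basis. (u - l) \<bullet> b)" .
qed simp

lemma Basis_vec2: "(Basis :: (real^2) set) = {axis 1 1, axis 2 1}"
  by (auto simp: Basis_vec_def UNIV_2)

lemma vector2_eq: "(vector [x, y] :: real^2) = x *\<^sub>R axis 1 1 + y *\<^sub>R axis 2 1"
  by (simp add: vec_eq_iff forall_2 axis_def)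

lemma measurable_vector2 [measurable]:
  "f \<in> borel_measurable M \<Longrightarrow> g \<in> borel_measurable M \<Longrightarrow> (\<lambda>p. vector [f p, g p] :: real^2) \<in> borel_measurable M"
  unfolding vector2_eq by (intro borel_measurable_add borel_measurable_scaleR borel_measurable_const)

lemma lborel_vector2: "distr (lborel \<Otimes>\<^sub>M lborel) borel (\<lambda>p. vector [fst p, snd p]) = (lborel :: (real^2) measure)"
proof (rule lborel_eqI[symmetric])
  fix l u :: "real^2" assume lu: "\<And>b. b \<in> Basis \<Longrightarrow> l \<bullet> b \<le> u \<bullet> b"
  have le: "l $ 1 \<le> u $ 1" "l $ 2 \<le> u $ 2"
    using lu[of "axis 1 1"] lu[of "axis 2 1"] by (auto simp: Basis_vec2 inner_axis)
  have ax: "axis 1 1 \<noteq> (axis 2 1 :: real^2)" by (simp add: axis_eq_axis)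
  have "(\<lambda>p. vector [fst p, snd p]) -` box l u \<inter> space (lborel \<Otimes>\<^sub>M lborel)
      = {l $ 1<..<u $ 1} \<times> {l $ 2<..<u $ 2}"
    by (auto simp: box_def Basis_vec2 space_pair_measure inner_axis)
  then have "emeasure (distr (lborel \<Otimes>\<^sub>M lborel) borel (\<lambda>p. vector [fst p, snd p])) (box l u)
      = emeasure lborel {l $ 1<..<u $ 1} * emeasure lborel {l $ 2<..<u $ 2}"
    by (simp add: emeasure_distr lborel.emeasure_pair_measure_Times)
  also have "\<dots> = ennreal (u $ 1 - l $ 1) * ennreal (u $ 2 - l $ 2)" using le by simp
  also have "\<dots> = ennreal (\<Prod>b\<in>Basis. (u - l) \<bullet> b)"
    using le ax by (simp add: Basis_vec2 ennreal_mult inner_axis)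
  finally show "emeasure (distr (lborel \<Otimes>\<^sub>M lborel) borel (\<lambda>p. vector [fst p, snd p])) (box l u)
      = (\<Prod>b\<in>Basis. (u - l) \<bullet> b)" .
qed simp

text \<open>The change of variables in \<open>polar_change\<close> takes place in
  \<open>real^2\<close> and Fubini's theorem on the product measure, so integrals over the complex
  plane are carried along complex, \<open>real^2\<close> and product.\<close>

lemma lborel_integral_transfer:
  fixes F :: "complex \<Rightarrow> 'b :: euclidean_space" and G :: "real^2 \<Rightarrow> 'b"
  assumes [measurable]: "F \<in> borel_measurable borel" "G \<in> borel_measurable borel"
  shows "(LINT z|lborel. F z) = (LINT v|lborel. F (Complex ((v :: real^2) $ 1) (v $ 2)))"
    and "(LINT v|lborel. G v) = (LINT p|(lborel \<Otimes>\<^sub>M lborel). G (vector [fst p, snd p]))"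
    and "integrable lborel G \<longleftrightarrow> integrable (lborel \<Otimes>\<^sub>M lborel) (\<lambda>p. G (vector [fst p, snd p]))"
proof -
  have m: "(\<lambda>p. Complex (fst p) (snd p)) \<in> borel_measurable (lborel \<Otimes>\<^sub>M lborel)"
    unfolding Complex_eq by measurable
  have mc: "(\<lambda>v::real^2. Complex (v $ 1) (v $ 2)) \<in> borel_measurable borel"
    by (intro borel_measurable_continuous_onI) (auto simp: Complex_eq intro!: continuous_intros)
  have mv: "(\<lambda>p. vector [fst p, snd p] :: real^2) \<in> borel_measurable (lborel \<Otimes>\<^sub>M lborel)" by measurable
  show vec: "(LINT v|lborel. G v) = (LINT p|(lborel \<Otimes>\<^sub>M lborel). G (vector [fst p, snd p]))"
    by (subst lborel_vector2[symmetric], subst integral_distr[OF mv]) simp_all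
  show "integrable lborel G \<longleftrightarrow> integrable (lborel \<Otimes>\<^sub>M lborel) (\<lambda>p. G (vector [fst p, snd p]))"
    by (subst lborel_vector2[symmetric], subst integrable_distr_eq[OF mv]) simp_all
  have "(LINT z|lborel. F z) = (LINT p|(lborel \<Otimes>\<^sub>M lborel). F (Complex (fst p) (snd p)))"
    by (subst lborel_Complex[symmetric], subst integral_distr[OF m]) simp_all
  also have "\<dots> = (LINT p|(lborel \<Otimes>\<^sub>M lborel). F (Complex ((vector [fst p, snd p] :: real^2) $ 1) ((vector [fst p, snd p] :: real^2) $ 2)))"
    by simp
  also have "\<dots> = (LINT v|lborel. F (Complex ((v :: real^2) $ 1) (v $ 2)))"
    by (subst lborel_vector2[symmetric], subst integral_distr[OF mv])
      (use mc in \<open>auto intro: measurable_compose[OF mc]\<close>)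
  finally show "(LINT z|lborel. F z) = (LINT v|lborel. F (Complex ((v :: real^2) $ 1) (v $ 2)))" .
qed

text \<open>The polar map is injective on the open rectangle \<open>S\<close> with Jacobian r. Of
  the open disc it misses only points of the axis v $ 2 = 0, which is negligible.\<close>

lemma polar_change:
  fixes f :: "real^2 \<Rightarrow> real^2"
  assumes f: "integrable lborel f" and supp: "\<And>v. R \<le> norm v \<Longrightarrow> f v = 0"
  defines "S \<equiv> {v :: real^2. 0 < v $ 1 \<and> v $ 1 < R \<and> 0 < v $ 2 \<and> v $ 2 < 2 * pi}"
    and "g \<equiv> \<lambda>v :: real^2. vector [v $ 1 * cos (v $ 2), v $ 1 * sin (v $ 2)] :: real^2"
  shows "(\<lambda>v. v $ 1 *\<^sub>R f (g v)) absolutely_integrable_on S"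
    and "integral S (\<lambda>v. v $ 1 *\<^sub>R f (g v)) = (LINT v|lborel. f v)"
proof -
  define g' where "g' v h = (vector [h $ 1 * cos (v $ 2) - v $ 1 * sin (v $ 2) * h $ 2,
      h $ 1 * sin (v $ 2) + v $ 1 * cos (v $ 2) * h $ 2] :: real^2)" for v h :: "real^2"
  have "open S" unfolding S_def
    by (intro open_Collect_conj open_Collect_less continuous_intros)
  then have S: "S \<in> sets lebesgue" by (intro sets_completionI_sets) auto
  have der: "(g has_derivative g' v) (at v within S)" for v
  proof (subst has_derivative_componentwise_within, intro ballI)
    fix b :: "real^2" assume "b \<in> Basis"
    then consider "b = axis 1 1" | "b = axis 2 1" by (auto simp: Basis_vec2)
    then show "((\<lambda>x. g x \<bullet> b) has_derivative (\<lambda>x. g' v x \<bullet> b)) (at v within S)"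
    proof cases
      case 1
      show ?thesis unfolding 1 g_def g'_def inner_axis vector_2
        by (auto intro!: derivative_eq_intros bounded_linear_imp_has_derivative bounded_linear_vec_nth)
    next
      case 2
      show ?thesis unfolding 2 g_def g'_def inner_axis vector_2
        by (auto intro!: derivative_eq_intros bounded_linear_imp_has_derivative bounded_linear_vec_nth)
    qed
  qed
  have det: "\<bar>det (matrix (g' v))\<bar> = v $ 1" if "v \<in> S" for v
  proof -
    have "det (matrix (g' v)) = v $ 1"
      unfolding det_2 matrix_def g'_def
      using distrib_left[of "v $ 1" "cos (v $ 2) * cos (v $ 2)" "sin (v $ 2) * sin (v $ 2)"]
      by (simp add: axis_def sin_cos_squared_add3 mult_ac)
    then show ?thesis using that by (simp add: S_def)
  qed
  have gc: "Complex (g v $ 1) (g v $ 2) = rcis (v $ 1) (v $ 2)" for v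
    by (simp add: g_def complex_eq_iff)
  have inj: "inj_on g S"
  proof (rule inj_onI)
    fix v w assume v: "v \<in> S" and w: "w \<in> S" and eq: "g v = g w"
    then have e: "rcis (v $ 1) (v $ 2) = rcis (w $ 1) (w $ 2)" by (metis gc)
    then have "cmod (rcis (v $ 1) (v $ 2)) = cmod (rcis (w $ 1) (w $ 2))" by simp
    then have 1: "v $ 1 = w $ 1" using v w by (simp add: S_def)
    then have "cis (v $ 2) = cis (w $ 2)" using e v by (simp add: rcis_def S_def)
    moreover have "Arg2pi (cis t) = t" if "0 < t" "t < 2 * pi" for t
      by (rule Arg2pi_unique[of 1]) (use that in \<open>auto simp: cis_conv_exp\<close>)
    ultimately have "v $ 2 = w $ 2" using v w unfolding S_def mem_Collect_eq by metis
    then show "v = w" using 1 by (simp add: vec_eq_iff forall_2)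
  qed
  have norm2: "norm v = cmod (Complex (v $ 1) (v $ 2))" for v :: "real^2"
    by (simp add: norm_vec_def L2_set_def UNIV_2 cmod_def)
  have img: "v \<in> g ` S" if v: "norm v < R" "v $ 2 \<noteq> 0" for v
  proof -
    let ?z = "Complex (v $ 1) (v $ 2)"
    have z: "?z \<noteq> 0" using v by (simp add: complex_eq_iff)
    have "Arg2pi ?z \<noteq> 0" using v by (simp add: Arg2pi_eq_0 complex_is_Real_iff)
    then have a: "0 < Arg2pi ?z" "Arg2pi ?z < 2 * pi"
      using Arg2pi_ge_0[of ?z] Arg2pi_lt_2pi[of ?z] by auto
    have "rcis (cmod ?z) (Arg2pi ?z) = ?z"
      using Arg2pi_eq[of ?z] by (simp add: rcis_def cis_conv_exp)
    then have "g (vector [cmod ?z, Arg2pi ?z]) = v"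
      using gc[of "vector [cmod ?z, Arg2pi ?z]"] by (simp add: vec_eq_iff forall_2)
    moreover have "vector [cmod ?z, Arg2pi ?z] \<in> S"
      using a z v by (simp add: S_def norm2)
    ultimately show ?thesis by (metis image_eqI)
  qed
  have sub: "{v. f v \<noteq> 0} - g ` S \<subseteq> {v. v $ 2 = 0}" using img supp by force
  have fU: "f absolutely_integrable_on UNIV"
    using f by (simp add: set_integrable_def integrable_completion)
  have neg: "negligible {v :: real^2. v $ 2 = 0}" by (rule negligible_standard_hyperplane_cart)
  have spike: "negligible {v \<in> UNIV - g ` S. f v \<noteq> 0}"
    by (rule negligible_subset[OF neg]) (use sub in auto)
  have "f absolutely_integrable_on g ` S"
    by (rule absolutely_integrable_spike_set[OF fU]) (use spike in \<open>auto intro: negligible_subset\<close>)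
  moreover have "integral (g ` S) f = integral UNIV f"
    by (rule integral_spike_set) (use spike in \<open>auto intro: negligible_subset\<close>)
  moreover have "integral UNIV f = (LINT v|lborel. f v)" by (rule integral_lborel[OF f])
  ultimately have "f absolutely_integrable_on g ` S \<and> integral (g ` S) f = (LINT v|lborel. f v)"
    by simp
  then have "(\<lambda>v. \<bar>det (matrix (g' v))\<bar> *\<^sub>R f (g v)) absolutely_integrable_on S \<and>
      integral S (\<lambda>v. \<bar>det (matrix (g' v))\<bar> *\<^sub>R f (g v)) = (LINT v|lborel. f v)"
    by (rule iffD2[OF has_absolute_integral_change_of_variables[OF S der inj]])
  moreover have "(\<lambda>v. \<bar>det (matrix (g' v))\<bar> *\<^sub>R f (g v)) absolutely_integrable_on S
      \<longleftrightarrow> (\<lambda>v. v $ 1 *\<^sub>R f (g v)) absolutely_integrable_on S"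
    by (rule set_integrable_cong) (simp_all add: det)
  moreover have "integral S (\<lambda>v. \<bar>det (matrix (g' v))\<bar> *\<^sub>R f (g v)) = integral S (\<lambda>v. v $ 1 *\<^sub>R f (g v))"
    by (rule integral_cong) (simp add: det)
  ultimately show "(\<lambda>v. v $ 1 *\<^sub>R f (g v)) absolutely_integrable_on S"
    "integral S (\<lambda>v. v $ 1 *\<^sub>R f (g v)) = (LINT v|lborel. f v)" by auto
qed

lemma polar_integral:
  fixes F :: "complex \<Rightarrow> complex"
  assumes F [measurable]: "F \<in> borel_measurable borel" and bd: "\<And>z. cmod (F z) \<le> B"
    and supp: "\<And>z. R \<le> cmod z \<Longrightarrow> F z = 0" and R: "R > 0"
  shows "(LINT z|lborel. F z)
    = (LINT r|lborel. indicator {0<..<R} r *\<^sub>R (r *\<^sub>R (LINT \<theta>|lborel. indicator {0<..<2 * pi} \<theta> *\<^sub>R F (rcis r \<theta>))))"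
proof -
  \<comment> \<open>\<open>polar_change\<close> handles fields with values in \<open>real^2\<close>,
    so F is split into real and imaginary parts; the linear map \<open>c\<close> below puts them
    together again.\<close>
  define f where "f v = (vector [Re (F (Complex (v $ 1) (v $ 2))), Im (F (Complex (v $ 1) (v $ 2)))] :: real^2)" for v :: "real^2"
  have mc [measurable]: "(\<lambda>v::real^2. Complex (v $ 1) (v $ 2)) \<in> borel_measurable borel"
    by (intro borel_measurable_continuous_onI) (auto simp: Complex_eq intro!: continuous_intros)
  have [measurable]: "f \<in> borel_measurable borel" unfolding f_def by measurable
  have norm2: "norm v = cmod (Complex (v $ 1) (v $ 2))" for v :: "real^2"
    by (simp add: norm_vec_def L2_set_def UNIV_2 cmod_def)
  have fn: "norm (f v) = cmod (F (Complex (v $ 1) (v $ 2)))" for v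
    unfolding norm2 by (simp add: f_def)
  have fs: "f v = 0" if "R \<le> norm v" for v
    using fn[of v] supp[of "Complex (v $ 1) (v $ 2)"] that norm2[of v] by simp
  have fi: "integrable lborel f"
  proof (rule Bochner_Integration.integrable_bound)
    show "integrable lborel (\<lambda>v :: real^2. indicator (cball 0 R) v * B)"
      by (intro integrable_mult_left integrable_real_indicator)
        (use emeasure_bounded_finite[OF bounded_cball, of "0 :: real^2" R] in simp_all)
    show "AE v in lborel. norm (f v) \<le> norm (indicator (cball 0 R) v * B)"
    proof (rule AE_I2)
      fix v :: "real^2"
      show "norm (f v) \<le> norm (indicator (cball 0 R) v * B)"
      proof (cases "R \<le> norm v")
        case False
        then have "indicator (cball 0 R) v = (1 :: real)" by simp
        then show ?thesis using bd[of "Complex (v $ 1) (v $ 2)"] fn[of v] by simp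
      qed (simp add: fs)
    qed
  qed simp
  define S where "S = {v :: real^2. 0 < v $ 1 \<and> v $ 1 < R \<and> 0 < v $ 2 \<and> v $ 2 < 2 * pi}"
  define g where "g v = (vector [v $ 1 * cos (v $ 2), v $ 1 * sin (v $ 2)] :: real^2)" for v :: "real^2"
  note pc = polar_change[where R = R and f = f, OF fi fs, folded S_def g_def]
  have [measurable]: "g \<in> borel_measurable borel" unfolding g_def by measurable
  have "open S" unfolding S_def
    by (intro open_Collect_conj open_Collect_less continuous_intros)
  then have [measurable]: "S \<in> sets borel" by auto
  define D where "D v = indicator S v *\<^sub>R (v $ 1 *\<^sub>R f (g v))" for v
  have Dm [measurable]: "D \<in> borel_measurable borel" unfolding D_def by measurable
  have Di: "integrable lborel D"
    using pc(1) unfolding set_integrable_def D_def[symmetric] by (simp add: integrable_completion)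
  have "(LINT v|lborel. D v) = integral UNIV D" by (rule integral_lborel[OF Di, symmetric])
  also have "\<dots> = integral S (\<lambda>v. v $ 1 *\<^sub>R f (g v))"
    unfolding D_def by (subst integral_restrict_UNIV[symmetric]) (auto intro!: integral_cong simp: indicator_def)
  finally have DL: "(LINT v|lborel. D v) = (LINT v|lborel. f v)" using pc(2) by simp
  define c where "c v = Complex (v $ 1) (v $ 2)" for v :: "real^2"
  have cl: "bounded_linear c"
    unfolding c_def Complex_eq
    by (intro bounded_linear_add bounded_linear_const_mult bounded_linear_compose[OF bounded_linear_of_real] bounded_linear_vec_nth)
  have cD: "c (D (vector [r, t])) = indicator {0<..<R} r *\<^sub>R (r *\<^sub>R (indicator {0<..<2 * pi} t *\<^sub>R F (rcis r t)))" for r t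
  proof -
    have rc: "Complex (r * cos t) (r * sin t) = rcis r t" by (simp add: complex_eq_iff)
    show ?thesis
      by (auto simp: D_def c_def S_def g_def f_def indicator_def rc) (simp_all add: complex_eq_iff)
  qed
  have "(LINT z|lborel. F z) = (LINT v|lborel. F (Complex ((v :: real^2) $ 1) (v $ 2)))"
    by (rule lborel_integral_transfer(1)[OF F, of "\<lambda>_. 0"]) measurable
  also have "\<dots> = (LINT v|lborel. c (f v))" by (simp add: c_def f_def)
  also have "\<dots> = c (LINT v|lborel. f v)" by (rule integral_bounded_linear[OF cl fi])
  also have "\<dots> = (LINT v|lborel. c (D v))" unfolding DL[symmetric] by (rule integral_bounded_linear[OF cl Di, symmetric])
  also have "\<dots> = (LINT p|(lborel \<Otimes>\<^sub>M lborel). c (D (vector [fst p, snd p])))"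
    using cl by (intro lborel_integral_transfer(2)[OF F]) (auto intro: borel_measurable_continuous_onI linear_continuous_on measurable_compose[OF Dm])
  also have "\<dots> = (LINT r|lborel. LINT t|lborel. c (D (vector [r, t])))"
  proof -
    have "integrable (lborel \<Otimes>\<^sub>M lborel) (\<lambda>p. D (vector [fst p, snd p]))"
      using Di lborel_integral_transfer(3)[of "\<lambda>_. 0" D] by simp
    then have "integrable (lborel \<Otimes>\<^sub>M lborel) (\<lambda>p. c (D (vector [fst p, snd p])))"
      by (rule integrable_bounded_linear[OF cl])
    then have "integrable (lborel \<Otimes>\<^sub>M lborel) (\<lambda>(r, t). c (D (vector [r, t])))"
      unfolding split_beta' .
    from lborel_pair.integral_fst[OF this] show ?thesis unfolding split_beta' by (rule sym)
  qed
  finally show ?thesis unfolding cD scaleR_conv_of_real by (simp only: integral_mult_right_zero)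
qed

subsection \<open>Radial modes of weak solutions\<close>

text \<open>The weak formulation for the mode \<open>U\<close>, tested with
  \<open>\<eta>(|z|\<^sup>2)\<close> times a power of \<open>z\<close> or of its conjugate.\<close>

definition radial_weak :: "nat \<Rightarrow> (real \<Rightarrow> real) \<Rightarrow> (real \<Rightarrow> complex) \<Rightarrow> bool" where
  "radial_weak n k U \<longleftrightarrow> (\<forall>R>0. \<forall>\<eta> \<eta>1 \<eta>2 :: real \<Rightarrow> complex.
     (\<forall>\<rho>. (\<eta> has_vector_derivative \<eta>1 \<rho>) (at \<rho>) \<and> (\<eta>1 has_vector_derivative \<eta>2 \<rho>) (at \<rho>)) \<longrightarrow>
     continuous_on UNIV \<eta>2 \<longrightarrow> (\<forall>\<rho>\<ge>R\<^sup>2. \<eta> \<rho> = 0) \<longrightarrow>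
     ((\<lambda>r. of_real (r ^ Suc n) * (4 * (of_real (r\<^sup>2) * \<eta>2 (r\<^sup>2) + of_nat (n + 1) * \<eta>1 (r\<^sup>2))
        + of_real (k r) * \<eta> (r\<^sup>2)) * U r) has_integral 0) {0..R})"

definition step_coeff :: "real \<Rightarrow> real \<Rightarrow> real \<Rightarrow> real \<Rightarrow> real" where
  "step_coeff e k1 k2 r = (if r < e then k1 else k2)"

text \<open>The integral from \<open>0\<close> to \<open>r\<close> of \<open>k t\<^sup>n\<^sup>+\<^sup>1 U\<close> for the step function \<open>k\<close>.\<close>

definition mode_flux :: "nat \<Rightarrow> real \<Rightarrow> real \<Rightarrow> real \<Rightarrow> (real \<Rightarrow> complex) \<Rightarrow> real \<Rightarrow> complex" where
  "mode_flux n e k1 k2 U r = (let I = (\<lambda>r. integral {0..r} (\<lambda>t. of_real (t ^ Suc n) * U t)) in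
     of_real k2 * I r + of_real (k1 - k2) * I (min r e))"

lemma integral_deriv_at:
  fixes f :: "real \<Rightarrow> complex"
  assumes f: "continuous_on {0..} f" and r: "r > 0"
  shows "((\<lambda>r. integral {0..r} f) has_vector_derivative f r) (at r)"
proof -
  have c: "continuous_on {0..r + 1} f" using f by (rule continuous_on_subset) auto
  have "((\<lambda>r. integral {0..r} f) has_vector_derivative f r) (at r within {0..r + 1})"
    by (rule integral_has_vector_derivative[OF c]) (use r in simp)
  moreover have "at r within {0..r + 1} = at r" by (rule at_within_Icc_at) (use r in auto)
  ultimately show ?thesis by simp
qed

lemma continuous_on_integral0:
  fixes f :: "real \<Rightarrow> complex"
  assumes f: "continuous_on {0..} f"
  shows "continuous_on {0..} (\<lambda>r. integral {0..r} f)"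
proof -
  have "continuous (at r within {0..}) (\<lambda>r. integral {0..r} f)" if r: "r \<ge> 0" for r
  proof -
    have c: "continuous_on {0..r + 1} f" using f by (rule continuous_on_subset) auto
    have "continuous_on {0..r + 1} (\<lambda>r. integral {0..r} f)"
      by (intro indefinite_integral_continuous_1 integrable_continuous_real c)
    then have "continuous (at r within {0..r + 1}) (\<lambda>r. integral {0..r} f)"
      using r by (simp add: continuous_on_eq_continuous_within)
    moreover have "at r within {0..} = at r within {0..r + 1}"
      by (rule at_within_nhd[of _ "{..<r + 1}"]) auto
    ultimately show ?thesis by (simp add: continuous_within)
  qed
  then show ?thesis by (simp add: continuous_on_eq_continuous_within)
qed

context
  fixes n :: nat and e k1 k2 :: real and U :: "real \<Rightarrow> complex"
  assumes U: "continuous_on {0..} U" and e: "e > 0"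
begin

abbreviation "G \<equiv> mode_flux n e k1 k2 U"

lemma cont_tU: "continuous_on {0..} (\<lambda>t. of_real (t ^ Suc n) * U t)"
  by (intro continuous_intros U)

lemma G_0: "G 0 = 0"
  using e by (simp add: mode_flux_def)

lemma cont_G: "continuous_on {0..} G"
  unfolding mode_flux_def[abs_def] Let_def
  by (intro continuous_intros continuous_on_integral0[OF cont_tU]
      continuous_on_compose2[OF continuous_on_integral0[OF cont_tU]]) (use e in auto)

lemma G_deriv:
  assumes r: "r > 0" "r \<noteq> e"
  shows "(G has_vector_derivative of_real (step_coeff e k1 k2 r) * (of_real (r ^ Suc n) * U r)) (at r)"
proof -
  let ?I = "\<lambda>r. integral {0..r} (\<lambda>t. of_real (t ^ Suc n) * U t)"
  note d = integral_deriv_at[OF cont_tU r(1)]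
  show ?thesis
  proof (cases "r < e")
    case True
    have "((\<lambda>r. of_real k1 * ?I r) has_vector_derivative of_real k1 * (of_real (r ^ Suc n) * U r)) (at r)"
      by (intro has_vector_derivative_mult_right d)
    then have "(G has_vector_derivative of_real k1 * (of_real (r ^ Suc n) * U r)) (at r)"
      by (rule has_vector_derivative_transform_within_open[where S = "{..<e}"])
        (use True in \<open>auto simp: mode_flux_def algebra_simps\<close>)
    then show ?thesis using True by (simp add: step_coeff_def)
  next
    case False
    have "((\<lambda>r. of_real k2 * ?I r + of_real (k1 - k2) * ?I e) has_vector_derivative of_real k2 * (of_real (r ^ Suc n) * U r) + 0) (at r)"
      by (intro has_vector_derivative_add has_vector_derivative_const has_vector_derivative_mult_right d)
    then have "(G has_vector_derivative of_real k2 * (of_real (r ^ Suc n) * U r) + 0) (at r)"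
      by (rule has_vector_derivative_transform_within_open[where S = "{e<..}"])
        (use False r in \<open>auto simp: mode_flux_def\<close>)
    then show ?thesis using False by (simp add: step_coeff_def)
  qed
qed

text \<open>The du Bois-Reymond argument: the derivative of the test function \<open>\<theta>\<close> below is a weight times
  the conjugate of \<open>h\<close> minus its weighted mean.\<close>

lemma radial_weak_const:
  assumes weak: "radial_weak n (step_coeff e k1 k2) U" and d: "0 < d" "d < R"
  shows "\<exists>C. \<forall>r\<in>{d<..<R}. U r / of_real (r ^ n) + integral {d..r} (\<lambda>t. G t / of_real (t ^ (2 * n + 1))) = C"
proof -
  define q where "q t = G t / of_real (t ^ (2 * n + 1))" for t
  define h where "h r = U r / of_real (r ^ n) + integral {d..r} q" for r
  have cG: "continuous_on {d..R} G" using cont_G by (rule continuous_on_subset) (use d in auto)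
  have cU: "continuous_on {d..R} U" using U by (rule continuous_on_subset) (use d in auto)
  have cq: "continuous_on {d..R} q" unfolding q_def
    by (intro continuous_intros cG) (use d in auto)
  have cB: "continuous_on {d..R} (\<lambda>r. integral {d..r} q)"
    by (intro indefinite_integral_continuous_1 integrable_continuous_real cq)
  have ch: "continuous_on {d..R} h" unfolding h_def
    by (intro continuous_intros cU cB) (use d in auto)
  define chi where "chi t = max 0 ((t - d) * (R - t))" for t
  have chi0: "chi t = 0" if "t \<notin> {d<..<R}" for t
  proof -
    have "(t - d) * (R - t) \<le> 0" using that d
      by (cases "t \<le> d") (auto intro: mult_nonpos_nonneg mult_nonneg_nonpos)
    then show ?thesis by (simp add: chi_def)
  qed
  have chi_pos: "chi t > 0" if "t \<in> {d<..<R}" for t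
    using that mult_pos_pos[of "t - d" "R - t"] by (simp add: chi_def)
  have cchi: "continuous_on S chi" for S unfolding chi_def by (intro continuous_intros)
  \<comment> \<open>Extending h by its end values makes \<open>hc\<close>, and with it
    \<open>th'\<close>, continuous on the whole line.\<close>
  define clamp where "clamp t = max d (min R t)" for t
  define hc where "hc t = cnj (h (clamp t))" for t
  have chc: "continuous_on S hc" for S unfolding hc_def clamp_def
    by (intro continuous_intros continuous_on_compose2[OF ch]) (use d in auto)
  define mass where "mass = integral {d..R} chi"
  have "mass \<noteq> 0"
  proof
    assume "mass = 0"
    then have "\<forall>x\<in>{d..R}. chi x = 0"
      using integral_eq_0_iff[of d R chi] d cchi[of "{d..R}"] by (simp add: mass_def chi_def)
    then show False using chi_pos[of "(d + R) / 2"] d by force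
  qed
  define m where "m = integral {d..R} (\<lambda>t. of_real (chi t) * hc t) / of_real mass"
  define th' where "th' t = of_real (chi t) * (hc t - m)" for t
  have cth': "continuous_on S th'" for S unfolding th'_def by (intro continuous_intros cchi chc)
  have th'0: "th' t = 0" if "t \<notin> {d<..<R}" for t using chi0[OF that] by (simp add: th'_def)
  define th where "th t = integral {0..t} th'" for t
  have dth: "(th has_vector_derivative th' t) (at t)" if "t > 0" for t
    unfolding th_def[abs_def] by (rule integral_deriv_at[OF cth' that])
  have th_low: "th t = 0" if "t \<le> d" for t
    unfolding th_def using that by (intro integral_unique has_integral_is_0) (auto intro: th'0)
  have "th R = integral {d..R} th'"
  proof -
    have "th R = integral {0..d} th' + integral {d..R} th'"
      unfolding th_def using d by (intro Henstock_Kurzweil_Integration.integral_combine[symmetric] integrable_continuous_real cth') auto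
    then show ?thesis using th_low[of d] by (simp add: th_def)
  qed
  also have "\<dots> = integral {d..R} (\<lambda>t. of_real (chi t) * hc t) - integral {d..R} (\<lambda>t. of_real (chi t) * m)"
    unfolding th'_def right_diff_distrib
    by (intro integral_diff integrable_continuous_real continuous_intros cchi chc)
  also have "integral {d..R} (\<lambda>t. complex_of_real (chi t) * m) = of_real mass * m"
  proof -
    have "((\<lambda>t. complex_of_real (chi t)) has_integral of_real mass) {d..R}"
      unfolding mass_def by (intro has_integral_of_real integrable_integral integrable_continuous_real cchi)
    then show ?thesis by (intro integral_unique has_integral_mult_left)
  qed
  also have "integral {d..R} (\<lambda>t. of_real (chi t) * hc t) - of_real mass * m = 0"
    using \<open>mass \<noteq> 0\<close> by (simp add: m_def)
  finally have thR: "th R = 0" .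
  have th_high: "th t = 0" if "t \<ge> R" for t
  proof -
    have "th t = th R + integral {R..t} th'"
      unfolding th_def using that d by (intro Henstock_Kurzweil_Integration.integral_combine[symmetric] integrable_continuous_real cth') auto
    moreover have "integral {R..t} th' = 0" by (intro integral_unique has_integral_is_0) (auto intro: th'0)
    ultimately show ?thesis using thR by simp
  qed
  \<comment> \<open>Since rho eta2 + (n + 1) eta1 = rho^(-n) (rho^(n + 1) eta1)', prescribing rho^(n
    + 1) eta1 = th (sqrt rho) turns the second-order operator of the weak equation into
    \<open>th'\<close>.\<close>
  define eta1 where "eta1 \<rho> = th (sqrt \<rho>) / of_real (\<rho> ^ Suc n)" for \<rho>
  define eta2 where "eta2 \<rho> = th' (sqrt \<rho>) * of_real (1 / (2 * sqrt \<rho> * \<rho> ^ Suc n))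
    - of_nat (Suc n) * th (sqrt \<rho>) / of_real (\<rho> ^ (n + 2))" for \<rho>
  have zero12: "eta1 \<rho> = 0" "eta2 \<rho> = 0" if "\<rho> < d\<^sup>2" for \<rho>
  proof -
    have "sqrt \<rho> \<le> d" using real_sqrt_le_mono[OF less_imp_le[OF that]] d by simp
    then show "eta1 \<rho> = 0" "eta2 \<rho> = 0" using th_low th'0 by (auto simp: eta1_def eta2_def)
  qed
  have deta1: "(eta1 has_vector_derivative eta2 \<rho>) (at \<rho>)" for \<rho>
  proof (cases "\<rho> < d\<^sup>2")
    case True
    have "((\<lambda>_. 0) has_vector_derivative 0) (at \<rho>)" by simp
    then have "(eta1 has_vector_derivative 0) (at \<rho>)"
      by (rule has_vector_derivative_transform_within_open[where S = "{..<d\<^sup>2}"]) (use True zero12 in auto)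
    then show ?thesis using zero12(2)[OF True] by simp
  next
    case False
    then have p: "\<rho> > 0" using d by (smt (verit) zero_less_power)
    have s: "(sqrt has_vector_derivative 1 / (2 * sqrt \<rho>)) (at \<rho>)"
      using DERIV_real_sqrt[OF p] by (simp add: has_real_derivative_iff_has_vector_derivative inverse_eq_divide mult.commute)
    have "((th \<circ> sqrt) has_vector_derivative (1 / (2 * sqrt \<rho>)) *\<^sub>R th' (sqrt \<rho>)) (at \<rho>)"
      by (rule vector_diff_chain_at[OF s dth]) (use p in simp)
    then have t: "((\<lambda>\<rho>. th (sqrt \<rho>)) has_vector_derivative of_real (1 / (2 * sqrt \<rho>)) * th' (sqrt \<rho>)) (at \<rho>)"
      by (simp only: o_def scaleR_conv_of_real)
    have i: "((\<lambda>\<rho>. complex_of_real (1 / \<rho> ^ Suc n)) has_vector_derivative of_real (- real (Suc n) / \<rho> ^ (n + 2))) (at \<rho>)"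
    proof (rule has_vector_derivative_of_real)
      have "((\<lambda>x. x ^ Suc n) has_real_derivative real (Suc n) * \<rho> ^ n) (at \<rho>)"
        using DERIV_pow[of "Suc n" \<rho>] by simp
      then have "((\<lambda>x. 1 / x ^ Suc n) has_real_derivative
          (0 * \<rho> ^ Suc n - 1 * (real (Suc n) * \<rho> ^ n)) / (\<rho> ^ Suc n * \<rho> ^ Suc n)) (at \<rho>)"
        using p by (intro DERIV_divide DERIV_const) auto
      then show "((\<lambda>x. 1 / x ^ Suc n) has_real_derivative - real (Suc n) / \<rho> ^ (n + 2)) (at \<rho>)"
        by (rule DERIV_cong) (use p in \<open>simp add: divide_simps\<close>)
    qed
    have "((\<lambda>\<rho>. th (sqrt \<rho>) * of_real (1 / \<rho> ^ Suc n)) has_vector_derivative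
        th (sqrt \<rho>) * of_real (- real (Suc n) / \<rho> ^ (n + 2)) + of_real (1 / (2 * sqrt \<rho>)) * th' (sqrt \<rho>) * of_real (1 / \<rho> ^ Suc n)) (at \<rho>)"
      by (rule has_vector_derivative_mult[OF t i])
    also have "(\<lambda>\<rho>. th (sqrt \<rho>) * of_real (1 / \<rho> ^ Suc n)) = eta1" by (auto simp: eta1_def)
    also have "th (sqrt \<rho>) * of_real (- real (Suc n) / \<rho> ^ (n + 2)) + of_real (1 / (2 * sqrt \<rho>)) * th' (sqrt \<rho>) * of_real (1 / \<rho> ^ Suc n) = eta2 \<rho>"
    proof -
      have 1: "complex_of_real (- real (Suc n) / x) = - (of_nat (Suc n) / of_real x)" for x
        by (simp del: of_nat_Suc)
      have 2: "of_real a * z * of_real b = z * complex_of_real (a * b)" for a b z by simp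
      have 3: "1 / (2 * sqrt \<rho>) * (1 / \<rho> ^ Suc n) = 1 / (2 * sqrt \<rho> * \<rho> ^ Suc n)" by (simp del: power_Suc)
      have 4: "z * - (a / b) + y = y - a * z / b" for z a b y :: complex by simp
      show ?thesis unfolding eta2_def 1 2 3 4 ..
    qed
    finally show ?thesis .
  qed
  have cth: "continuous_on {0..} th" unfolding th_def by (rule continuous_on_integral0[OF cth'])
  have ceta2: "continuous_on UNIV eta2"
  proof -
    have "continuous_on {..<d\<^sup>2} eta2"
      by (subst continuous_on_cong[OF refl zero12(2)]) auto
    moreover have "continuous_on {0<..} eta2" unfolding eta2_def
      by (intro continuous_intros continuous_on_compose2[OF cth] continuous_on_compose2[OF cth'[of UNIV]]) auto
    ultimately have "continuous_on ({..<d\<^sup>2} \<union> {0<..}) eta2" by (intro continuous_on_open_Un) auto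
    moreover have "{..<d\<^sup>2} \<union> {0<..} = (UNIV :: real set)" using d by (auto simp: not_less intro: le_less_trans)
    ultimately show ?thesis by simp
  qed
  have ceta1: "continuous_on S eta1" for S
    by (intro continuous_at_imp_continuous_on ballI has_vector_derivative_continuous[OF deta1])
  define eta where "eta \<rho> = integral {0..\<rho>} eta1 - integral {0..R\<^sup>2} eta1" for \<rho>
  have deta: "(eta has_vector_derivative eta1 \<rho>) (at \<rho>)" for \<rho>
  proof (cases "\<rho> < d\<^sup>2")
    case True
    have "((\<lambda>_. - integral {0..R\<^sup>2} eta1) has_vector_derivative 0) (at \<rho>)" by simp
    then have "(eta has_vector_derivative 0) (at \<rho>)"
    proof (rule has_vector_derivative_transform_within_open[where S = "{..<d\<^sup>2}"])
      fix x assume "x \<in> {..<d\<^sup>2}"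
      then have "integral {0..x} eta1 = 0" by (intro integral_unique has_integral_is_0) (auto intro: zero12)
      then show "- integral {0..R\<^sup>2} eta1 = eta x" by (simp add: eta_def)
    qed (use True in auto)
    then show ?thesis using zero12(1)[OF True] by simp
  next
    case False
    then have p: "\<rho> > 0" using d by (smt (verit) zero_less_power)
    have "(eta has_vector_derivative eta1 \<rho> - 0) (at \<rho>)"
      unfolding eta_def[abs_def] by (intro has_vector_derivative_diff integral_deriv_at has_vector_derivative_const ceta1 p)
    then show ?thesis by simp
  qed
  have eta_high: "eta \<rho> = 0" if "\<rho> \<ge> R\<^sup>2" for \<rho>
  proof -
    have "integral {0..\<rho>} eta1 = integral {0..R\<^sup>2} eta1 + integral {R\<^sup>2..\<rho>} eta1"
      using that by (intro Henstock_Kurzweil_Integration.integral_combine[symmetric] integrable_continuous_real ceta1) auto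
    moreover have "integral {R\<^sup>2..\<rho>} eta1 = 0"
    proof (intro integral_unique has_integral_is_0)
      fix x assume "x \<in> {R\<^sup>2..\<rho>}"
      then have "R \<le> sqrt x" using d by (intro real_le_rsqrt) auto
      then show "eta1 x = 0" using th_high by (simp add: eta1_def)
    qed
    ultimately show ?thesis by (simp add: eta_def)
  qed
  have R0: "R > 0" using d by simp
  have I1: "((\<lambda>r. of_real (r ^ Suc n) * (4 * (of_real (r\<^sup>2) * eta2 (r\<^sup>2) + of_nat (n + 1) * eta1 (r\<^sup>2))
        + of_real (step_coeff e k1 k2 r) * eta (r\<^sup>2)) * U r) has_integral 0) {0..R}"
    using weak[unfolded radial_weak_def, rule_format, OF R0, of eta eta1 eta2] deta deta1 ceta2 eta_high by blast
  have sqd: "((\<lambda>r. eta (r\<^sup>2)) has_vector_derivative of_real (2 * r) * eta1 (r\<^sup>2)) (at r)" for r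
  proof -
    have "((\<lambda>r. r\<^sup>2) has_vector_derivative 2 * r) (at r)"
      unfolding has_real_derivative_iff_has_vector_derivative[symmetric] by (auto intro!: derivative_eq_intros)
    from vector_diff_chain_at[OF this deta] show ?thesis by (simp only: o_def scaleR_conv_of_real)
  qed
  \<comment> \<open>Integration by parts against the primitive \<open>G\<close> trades the
    zero-order term with \<open>eta\<close> for one with \<open>eta1\<close>. The interface e is the
    exceptional point, and the boundary terms vanish because G 0 = 0 and eta vanishes at
    R^2.\<close>
  have "((\<lambda>r. G r * (of_real (2 * r) * eta1 (r\<^sup>2)) + of_real (step_coeff e k1 k2 r) * (of_real (r ^ Suc n) * U r) * eta (r\<^sup>2))
      has_integral (G R * eta (R\<^sup>2) - G 0 * eta (0\<^sup>2))) {0..R}"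
  proof (rule fundamental_theorem_of_calculus_interior_strong[where S = "{e}" and f = "\<lambda>r. G r * eta (r\<^sup>2)"])
    show "((\<lambda>r. G r * eta (r\<^sup>2)) has_vector_derivative
        G r * (of_real (2 * r) * eta1 (r\<^sup>2)) + of_real (step_coeff e k1 k2 r) * (of_real (r ^ Suc n) * U r) * eta (r\<^sup>2)) (at r)"
      if "r \<in> {0<..<R} - {e}" for r
      using that by (intro has_vector_derivative_mult G_deriv sqd) auto
    have "continuous_on {0..R} (\<lambda>r. eta (r\<^sup>2))"
      by (intro continuous_at_imp_continuous_on ballI has_vector_derivative_continuous[OF sqd])
    then show "continuous_on {0..R} (\<lambda>r. G r * eta (r\<^sup>2))"
      by (intro continuous_intros continuous_on_subset[OF cont_G]) auto
  qed (use R0 in auto)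
  then have I2: "((\<lambda>r. G r * (of_real (2 * r) * eta1 (r\<^sup>2)) + of_real (step_coeff e k1 k2 r) * (of_real (r ^ Suc n) * U r) * eta (r\<^sup>2))
      has_integral 0) {0..R}" by (simp add: G_0 eta_high)
  have "((\<lambda>r. if r \<in> {d..R} then 2 * (U r / of_real (r ^ n)) * th' r - 2 * q r * th r else 0) has_integral 0 - 0) {0..R}"
  proof (rule has_integral_eq[OF _ has_integral_diff[OF I1 I2]])
    fix r assume r: "r \<in> {0..R}"
    show "of_real (r ^ Suc n) * (4 * (of_real (r\<^sup>2) * eta2 (r\<^sup>2) + of_nat (n + 1) * eta1 (r\<^sup>2))
        + of_real (step_coeff e k1 k2 r) * eta (r\<^sup>2)) * U r
      - (G r * (of_real (2 * r) * eta1 (r\<^sup>2)) + of_real (step_coeff e k1 k2 r) * (of_real (r ^ Suc n) * U r) * eta (r\<^sup>2))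
      = (if r \<in> {d..R} then 2 * (U r / of_real (r ^ n)) * th' r - 2 * q r * th r else 0)"
    proof (cases "r < d")
      case True
      then have "r\<^sup>2 < d\<^sup>2" using r by (intro power_strict_mono) auto
      then show ?thesis using True zero12 by simp
    next
      case False
      then have r0: "r > 0" "r \<in> {d..R}" using d r by auto
      define X P where "X = complex_of_real r" and "P = X ^ (2 * n + 1)"
      have X: "X \<noteq> 0" "P \<noteq> 0" using r0 by (auto simp: X_def P_def)
      have sq: "sqrt (r\<^sup>2) = r" using r0 by simp
      have pw: "(r\<^sup>2) ^ Suc n = r * r ^ (2 * n + 1)" "(r\<^sup>2) ^ (n + 2) = r\<^sup>2 * (r * r ^ (2 * n + 1))"
        by (simp_all add: power_mult[symmetric] power_add[symmetric] power_Suc[symmetric] del: power_Suc)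
      have e1: "eta1 (r\<^sup>2) = th r / (X * P)"
        unfolding eta1_def sq pw by (simp add: X_def P_def)
      have e2: "eta2 (r\<^sup>2) = th' r / (2 * X\<^sup>2 * P) - of_nat (Suc n) * th r / (X\<^sup>2 * (X * P))"
        unfolding eta2_def sq pw by (simp add: X_def P_def power2_eq_square)
      have a: "of_real (r\<^sup>2) * eta2 (r\<^sup>2) + of_nat (n + 1) * eta1 (r\<^sup>2) = th' r / (2 * P)"
      proof -
        have "X\<^sup>2 * (a / (2 * X\<^sup>2 * P) - N * t / (X\<^sup>2 * (X * P))) + N * (t / (X * P)) = a / (2 * P)" for a t N
          using X by (simp add: right_diff_distrib)
        moreover have "of_real (r\<^sup>2) = X\<^sup>2" "n + 1 = Suc n" by (simp_all add: X_def)
        ultimately show ?thesis unfolding e1 e2 by simp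
      qed
      have b: "of_real (2 * r) * eta1 (r\<^sup>2) = 2 * th r / P"
        unfolding e1 using X by (simp add: X_def)
      have c: "of_real (r ^ Suc n) * (4 * (t / (2 * P))) * v = 2 * (v / of_real (r ^ n)) * t" for t v
      proof -
        have "P = X ^ Suc n * X ^ n" by (simp add: P_def power_add mult_2)
        moreover have "4 * (t / (2 * (a * b))) * a = 2 * t / b" if "a \<noteq> 0" for a b :: complex using that by simp
        ultimately have "4 * (t / (2 * P)) * X ^ Suc n = 2 * t / X ^ n" using X by simp
        then show ?thesis by (simp add: X_def mult_ac)
      qed
      have qP: "q r = G r / P" by (simp add: q_def P_def X_def)
      have "of_real (r ^ Suc n) * (4 * (of_real (r\<^sup>2) * eta2 (r\<^sup>2) + of_nat (n + 1) * eta1 (r\<^sup>2))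
        + of_real (step_coeff e k1 k2 r) * eta (r\<^sup>2)) * U r
      - (G r * (of_real (2 * r) * eta1 (r\<^sup>2)) + of_real (step_coeff e k1 k2 r) * (of_real (r ^ Suc n) * U r) * eta (r\<^sup>2))
      = of_real (r ^ Suc n) * (4 * (of_real (r\<^sup>2) * eta2 (r\<^sup>2) + of_nat (n + 1) * eta1 (r\<^sup>2))) * U r
       - G r * (of_real (2 * r) * eta1 (r\<^sup>2))" proof -
        have "A * (4 * B + s * E) * u - (g * F + s * (A * u) * E) = A * (4 * B) * u - g * F" for A B s E u g F :: complex
          by (simp add: algebra_simps)
        then show ?thesis .
      qed
      also have "\<dots> = 2 * (U r / of_real (r ^ n)) * th' r - 2 * q r * th r"
        unfolding a b c qP by simp
      finally show ?thesis using r0 by simp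
    qed
  qed
  then have I3: "((\<lambda>r. 2 * (U r / of_real (r ^ n)) * th' r - 2 * q r * th r) has_integral 0) {d..R}"
    using d by (subst (asm) has_integral_restrict) auto
  \<comment> \<open>A second integration by parts moves the remaining term onto \<open>th'\<close>;
    the boundary terms vanish since th R = 0 and the integral over {d..d} is 0.\<close>
  have "((\<lambda>r. 2 * integral {d..r} q * th' r + 2 * q r * th r) has_integral
      (2 * integral {d..R} q * th R - 2 * integral {d..d} q * th d)) {d..R}"
  proof (rule fundamental_theorem_of_calculus_interior_strong[where S = "{}" and f = "\<lambda>r. 2 * integral {d..r} q * th r"])
    fix r assume r: "r \<in> {d<..<R} - {}"
    have "((\<lambda>r. integral {d..r} q) has_vector_derivative q r) (at r within {d..R})"
      by (rule integral_has_vector_derivative[OF cq]) (use r in simp)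
    then have "((\<lambda>r. integral {d..r} q) has_vector_derivative q r) (at r)"
      using r by (simp add: at_within_Icc_at)
    then show "((\<lambda>r. 2 * integral {d..r} q * th r) has_vector_derivative 2 * integral {d..r} q * th' r + 2 * q r * th r) (at r)"
      using r d by (intro has_vector_derivative_mult has_vector_derivative_mult_right dth) auto
  next
    show "continuous_on {d..R} (\<lambda>r. 2 * integral {d..r} q * th r)"
      by (intro continuous_intros cB continuous_on_subset[OF cth]) (use d in auto)
  qed (use d in auto)
  then have "((\<lambda>r. 2 * integral {d..r} q * th' r + 2 * q r * th r) has_integral 0) {d..R}"
    by (simp add: thR)
  from has_integral_add[OF I3 this] have "((\<lambda>r. 2 * (h r * th' r)) has_integral 0) {d..R}"
    by (simp add: h_def algebra_simps)
  from has_integral_mult_right[OF this, of "1 / 2"] have I4: "((\<lambda>r. h r * th' r) has_integral 0) {d..R}" by simp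
  have "(th' has_integral 0) {d..R}"
    using integrable_integral[OF integrable_continuous_real[OF cth', of d R]] \<open>th R = integral {d..R} th'\<close> thR by simp
  then have "((\<lambda>r. cnj m * th' r) has_integral cnj m * 0) {d..R}" by (rule has_integral_mult_right)
  from has_integral_diff[OF I4 this] have I5: "((\<lambda>r. h r * th' r - cnj m * th' r) has_integral 0) {d..R}" by simp
  \<comment> \<open>As \<open>th'\<close> has integral 0, a multiple of it may be subtracted. The
    integrand becomes a positive weight times a square, so the square vanishes.\<close>
  have eq: "h r * th' r - cnj m * th' r = of_real (chi r * (cmod (h r - cnj m))\<^sup>2)" if "r \<in> {d..R}" for r
  proof -
    have "hc r = cnj (h r)" using that by (auto simp: hc_def clamp_def)
    then have "h r * th' r - cnj m * th' r = of_real (chi r) * ((h r - cnj m) * cnj (h r - cnj m))"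
      by (simp add: th'_def algebra_simps)
    then show ?thesis unfolding of_real_mult complex_norm_square .
  qed
  have "((\<lambda>r. complex_of_real (chi r * (cmod (h r - cnj m))\<^sup>2)) has_integral 0) {d..R}"
    by (rule has_integral_eq[OF eq I5])
  from has_integral_linear[OF this bounded_linear_Re]
  have "((\<lambda>r. chi r * (cmod (h r - cnj m))\<^sup>2) has_integral 0) {d..R}"
    by (simp only: o_def Re_complex_of_real zero_complex.sel)
  then have "integral {d..R} (\<lambda>r. chi r * (cmod (h r - cnj m))\<^sup>2) = 0" by (rule integral_unique)
  moreover have "continuous_on {d..R} (\<lambda>r. chi r * (cmod (h r - cnj m))\<^sup>2)"
    by (intro continuous_intros cchi ch)
  ultimately have z: "\<forall>r\<in>{d..R}. chi r * (cmod (h r - cnj m))\<^sup>2 = 0"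
    using integral_eq_0_iff[of d R "\<lambda>r. chi r * (cmod (h r - cnj m))\<^sup>2"] d by (simp add: chi_def)
  have "h r = cnj m" if "r \<in> {d<..<R}" for r
    using z[rule_format, of r] chi_pos[OF that] that by auto
  then show ?thesis unfolding h_def q_def by blast
qed

text \<open>A continuous solution of the weak equation is differentiable, because it differs from a
  constant by the primitive of a continuous function. The conclusion includes r = e, which is the
  transmission condition.\<close>

lemma radial_weak_deriv:
  assumes weak: "radial_weak n (step_coeff e k1 k2) U" and r: "r > 0"
  shows "((\<lambda>r. U r / of_real (r ^ n)) has_vector_derivative - (G r / of_real (r ^ (2 * n + 1)))) (at r)"
proof -
  let ?q = "\<lambda>t. G t / of_real (t ^ (2 * n + 1))"
  have d: "0 < r / 2" "r / 2 < 2 * r" using r by auto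
  obtain C where C: "\<And>s. s \<in> {r / 2<..<2 * r} \<Longrightarrow> U s / of_real (s ^ n) + integral {r / 2..s} ?q = C"
    using radial_weak_const[OF weak d] by blast
  have cq: "continuous_on {r / 2..2 * r} ?q"
    by (intro continuous_intros continuous_on_subset[OF cont_G]) (use r in auto)
  have "((\<lambda>s. integral {r / 2..s} ?q) has_vector_derivative ?q r) (at r within {r / 2..2 * r})"
    by (rule integral_has_vector_derivative[OF cq]) (use r in simp)
  then have "((\<lambda>s. integral {r / 2..s} ?q) has_vector_derivative ?q r) (at r)"
    using r by (simp add: at_within_Icc_at)
  then have "((\<lambda>s. C - integral {r / 2..s} ?q) has_vector_derivative 0 - ?q r) (at r)"
    by (intro has_vector_derivative_diff has_vector_derivative_const)
  then have "((\<lambda>r. U r / of_real (r ^ n)) has_vector_derivative 0 - ?q r) (at r)"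
  proof (rule has_vector_derivative_transform_within_open[where S = "{r / 2<..<2 * r}"])
    fix s assume "s \<in> {r / 2<..<2 * r}"
    then show "C - integral {r / 2..s} ?q = U s / of_real (s ^ n)" using C[of s] by (simp add: algebra_simps)
  qed (use r in auto)
  then show ?thesis by simp
qed

end

section \<open>Reduction of the two-dimensional weak equation to its Fourier modes\<close>

lemma test_functionI:
  assumes d: "\<And>z. (\<phi> has_derivative D z) (at z)"
    and c: "continuous_on UNIV (\<lambda>z. D z 1)" "continuous_on UNIV (\<lambda>z. D z \<i>)"
    and supp: "\<And>z. R \<le> cmod z \<Longrightarrow> \<phi> z = 0"
  shows "test_function \<phi>" and "dir_deriv v \<phi> z = D z v"
proof -
  have e: "frechet_derivative \<phi> (at z) = D z" for z
    using frechet_derivative_at[OF d] by simp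
  then have dd: "dir_deriv v \<phi> = (\<lambda>z. D z v)" for v by (rule_tac ext) (simp add: dir_deriv_def)
  then show "dir_deriv v \<phi> z = D z v" by simp
  have "{z. \<phi> z \<noteq> 0} \<subseteq> cball 0 R" using supp by (force simp: not_le intro: less_imp_le ccontr)
  then have "bounded {z. \<phi> z \<noteq> 0}" by (rule bounded_subset[OF bounded_cball])
  then show "test_function \<phi>"
    unfolding test_function_def dd using d c by (auto simp: differentiable_def)
qed

lemma integrable_bounded_support:
  fixes f :: "complex \<Rightarrow> complex"
  assumes [measurable]: "f \<in> borel_measurable borel" and b: "\<And>z. cmod (f z) \<le> B"
    and supp: "\<And>z. R \<le> cmod z \<Longrightarrow> f z = 0"
  shows "integrable lborel f"
proof (rule Bochner_Integration.integrable_bound)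
  show "integrable lborel (\<lambda>v :: complex. indicator (cball 0 R) v * B)"
    by (intro integrable_mult_left integrable_real_indicator)
      (use emeasure_bounded_finite[OF bounded_cball, of "0 :: complex" R] in simp_all)
  show "AE v in lborel. norm (f v) \<le> norm (indicator (cball 0 R) v * B)"
  proof (rule AE_I2)
    fix v
    show "norm (f v) \<le> norm (indicator (cball 0 R) v * B)"
    proof (cases "R \<le> norm v")
      case False
      then have "indicator (cball 0 R) v = (1 :: real)" by simp
      then show ?thesis using b[of v] by simp
    qed (simp add: supp)
  qed
qed simp

lemma continuous_support_bounded:
  fixes f :: "complex \<Rightarrow> complex"
  assumes c: "continuous_on UNIV f" and supp: "\<And>z. R \<le> cmod z \<Longrightarrow> f z = 0"
  shows "\<exists>B. \<forall>z. cmod (f z) \<le> B"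
proof -
  have "compact (f ` cball 0 R)"
    by (intro compact_continuous_image compact_cball continuous_on_subset[OF c]) auto
  then have "bounded (f ` cball 0 R)" by (rule compact_imp_bounded)
  then obtain B where "\<forall>y \<in> f ` cball 0 R. cmod y \<le> B" unfolding bounded_iff by blast
  then have B: "cmod (f z) \<le> B" if "z \<in> cball 0 R" for z using that by blast
  have "cmod (f z) \<le> max B 0" for z
    using B[of z] supp[of z] by (cases "cmod z \<le> R") auto
  then show ?thesis by blast
qed

lemma L2_loc_integrable_mult:
  assumes g: "L2_loc g" and c: "continuous_on UNIV f" and supp: "\<And>z. R \<le> cmod z \<Longrightarrow> f z = 0"
  shows "integrable lborel (\<lambda>z. g z * f z)"
proof -
  obtain B where B: "\<And>z. cmod (f z) \<le> B" using continuous_support_bounded[OF c supp] by blast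
  have B0: "0 \<le> B" using B[of 0] norm_ge_zero[of "f 0"] by linarith
  have [measurable]: "g \<in> borel_measurable lborel" using g by (simp add: L2_loc_def)
  have [measurable]: "f \<in> borel_measurable lborel" using borel_measurable_continuous_onI[OF c] by simp
  have i1: "integrable lborel (\<lambda>z :: complex. indicator (cball 0 R) z * B)"
    by (intro integrable_mult_left integrable_real_indicator)
      (use emeasure_bounded_finite[OF bounded_cball, of "0 :: complex" R] in simp_all)
  have "set_integrable lborel (cball 0 R) (\<lambda>z. (cmod (g z))\<^sup>2)"
    using g by (auto simp: L2_loc_def)
  then have "integrable lborel (\<lambda>z. (indicator (cball 0 R) z *\<^sub>R (cmod (g z))\<^sup>2) * B)"
    unfolding set_integrable_def by (rule integrable_mult_left)
  from Bochner_Integration.integrable_add[OF this i1] show ?thesis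
  proof (rule Bochner_Integration.integrable_bound)
    show "AE z in lborel. norm (g z * f z)
        \<le> norm (indicator (cball 0 R) z *\<^sub>R (cmod (g z))\<^sup>2 * B + indicator (cball 0 R) z * B)"
    proof (rule AE_I2)
      fix z
      show "norm (g z * f z) \<le> norm (indicator (cball 0 R) z *\<^sub>R (cmod (g z))\<^sup>2 * B + indicator (cball 0 R) z * B)"
      proof (cases "R \<le> cmod z")
        case False
        have "0 \<le> (cmod (g z) - 1 / 2)\<^sup>2" by simp
        then have "cmod (g z) \<le> (cmod (g z))\<^sup>2 + 1" by (simp add: power2_eq_square algebra_simps)
        then have "cmod (g z) * cmod (f z) \<le> ((cmod (g z))\<^sup>2 + 1) * B"
          using B[of z] B0 by (intro mult_mono) auto
        also have "\<dots> = norm (indicator (cball 0 R) z *\<^sub>R (cmod (g z))\<^sup>2 * B + indicator (cball 0 R) z * B)"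
          using False B0 by (simp add: distrib_right)
        finally show ?thesis by (simp add: norm_mult)
      qed (simp add: supp)
    qed
  qed simp
qed

text \<open>z for s = 1 and its conjugate for s = -1, so that both signs of the angular order are
  treated at once.\<close>

definition zeta :: "real \<Rightarrow> complex \<Rightarrow> complex" where
  "zeta s z = of_real (Re z) + \<i> * of_real (s * Im z)"

lemma bounded_linear_zeta: "bounded_linear (zeta s)"
  unfolding zeta_def
  by (intro bounded_linear_add bounded_linear_const_mult bounded_linear_compose[OF bounded_linear_of_real]
      bounded_linear_Re bounded_linear_Im)

lemma radial_has_derivative:
  fixes f :: "real \<Rightarrow> complex"
  assumes "\<And>\<rho>. (f has_vector_derivative f' \<rho>) (at \<rho>)"
  shows "((\<lambda>z. f ((cmod z)\<^sup>2)) has_derivative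
    (\<lambda>h. of_real (2 * (Re z * Re h + Im z * Im h)) * f' ((cmod z)\<^sup>2))) (at z)"
proof -
  have "((\<lambda>z. (Re z)\<^sup>2 + (Im z)\<^sup>2) has_derivative (\<lambda>h. 2 * (Re z * Re h + Im z * Im h))) (at z)"
    by (auto intro!: derivative_eq_intros bounded_linear_imp_has_derivative bounded_linear_Re bounded_linear_Im
        simp: algebra_simps)
  then have "((\<lambda>z. (cmod z)\<^sup>2) has_derivative (\<lambda>h. 2 * (Re z * Re h + Im z * Im h))) (at z)"
    by (simp only: cmod_power2)
  from diff_chain_at[OF this, of f "\<lambda>x. x *\<^sub>R f' ((cmod z)\<^sup>2)"] show ?thesis
    using assms[of "(cmod z)\<^sup>2"] by (simp add: has_vector_derivative_def o_def scaleR_conv_of_real)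
qed

lemma zeta_power_has_derivative:
  "((\<lambda>z. zeta s z ^ k) has_derivative (\<lambda>h. of_nat k * zeta s z ^ (k - 1) * zeta s h)) (at z)"
  by (rule has_derivative_eq_rhs[OF has_derivative_power[OF bounded_linear_imp_has_derivative[OF bounded_linear_zeta]]])
    (simp add: mult_ac)

lemma vanishing_derivative:
  fixes f :: "real \<Rightarrow> complex"
  assumes d: "\<And>\<rho>. (f has_vector_derivative f' \<rho>) (at \<rho>)" and c: "continuous_on UNIV f'"
    and z: "\<And>\<rho>. a \<le> \<rho> \<Longrightarrow> f \<rho> = 0" and r: "a \<le> \<rho>"
  shows "f' \<rho> = 0"
proof -
  have z': "f' t = 0" if "t > a" for t
  proof -
    have "((\<lambda>_. 0) has_vector_derivative 0) (at t)" by simp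
    then have "(f has_vector_derivative 0) (at t)"
      by (rule has_vector_derivative_transform_within_open[where S = "{a<..}"]) (use that z in auto)
    then show ?thesis using d vector_derivative_unique_at by blast
  qed
  show ?thesis
  proof (cases "\<rho> = a")
    case True
    have "isCont f' a" using c by (simp add: continuous_on_eq_continuous_at)
    then have "(f' \<longlongrightarrow> f' a) (at_right a)" unfolding isCont_def by (rule tendsto_within_subset) simp
    moreover have "(f' \<longlongrightarrow> 0) (at_right a)"
      by (rule tendsto_eventually, rule eventually_mono[OF eventually_at_right_less]) (rule z')
    ultimately show ?thesis using True tendsto_unique[OF trivial_limit_at_right_real] by blast
  qed (use z' r in auto)
qed

text \<open>Two integrations by parts for phi = eta(|z|^2) zeta^n: the weak equation is tested with
  phi, then the weak derivatives of u with the partial derivatives of phi, which are again test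
  functions. The factor on the left is the Laplacian of phi; it has this form because zeta^n is
  harmonic when s * s = 1.\<close>

lemma weak_laplacian:
  fixes \<eta> \<eta>1 \<eta>2 :: "real \<Rightarrow> complex"
  assumes sol: "H1_loc_solution c u" and s: "s * s = 1"
    and d0: "\<And>\<rho>. (\<eta> has_vector_derivative \<eta>1 \<rho>) (at \<rho>)" and d1: "\<And>\<rho>. (\<eta>1 has_vector_derivative \<eta>2 \<rho>) (at \<rho>)"
    and c2: "continuous_on UNIV \<eta>2" and supp: "\<And>\<rho>. R\<^sup>2 \<le> \<rho> \<Longrightarrow> \<eta> \<rho> = 0" and R: "R > 0"
  shows "(LINT z|lborel. u z * (4 * (of_real ((cmod z)\<^sup>2) * \<eta>2 ((cmod z)\<^sup>2) + of_nat (n + 1) * \<eta>1 ((cmod z)\<^sup>2)) * zeta s z ^ n))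
    = - (LINT z|lborel. of_real (c z) * u z * (\<eta> ((cmod z)\<^sup>2) * zeta s z ^ n))"
proof -
  have ceta: "continuous_on UNIV \<eta>" "continuous_on UNIV \<eta>1"
    by (intro continuous_at_imp_continuous_on ballI has_vector_derivative_continuous[OF d0]
        has_vector_derivative_continuous[OF d1])+
  have supp1: "\<And>\<rho>. R\<^sup>2 \<le> \<rho> \<Longrightarrow> \<eta>1 \<rho> = 0" using vanishing_derivative[OF d0 ceta(2) supp] by blast
  have supp2: "\<And>\<rho>. R\<^sup>2 \<le> \<rho> \<Longrightarrow> \<eta>2 \<rho> = 0" using vanishing_derivative[OF d1 c2 supp1] by blast
  define E0 E1 E2 where "E0 z = \<eta> ((cmod z)\<^sup>2)" and "E1 z = \<eta>1 ((cmod z)\<^sup>2)" and "E2 z = \<eta>2 ((cmod z)\<^sup>2)" for z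
  define N where "N z h = complex_of_real (2 * (Re z * Re h + Im z * Im h))" for z h
  have dE0: "(E0 has_derivative (\<lambda>h. N z h * E1 z)) (at z)" for z
    unfolding E0_def[abs_def] E1_def N_def by (rule radial_has_derivative[OF d0])
  have dE1: "(E1 has_derivative (\<lambda>h. N z h * E2 z)) (at z)" for z
    unfolding E1_def[abs_def] E2_def N_def by (rule radial_has_derivative[OF d1])
  note cz = linear_continuous_on[OF bounded_linear_zeta]
  have cE: "continuous_on UNIV E0" "continuous_on UNIV E1" "continuous_on UNIV E2"
    unfolding E0_def E1_def E2_def
    by (intro continuous_on_compose2[OF ceta(1)] continuous_on_compose2[OF ceta(2)]
        continuous_on_compose2[OF c2] continuous_intros; simp)+
  have sE: "E0 z = 0" "E1 z = 0" "E2 z = 0" if "R \<le> cmod z" for z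
  proof -
    have "R\<^sup>2 \<le> (cmod z)\<^sup>2" using that R by (intro power_mono) auto
    then show "E0 z = 0" "E1 z = 0" "E2 z = 0" using supp supp1 supp2 by (auto simp: E0_def E1_def E2_def)
  qed
  let ?Z = "zeta s"
  define phi where "phi z = E0 z * ?Z z ^ n" for z
  define Dphi where "Dphi z h = E0 z * (of_nat n * ?Z z ^ (n - 1) * ?Z h) + N z h * E1 z * ?Z z ^ n" for z h
  have dphi: "(phi has_derivative Dphi z) (at z)" for z
    unfolding phi_def[abs_def] Dphi_def[abs_def]
    by (rule has_derivative_mult[OF dE0 zeta_power_has_derivative])
  have cphi: "continuous_on UNIV (\<lambda>z. Dphi z v)" for v
    unfolding Dphi_def N_def by (intro continuous_intros cE cz)
  note tphi = test_functionI[where \<phi> = phi and D = Dphi and R = R, OF dphi cphi cphi]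
  have sphi: "R \<le> cmod z \<Longrightarrow> phi z = 0" for z by (simp add: phi_def sE)
  \<comment> \<open>Common shape of both partial derivatives of \<open>phi\<close>: l is the
    coordinate \<open>Re\<close> or \<open>Im\<close>, and k is n times \<open>zeta\<close> of the
    direction.\<close>
  define P where "P l k z = of_real (2 * l z) * (E1 z * ?Z z ^ n) + k * (E0 z * ?Z z ^ (n - 1))" for l k z
  define DP where "DP l k z h = of_real (2 * l z) * (E1 z * (of_nat n * ?Z z ^ (n - 1) * ?Z h) + N z h * E2 z * ?Z z ^ n)
      + of_real (2 * l h) * (E1 z * ?Z z ^ n)
      + k * (E0 z * (of_nat (n - 1) * ?Z z ^ (n - 1 - 1) * ?Z h) + N z h * E1 z * ?Z z ^ (n - 1))" for l k z h
  have dP: "(P l k has_derivative DP l k z) (at z)" if l: "bounded_linear l" for l k z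
  proof -
    have "((\<lambda>z. complex_of_real (2 * l z)) has_derivative (\<lambda>h. of_real (2 * l h))) (at z)"
      by (intro bounded_linear_imp_has_derivative bounded_linear_compose[OF bounded_linear_of_real] bounded_linear_const_mult l)
    then show ?thesis
      unfolding P_def[abs_def] DP_def[abs_def]
      by (intro has_derivative_add has_derivative_mult dE1 dE0 zeta_power_has_derivative has_derivative_mult_right)
  qed
  have cP: "continuous_on UNIV (\<lambda>z. DP l k z v)" if "bounded_linear l" for l k v
    unfolding DP_def N_def by (intro continuous_intros cE cz linear_continuous_on that)
  have cP0: "continuous_on UNIV (P l k)" if "bounded_linear l" for l k
    unfolding P_def[abs_def] by (intro continuous_intros cE cz linear_continuous_on that)
  have sP: "R \<le> cmod z \<Longrightarrow> P l k z = 0" for l k z by (simp add: P_def sE)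
  have sDP: "R \<le> cmod z \<Longrightarrow> DP l k z v = 0" for l k z v by (simp add: DP_def sE)
  note tP = test_functionI[where R = R, OF dP cP cP]
  define k1 k2 where "k1 = (of_nat n :: complex)" and "k2 = of_nat n * (\<i> * of_real s)"
  have Z1: "?Z 1 = 1" "?Z \<i> = \<i> * of_real s" by (simp_all add: zeta_def)
  have px: "dir_deriv 1 phi = P Re k1" "dir_deriv \<i> phi = P Im k2"
  proof -
    have d: "dir_deriv v phi z = Dphi z v" for v z by (rule tphi(2)) (rule sphi)
    show "dir_deriv 1 phi = P Re k1" "dir_deriv \<i> phi = P Im k2"
      by (rule ext, simp add: d Dphi_def P_def N_def Z1 k1_def k2_def mult_ac)+
  qed
  obtain g1 g2 where g: "L2_loc g1" "L2_loc g2" and w: "weak_deriv 1 u g1" "weak_deriv \<i> u g2"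
    and eq: "\<And>\<phi>. test_function \<phi> \<Longrightarrow> (LINT z|lborel. g1 z * dir_deriv 1 \<phi> z + g2 z * dir_deriv \<i> \<phi> z)
           = (LINT z|lborel. of_real (c z) * u z * \<phi> z)"
    and cu: "continuous_on UNIV u"
    using sol unfolding H1_loc_solution_def by blast
  have "(LINT z|lborel. g1 z * P Re k1 z + g2 z * P Im k2 z) = (LINT z|lborel. of_real (c z) * u z * phi z)"
    using eq[OF tphi(1)[OF sphi]] unfolding px .
  then have 1: "(LINT z|lborel. of_real (c z) * u z * phi z)
      = (LINT z|lborel. g1 z * P Re k1 z) + (LINT z|lborel. g2 z * P Im k2 z)"
    using L2_loc_integrable_mult[OF g(1) cP0[OF bounded_linear_Re, of k1] sP]
      L2_loc_integrable_mult[OF g(2) cP0[OF bounded_linear_Im, of k2] sP] by simp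
  have tRe: "test_function (P Re k1)" "dir_deriv 1 (P Re k1) z = DP Re k1 z 1" for z
    by (rule tP[OF bounded_linear_Re bounded_linear_Re bounded_linear_Re sP]; assumption)+
  have tIm: "test_function (P Im k2)" "dir_deriv \<i> (P Im k2) z = DP Im k2 z \<i>" for z
    by (rule tP[OF bounded_linear_Im bounded_linear_Im bounded_linear_Im sP]; assumption)+
  have 2: "(LINT z|lborel. u z * DP Re k1 z 1) = - (LINT z|lborel. g1 z * P Re k1 z)"
    using w(1) tRe unfolding weak_deriv_def by (metis (no_types, lifting) Bochner_Integration.integral_cong)
  have 3: "(LINT z|lborel. u z * DP Im k2 z \<i>) = - (LINT z|lborel. g2 z * P Im k2 z)"
    using w(2) tIm unfolding weak_deriv_def by (metis (no_types, lifting) Bochner_Integration.integral_cong)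
  have int: "integrable lborel (\<lambda>z. u z * DP l k z v)" if l: "bounded_linear l" for l k v
  proof -
    have c: "continuous_on UNIV (\<lambda>z. u z * DP l k z v)" by (intro continuous_intros cu cP l)
    have sp: "u z * DP l k z v = 0" if "R \<le> cmod z" for z using sDP[OF that] by simp
    obtain B where "\<And>z. cmod (u z * DP l k z v) \<le> B" using continuous_support_bounded[OF c sp] by blast
    then show ?thesis by (rule integrable_bounded_support[OF borel_measurable_continuous_onI[OF c] _ sp])
  qed
  have lap: "DP Re k1 z 1 + DP Im k2 z \<i>
      = 4 * (of_real ((cmod z)\<^sup>2) * E2 z + of_nat (n + 1) * E1 z) * ?Z z ^ n" for z
  proof -
    have zn: "of_nat n * (?Z z ^ (n - 1) * ?Z z) = of_nat n * ?Z z ^ n" by (cases n) (auto simp: mult.commute)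
    define x y S w w2 where "x = complex_of_real (Re z)" and "y = complex_of_real (Im z)"
      and "S = complex_of_real s" and "w = ?Z z ^ (n - 1)" and "w2 = ?Z z ^ (n - 1 - 1)"
    have S: "S * S = 1" using s by (simp add: S_def flip: of_real_mult)
    have Zz: "?Z z = x + \<i> * (S * y)" by (simp add: zeta_def x_def y_def S_def)
    have N1: "N z 1 = 2 * x" "N z \<i> = 2 * y" by (simp_all add: N_def x_def y_def)
    have cm: "complex_of_real ((cmod z)\<^sup>2) = x * x + y * y"
      unfolding cmod_power2 by (simp add: x_def y_def power2_eq_square)
    have l1: "complex_of_real (2 * Re z) = 2 * x" "complex_of_real (2 * Im z) = 2 * y"
      "complex_of_real (2 * Re 1) = 2" "complex_of_real (2 * Im \<i>) = 2" by (simp_all add: x_def y_def)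
    \<comment> \<open>The term with the second derivative of zeta^n carries the factor 1 - S * S =
      0: this is where harmonicity enters.\<close>
    have "DP Re k1 z 1 + DP Im k2 z \<i>
      = 4 * E1 z * ?Z z ^ n + 4 * (x * x + y * y) * E2 z * ?Z z ^ n
        + 4 * E1 z * (of_nat n * (w * (x + \<i> * (S * y))))
        + of_nat n * (E0 z * (of_nat (n - 1) * w2)) * (1 - S * S)"
      unfolding DP_def Z1 N1 l1 k1_def k2_def S_def[symmetric] w_def[symmetric] w2_def[symmetric]
      by (simp add: algebra_simps)
    also have "of_nat n * (w * (x + \<i> * (S * y))) = of_nat n * ?Z z ^ n"
      using zn unfolding w_def Zz .
    finally show ?thesis unfolding cm S by (simp add: algebra_simps)
  qed
  have "(LINT z|lborel. u z * (4 * (of_real ((cmod z)\<^sup>2) * E2 z + of_nat (n + 1) * E1 z) * ?Z z ^ n))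
    = (LINT z|lborel. u z * DP Re k1 z 1 + u z * DP Im k2 z \<i>)"
    unfolding lap[symmetric] by (simp only: distrib_left)
  also have "\<dots> = (LINT z|lborel. u z * DP Re k1 z 1) + (LINT z|lborel. u z * DP Im k2 z \<i>)"
    by (intro Bochner_Integration.integral_add int bounded_linear_Re bounded_linear_Im)
  also have "\<dots> = - (LINT z|lborel. of_real (c z) * u z * phi z)" unfolding 1 2 3 by simp
  finally show ?thesis unfolding phi_def E0_def E1_def E2_def .
qed

lemma continuous_rcis: "continuous_on S (\<lambda>p. rcis (f p) (g p))" if "continuous_on S f" "continuous_on S g"
  unfolding rcis_def cis_conv_exp using that by (intro continuous_intros)

lemma continuous_fourier_coeff:
  assumes u: "continuous_on UNIV u"
  shows "continuous_on S (\<lambda>r. fourier_coeff u r m)"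
proof -
  have "continuous_on (S \<times> cbox 0 (2 * pi)) (\<lambda>(r, \<theta>). u (rcis r \<theta>) * cis (- (of_int m * \<theta>)))"
    unfolding case_prod_beta' cis_conv_exp
    by (intro continuous_intros continuous_on_compose2[OF u] continuous_rcis) auto
  from integral_continuous_on_param[OF this] show ?thesis
    unfolding fourier_coeff_def by (intro continuous_intros) simp
qed

lemma integral_open_circle:
  fixes f :: "real \<Rightarrow> complex"
  assumes "continuous_on {a..b} f"
  shows "(LINT \<theta>|lborel. indicator {a<..<b} \<theta> *\<^sub>R f \<theta>) = integral {a..b} f"
proof -
  have "set_integrable lborel {a..b} f" using borel_integrable_compact[OF compact_Icc assms] by (simp add: set_integrable_def)
  then have "set_integrable lborel {a<..<b} f" by (rule set_integrable_subset) auto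
  from set_borel_integral_eq_integral(2)[OF this] show ?thesis
    by (simp add: set_lebesgue_integral_def integral_open_interval_real)
qed

text \<open>Projection on the mode m requires exp (- i m theta): a power of the conjugate of z for m
  >= 0, of z for m < 0.\<close>

definition mode_sign :: "int \<Rightarrow> real" where
  "mode_sign m = (if m \<ge> 0 then - 1 else 1)"

lemma zeta_rcis: "zeta (mode_sign m) (rcis r \<theta>) ^ nat \<bar>m\<bar> = of_real (r ^ nat \<bar>m\<bar>) * cis (- (of_int m * \<theta>))"
proof -
  have "zeta (mode_sign m) (rcis r \<theta>) = of_real r * cis (mode_sign m * \<theta>)"
    by (simp add: zeta_def mode_sign_def complex_eq_iff)
  moreover have "cis (mode_sign m * \<theta>) ^ nat \<bar>m\<bar> = cis (- (of_int m * \<theta>))"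
    unfolding Complex.DeMoivre by (simp add: mode_sign_def)
  ultimately show ?thesis by (simp add: power_mult_distrib)
qed

text \<open>On the circle of radius r the test function contributes r^n exp (- i m theta), so the
  angular integral is a multiple of the m-th coefficient of u; the Jacobian raises r^n to r^(n +
  1).\<close>

lemma radial_weak_fourier_coeff:
  assumes sol: "H1_loc_solution (\<lambda>z. step_coeff e k1 k2 (cmod z)) u"
  shows "radial_weak (nat \<bar>m\<bar>) (step_coeff e k1 k2) (\<lambda>r. fourier_coeff u r m)"
  unfolding radial_weak_def
proof (intro allI impI)
  fix R :: real and \<eta> \<eta>1 \<eta>2 :: "real \<Rightarrow> complex"
  assume R: "R > 0"
    and d: "\<forall>\<rho>. (\<eta> has_vector_derivative \<eta>1 \<rho>) (at \<rho>) \<and> (\<eta>1 has_vector_derivative \<eta>2 \<rho>) (at \<rho>)"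
    and c2: "continuous_on UNIV \<eta>2" and supp: "\<forall>\<rho>\<ge>R\<^sup>2. \<eta> \<rho> = 0"
  define n where "n = nat \<bar>m\<bar>"
  define s where "s = mode_sign m"
  have s: "s * s = 1" by (simp add: s_def mode_sign_def)
  let ?k = "step_coeff e k1 k2"
  have d0: "(\<eta> has_vector_derivative \<eta>1 \<rho>) (at \<rho>)" and d1: "(\<eta>1 has_vector_derivative \<eta>2 \<rho>) (at \<rho>)" for \<rho>
    using d by auto
  have ceta: "continuous_on UNIV \<eta>" "continuous_on UNIV \<eta>1"
    by (intro continuous_at_imp_continuous_on ballI has_vector_derivative_continuous[OF d0]
        has_vector_derivative_continuous[OF d1])+
  have s0: "\<And>\<rho>. R\<^sup>2 \<le> \<rho> \<Longrightarrow> \<eta> \<rho> = 0" using supp by blast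
  have s1: "\<And>\<rho>. R\<^sup>2 \<le> \<rho> \<Longrightarrow> \<eta>1 \<rho> = 0" using vanishing_derivative[OF d0 ceta(2) s0] by blast
  have s2: "\<And>\<rho>. R\<^sup>2 \<le> \<rho> \<Longrightarrow> \<eta>2 \<rho> = 0" using vanishing_derivative[OF d1 c2 s1] by blast
  have cu: "continuous_on UNIV u" using sol by (simp add: H1_loc_solution_def)
  define L where "L \<rho> = 4 * (of_real \<rho> * \<eta>2 \<rho> + of_nat (n + 1) * \<eta>1 \<rho>)" for \<rho>
  have cL: "continuous_on UNIV L" unfolding L_def by (intro continuous_intros c2 ceta)
  define F1 F2 where "F1 z = u z * (L ((cmod z)\<^sup>2) * zeta s z ^ n)"
    and "F2 z = u z * (\<eta> ((cmod z)\<^sup>2) * zeta s z ^ n)" for z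
  have cF: "continuous_on UNIV F1" "continuous_on UNIV F2"
    unfolding F1_def F2_def
    by (intro continuous_intros cu continuous_on_compose2[OF cL] continuous_on_compose2[OF ceta(1)]
        linear_continuous_on bounded_linear_zeta; simp)+
  have sF: "F1 z = 0" "F2 z = 0" if "R \<le> cmod z" for z
  proof -
    have "R\<^sup>2 \<le> (cmod z)\<^sup>2" using that R by (intro power_mono) auto
    then show "F1 z = 0" "F2 z = 0" using s0 s1 s2 by (auto simp: F1_def F2_def L_def)
  qed
  obtain B1 B2 where B: "\<And>z. cmod (F1 z) \<le> B1" "\<And>z. cmod (F2 z) \<le> B2"
    using continuous_support_bounded[OF cF(1) sF(1)] continuous_support_bounded[OF cF(2) sF(2)] by blast
  have [measurable]: "F1 \<in> borel_measurable borel" "F2 \<in> borel_measurable borel"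
    using cF by (auto intro: borel_measurable_continuous_onI)
  have km [measurable]: "?k \<in> borel_measurable borel" unfolding step_coeff_def[abs_def] by measurable
  have kb: "\<bar>?k r\<bar> \<le> max \<bar>k1\<bar> \<bar>k2\<bar>" for r by (simp add: step_coeff_def)
  define K where "K = max \<bar>k1\<bar> \<bar>k2\<bar>"
  have b2: "cmod (of_real (?k (cmod z)) * F2 z) \<le> K * B2" for z
    unfolding norm_mult norm_of_real using kb B by (intro mult_mono) (auto simp: K_def intro: order_trans[OF abs_ge_zero kb])
  define F where "F z = F1 z + of_real (?k (cmod z)) * F2 z" for z
  have [measurable]: "F \<in> borel_measurable borel" unfolding F_def by measurable
  have bF: "cmod (F z) \<le> B1 + K * B2" for z
    unfolding F_def by (rule norm_triangle_le) (intro add_mono B b2)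
  have sF': "F z = 0" if "R \<le> cmod z" for z using sF[OF that] by (simp add: F_def)
  have i1: "integrable lborel F1" by (rule integrable_bounded_support[OF _ B(1) sF(1)]) auto
  have i2: "integrable lborel (\<lambda>z. of_real (?k (cmod z)) * F2 z)"
    by (rule integrable_bounded_support[where R = R, OF _ b2]) (auto simp: sF)
  have "(LINT z|lborel. F1 z) = - (LINT z|lborel. of_real (?k (cmod z)) * F2 z)"
    using weak_laplacian[OF sol s d0 d1 c2 s0 R, of n] by (simp add: F1_def F2_def L_def mult.assoc)
  then have F0: "(LINT z|lborel. F z) = 0"
    unfolding F_def using i1 i2 by simp
  define A where "A r = L (r\<^sup>2) + of_real (?k r) * \<eta> (r\<^sup>2)" for r
  have inner: "(LINT \<theta>|lborel. indicator {0<..<2 * pi} \<theta> *\<^sub>R F (rcis r \<theta>))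
      = A r * of_real (r ^ n) * (2 * of_real pi * fourier_coeff u r m)" if r: "0 < r" for r
  proof -
    have "F (rcis r \<theta>) = A r * of_real (r ^ n) * (u (rcis r \<theta>) * cis (- (of_int m * \<theta>)))" for \<theta>
      using r unfolding F_def F1_def F2_def s_def n_def zeta_rcis A_def by (simp add: algebra_simps)
    then have "(LINT \<theta>|lborel. indicator {0<..<2 * pi} \<theta> *\<^sub>R F (rcis r \<theta>))
      = (LINT \<theta>|lborel. A r * of_real (r ^ n) * (indicator {0<..<2 * pi} \<theta> *\<^sub>R (u (rcis r \<theta>) * cis (- (of_int m * \<theta>)))))"
      by (simp add: mult_scaleR_right)
    also have "\<dots> = A r * of_real (r ^ n) * (LINT \<theta>|lborel. indicator {0<..<2 * pi} \<theta> *\<^sub>R (u (rcis r \<theta>) * cis (- (of_int m * \<theta>))))"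
      by (rule integral_mult_right_zero)
    also have "(LINT \<theta>|lborel. indicator {0<..<2 * pi} \<theta> *\<^sub>R (u (rcis r \<theta>) * cis (- (of_int m * \<theta>))))
        = integral {0..2 * pi} (\<lambda>\<theta>. u (rcis r \<theta>) * cis (- (of_int m * \<theta>)))"
      unfolding cis_conv_exp
      by (intro integral_open_circle continuous_intros continuous_on_compose2[OF cu] continuous_rcis) auto
    also have "\<dots> = 2 * of_real pi * fourier_coeff u r m" by (simp add: fourier_coeff_def)
    finally show ?thesis .
  qed
  define T where "T r = of_real (r ^ Suc n) * A r * fourier_coeff u r m" for r
  have eq: "indicator {0<..<R} r *\<^sub>R (r *\<^sub>R (LINT \<theta>|lborel. indicator {0<..<2 * pi} \<theta> *\<^sub>R F (rcis r \<theta>)))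
      = 2 * of_real pi * (indicator {0<..<R} r *\<^sub>R T r)" for r
  proof (cases "0 < r")
    case True
    show ?thesis unfolding inner[OF True] by (simp add: T_def scaleR_conv_of_real mult_ac)
  qed simp
  have "0 = (LINT r|lborel. 2 * of_real pi * (indicator {0<..<R} r *\<^sub>R T r))"
    using polar_integral[of F, OF _ bF sF' R] unfolding F0 eq by simp
  also have "\<dots> = 2 * of_real pi * (LINT r|lborel. indicator {0<..<R} r *\<^sub>R T r)"
    by (rule integral_mult_right_zero)
  finally have T0: "(LINT r:{0<..<R}|lborel. T r) = 0" by (simp add: set_lebesgue_integral_def)
  define T1 T2 where "T1 r = of_real (r ^ Suc n) * L (r\<^sup>2) * fourier_coeff u r m"
    and "T2 r = of_real (r ^ Suc n) * \<eta> (r\<^sup>2) * fourier_coeff u r m" for r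
  have cT: "continuous_on UNIV T1" "continuous_on UNIV T2"
    unfolding T1_def T2_def
    by (intro continuous_intros continuous_on_compose2[OF cL] continuous_on_compose2[OF ceta(1)]
        continuous_fourier_coeff cu; simp)+
  have Teq: "T r = T1 r + of_real (?k r) * T2 r" for r by (simp add: T_def T1_def T2_def A_def algebra_simps)
  have cT': "continuous_on {0..R} T1" "continuous_on {0..R} T2" using cT continuous_on_subset by blast+
  have si: "set_integrable lborel {0..R} T1" "set_integrable lborel {0..R} T2"
    using borel_integrable_compact[OF compact_Icc cT'(1)] borel_integrable_compact[OF compact_Icc cT'(2)]
    by (auto simp: set_integrable_def)
  have "set_integrable lborel {0..R} (\<lambda>r. of_real (?k r) * T2 r)"
  proof (rule set_integrable_bound[where f = "\<lambda>r. K *\<^sub>R T2 r"])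
    show "set_integrable lborel {0..R} (\<lambda>r. K *\<^sub>R T2 r)" using si(2) by (rule set_integrable_scaleR_right)
    have [measurable]: "T2 \<in> borel_measurable borel" using cT by (auto intro: borel_measurable_continuous_onI)
    show "set_borel_measurable lborel {0..R} (\<lambda>r. of_real (?k r) * T2 r)"
      unfolding set_borel_measurable_def by measurable
    show "AE r in lborel. r \<in> {0..R} \<longrightarrow> norm (of_real (?k r) * T2 r) \<le> norm (K *\<^sub>R T2 r)"
      using kb by (intro AE_I2 impI) (auto simp: norm_mult K_def intro!: mult_right_mono order_trans[OF kb])
  qed
  then have siT: "set_integrable lborel {0..R} T" unfolding Teq by (rule set_integral_add(1)[OF si(1)])
  then have siT': "set_integrable lborel {0<..<R} T" by (rule set_integrable_subset) auto
  have "integral {0<..<R} T = 0" using set_borel_integral_eq_integral(2)[OF siT'] T0 by simp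
  then have "integral {0..R} T = 0" by (simp add: integral_open_interval_real)
  then have "(T has_integral 0) {0..R}"
    using set_borel_integral_eq_integral(1)[OF siT] by (metis has_integral_integral)
  then show "((\<lambda>r. of_real (r ^ Suc (nat \<bar>m\<bar>)) * (4 * (of_real (r\<^sup>2) * \<eta>2 (r\<^sup>2) + of_nat (nat \<bar>m\<bar> + 1) * \<eta>1 (r\<^sup>2))
        + of_real (?k r) * \<eta> (r\<^sup>2)) * fourier_coeff u r m) has_integral 0) {0..R}"
    unfolding T_def A_def L_def n_def .
qed

subsection \<open>Transmission and radiation conditions for the modes\<close>

lemma constant_on_interval:
  fixes F :: "real \<Rightarrow> complex"
  assumes "a \<le> b" "continuous_on {a..b} F" "\<And>r. a < r \<Longrightarrow> r < b \<Longrightarrow> (F has_vector_derivative 0) (at r)"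
  shows "F b = F a"
proof -
  have "((\<lambda>_. 0) has_integral F b - F a) {a..b}"
    by (rule fundamental_theorem_of_calculus_interior_strong[where S = "{}"]) (use assms in auto)
  then have "F b - F a = 0" using has_integral_0_eq by blast
  then show ?thesis by simp
qed

lemma wronskian_deriv:
  fixes f g ef eg :: "real \<Rightarrow> complex"
  assumes "(f has_vector_derivative ef r / of_real r) (at r)" "(ef has_vector_derivative Q * f r) (at r)"
    "(g has_vector_derivative eg r / of_real r) (at r)" "(eg has_vector_derivative Q * g r) (at r)"
  shows "((\<lambda>r. f r * eg r - g r * ef r) has_vector_derivative 0) (at r)"
proof -
  have "((\<lambda>r. f r * eg r - g r * ef r) has_vector_derivative
     (f r * (Q * g r) + ef r / of_real r * eg r) - (g r * (Q * f r) + eg r / of_real r * ef r)) (at r)"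
    by (intro has_vector_derivative_diff has_vector_derivative_mult assms)
  then show ?thesis by (simp add: algebra_simps)
qed

lemma scaled_deriv:
  assumes "(f has_vector_derivative f') (at (k * r))"
  shows "((\<lambda>r. f (k * r)) has_vector_derivative of_real k * (f' :: complex)) (at r)"
proof -
  have "((*) k has_vector_derivative k) (at r)"
    using DERIV_cmult_Id[of k r] by (simp add: has_real_derivative_iff_has_vector_derivative)
  from vector_diff_chain_at[OF this assms] show ?thesis by (simp only: o_def scaleR_conv_of_real)
qed

lemma ladder_euler_deriv:
  assumes Z: "ladder Z" and k: "k > 0" and r: "r > 0"
  shows "((\<lambda>r. Z n (k * r)) has_vector_derivative euler Z n (k * r) / of_real r) (at r)"
    and "((\<lambda>r. euler Z n (k * r)) has_vector_derivative of_real ((real n)\<^sup>2 / r - k\<^sup>2 * r) * Z n (k * r)) (at r)"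
proof -
  define s where "s = k * r"
  have s: "s > 0" using k r by (simp add: s_def)
  have z: "(Z n has_vector_derivative of_real (real n / s) * Z n s - Z (Suc n) s) (at s)"
    "(Z (Suc n) has_vector_derivative Z n s - of_real (real (n + 1) / s) * Z (Suc n) s) (at s)"
    using Z s unfolding ladder_def by blast+
  have id: "((\<lambda>s. complex_of_real s) has_vector_derivative 1) (at s)"
    using has_vector_derivative_of_real[OF DERIV_ident] by simp
  have "of_real k * (of_real (real n / s) * Z n s - Z (Suc n) s) = euler Z n s / of_real r"
    using k r by (simp add: euler_def s_def field_simps)
  then show "((\<lambda>r. Z n (k * r)) has_vector_derivative euler Z n (k * r) / of_real r) (at r)"
    using scaled_deriv[OF z(1)[unfolded s_def]] by (simp only: s_def)
  have "(euler Z n has_vector_derivative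
      of_nat n * (of_real (real n / s) * Z n s - Z (Suc n) s)
      - (of_real s * (Z n s - of_real (real (n + 1) / s) * Z (Suc n) s) + 1 * Z (Suc n) s)) (at s)"
    unfolding euler_def[abs_def] by (intro has_vector_derivative_diff has_vector_derivative_mult has_vector_derivative_mult_right z id)
  from scaled_deriv[OF this[unfolded s_def]]
  have "((\<lambda>r. euler Z n (k * r)) has_vector_derivative
      of_real k * (of_nat n * (of_real (real n / s) * Z n s - Z (Suc n) s)
      - (of_real s * (Z n s - of_real (real (n + 1) / s) * Z (Suc n) s) + 1 * Z (Suc n) s))) (at r)"
    by (simp only: s_def)
  moreover have "of_real k * (of_nat n * (of_real (real n / s) * Z n s - Z (Suc n) s)
      - (of_real s * (Z n s - of_real (real (n + 1) / s) * Z (Suc n) s) + 1 * Z (Suc n) s))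
      = of_real ((real n)\<^sup>2 / r - k\<^sup>2 * r) * Z n s"
    using k r by (simp add: s_def field_simps power2_eq_square)
  ultimately show "((\<lambda>r. euler Z n (k * r)) has_vector_derivative of_real ((real n)\<^sup>2 / r - k\<^sup>2 * r) * Z n (k * r)) (at r)"
    by (simp only: s_def)
qed

lemma euler_ladder_J: "euler (\<lambda>n x. complex_of_real (bessel_J_nat n x)) n x = of_real (euler_J n x)"
  by (simp add: euler_def euler_J_def)

lemma inv_power_deriv:
  assumes "r > 0"
  shows "((\<lambda>r. complex_of_real (1 / r ^ n)) has_vector_derivative of_real (- real n / r ^ Suc n)) (at r)"
proof (rule has_vector_derivative_of_real)
  have "((\<lambda>x. x ^ n) has_real_derivative real n * r ^ (n - 1)) (at r)"
    using DERIV_pow[of n r] by simp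
  then have "((\<lambda>x. 1 / x ^ n) has_real_derivative
      (0 * r ^ n - 1 * (real n * r ^ (n - 1))) / (r ^ n * r ^ n)) (at r)"
    using assms by (intro DERIV_divide DERIV_const) auto
  then show "((\<lambda>x. 1 / x ^ n) has_real_derivative - real n / r ^ Suc n) (at r)"
    by (rule DERIV_cong) (use assms in \<open>cases n; simp add: divide_simps\<close>)
qed

context
  fixes n :: nat and e k l :: real and c :: "real \<Rightarrow> complex"
  assumes c: "continuous_on {0..} c" and e: "e > 0" and k: "k > 0" and l: "l > 0"
    and weak: "radial_weak n (step_coeff e ((l * k)\<^sup>2) (k\<^sup>2)) c"
begin

abbreviation "Gf \<equiv> mode_flux n e ((l * k)\<^sup>2) (k\<^sup>2) c"

text \<open>\<open>r c'(r)\<close>, which unlike \<open>c''\<close> is continuous across the interface.\<close>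

definition euler_mode :: "real \<Rightarrow> complex" where
  "euler_mode r = of_nat n * c r - Gf r * of_real (1 / r ^ n)"

lemma mode_deriv:
  assumes r: "r > 0"
  shows "(c has_vector_derivative euler_mode r / of_real r) (at r)"
proof -
  have p: "((\<lambda>r. complex_of_real (r ^ n)) has_vector_derivative of_real (real n * r ^ (n - 1))) (at r)"
    using DERIV_pow[of n r] by (intro has_vector_derivative_of_real) simp
  have "((\<lambda>r. of_real (r ^ n) * (c r / of_real (r ^ n))) has_vector_derivative
      of_real (r ^ n) * - (Gf r / of_real (r ^ (2 * n + 1))) + of_real (real n * r ^ (n - 1)) * (c r / of_real (r ^ n))) (at r)"
    by (intro has_vector_derivative_mult p radial_weak_deriv[OF c e weak r])
  moreover have "of_real (r ^ n) * - (Gf r / of_real (r ^ (2 * n + 1))) + of_real (real n * r ^ (n - 1)) * (c r / of_real (r ^ n))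
      = euler_mode r / of_real r"
  proof -
    have 1: "complex_of_real (r ^ n) * - (g / of_real (r ^ (2 * n + 1))) = - (g * of_real (1 / r ^ n) / of_real r)" for g
      using r by (simp add: power_add mult_2)
    have "real n * r ^ (n - 1) = real n / r * r ^ n" using r by (cases n) auto
    then have 2: "complex_of_real (real n * r ^ (n - 1)) * (v / of_real (r ^ n)) = of_nat n * v / of_real r" for v
      using r by simp
    show ?thesis unfolding 1 2 euler_mode_def by (simp add: diff_divide_distrib)
  qed
  ultimately have "((\<lambda>r. of_real (r ^ n) * (c r / of_real (r ^ n))) has_vector_derivative euler_mode r / of_real r) (at r)"
    by simp
  then show ?thesis
    by (rule has_vector_derivative_transform_within_open[where S = "{0<..}"]) (use r in auto)
qed

lemma euler_mode_deriv:
  assumes r: "r > 0" "r \<noteq> e"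
  shows "(euler_mode has_vector_derivative of_real ((real n)\<^sup>2 / r - step_coeff e ((l * k)\<^sup>2) (k\<^sup>2) r * r) * c r) (at r)"
proof -
  let ?K = "step_coeff e ((l * k)\<^sup>2) (k\<^sup>2) r"
  have "(euler_mode has_vector_derivative of_nat n * (euler_mode r / of_real r) -
      (Gf r * of_real (- real n / r ^ Suc n) + of_real ?K * (of_real (r ^ Suc n) * c r) * of_real (1 / r ^ n))) (at r)"
    unfolding euler_mode_def[abs_def]
    by (intro has_vector_derivative_diff has_vector_derivative_mult_right has_vector_derivative_mult
        mode_deriv[unfolded euler_mode_def] inv_power_deriv G_deriv c e r)
  moreover have "of_nat n * (euler_mode r / of_real r) -
      (Gf r * of_real (- real n / r ^ Suc n) + of_real ?K * (of_real (r ^ Suc n) * c r) * of_real (1 / r ^ n))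
    = of_real ((real n)\<^sup>2 / r - ?K * r) * c r"
  proof -
    have G: "Gf r * of_real (- real n / r ^ Suc n) = - (of_nat n / of_real r * (Gf r * of_real (1 / r ^ n)))"
      by simp
    have g: "Gf r * of_real (1 / r ^ n) = of_nat n * c r - euler_mode r" by (simp add: euler_mode_def)
    have K: "of_real ?K * (of_real (r ^ Suc n) * c r) * of_real (1 / r ^ n) = of_real (?K * r) * c r"
      using r by simp
    show ?thesis unfolding G g K using r by (simp add: field_simps power2_eq_square)
  qed
  ultimately show ?thesis by simp
qed

lemma cont_euler_mode: "continuous_on {0<..} euler_mode"
  unfolding euler_mode_def[abs_def]
  by (intro continuous_intros continuous_on_subset[OF c] continuous_on_subset[OF cont_G[OF c e]]) auto

text \<open>Inside the disc the mode and J_n(l k r) satisfy the same equation, so their Wronskian is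
  constant there. It vanishes at the origin because the mode is bounded.\<close>

lemma interior_match: "c e * of_real (euler_J n (l * (k * e))) = of_real (bessel_J_nat n (l * (k * e))) * euler_mode e"
proof -
  define q where "q = l * k"
  have q: "q > 0" using k l by (simp add: q_def)
  \<comment> \<open>The Wronskian with the factor r^(-n) of \<open>euler_mode\<close> absorbed into
    J_n; in this form it is continuous at 0, where every term vanishes.\<close>
  define W where "W r = c r * of_real (euler_J n (q * r)) - of_nat n * of_real (bessel_J_nat n (q * r)) * c r
      + of_real ((q / 2) ^ n * clif n ((q * r)\<^sup>2 / 4)) * Gf r" for r
  have WE: "W r = c r * of_real (euler_J n (q * r)) - of_real (bessel_J_nat n (q * r)) * euler_mode r" if "r > 0" for r
  proof -
    have "(q / 2) ^ n * clif n ((q * r)\<^sup>2 / 4) = bessel_J_nat n (q * r) * (1 / r ^ n)"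
      using that by (simp add: bessel_J_nat_clif power_mult_distrib power_divide)
    then show ?thesis unfolding W_def euler_mode_def by (simp only: of_real_mult) (simp add: algebra_simps)
  qed
  have cc: "continuous_on S (clif n)" for S
    by (intro continuous_at_imp_continuous_on ballI DERIV_isCont[OF clif_deriv])
  have cJ: "continuous_on S (bessel_J_nat n)" "continuous_on S (euler_J n)" for S
    by (intro continuous_at_imp_continuous_on ballI isCont_J isCont_euler_J)+
  have "W e = W 0"
  proof (rule constant_on_interval)
    show "continuous_on {0..e} W" unfolding W_def
      by (intro continuous_intros continuous_on_compose2[OF cc[of UNIV]] continuous_on_compose2[OF cJ(1)[of UNIV]]
          continuous_on_compose2[OF cJ(2)[of UNIV]] continuous_on_subset[OF c] continuous_on_subset[OF cont_G[OF c e]]) auto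
    fix r assume r: "0 < r" "r < e"
    have d: "(euler_mode has_vector_derivative of_real ((real n)\<^sup>2 / r - q\<^sup>2 * r) * c r) (at r)"
      using euler_mode_deriv[of r] r by (simp add: step_coeff_def q_def)
    have "((\<lambda>r. c r * of_real (euler_J n (q * r)) - of_real (bessel_J_nat n (q * r)) * euler_mode r) has_vector_derivative 0) (at r)"
      by (rule wronskian_deriv[OF mode_deriv[OF r(1)] d])
        (use ladder_euler_deriv[OF ladder_J q r(1), of n] in \<open>simp_all add: euler_ladder_J\<close>)
    then show "(W has_vector_derivative 0) (at r)"
      by (rule has_vector_derivative_transform_within_open[where S = "{0<..}"]) (use r WE in auto)
  qed (use e in simp)
  also have "W 0 = 0" using G_0[OF c e, of n] by (cases "n = 0") (auto simp: W_def)
  finally show ?thesis using WE[OF e] by (simp add: q_def mult.assoc)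
qed

text \<open>Outside the disc b is a combination of Z and its conjugate whose coefficients are
  Wronskians, normalised by D = - 2 i * flux. The coefficient of the conjugate is the constant W Z,
  and the radiation condition forces it to be 0.\<close>

lemma exterior_form:
  assumes Z: "ladder Z" and out: "outgoing_at Z n" and flux: "flux Z > 0"
    and b: "\<And>r. r \<ge> e \<Longrightarrow> b r = c r - a * of_real (bessel_J_nat n (k * r))"
    and eb: "\<And>r. r \<ge> e \<Longrightarrow> eb r = euler_mode r - a * of_real (euler_J n (k * r))"
    and rad: "\<And>\<delta>. \<delta> > 0 \<Longrightarrow> \<forall>\<^sub>F r in at_top. cmod (eb r / of_real r - \<i> * of_real k * b r) \<le> \<delta> * r powr (- 1/2)"
  shows "\<exists>\<beta>. \<forall>r\<ge>e. b r = \<beta> * Z n (k * r) \<and> eb r = \<beta> * euler Z n (k * r)"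
proof -
  let ?Zc = "\<lambda>n x. cnj (Z n x)"
  have Zc: "ladder ?Zc" by (rule ladder_cnj[OF Z])
  have db: "(b has_vector_derivative eb r / of_real r) (at r)"
    "(eb has_vector_derivative of_real ((real n)\<^sup>2 / r - k\<^sup>2 * r) * b r) (at r)" if r: "r > e" for r
  proof -
    have r0: "r > 0" using r e by simp
    note dJ = ladder_euler_deriv[OF ladder_J k r0, of n, unfolded euler_ladder_J]
    have "((\<lambda>r. c r - a * of_real (bessel_J_nat n (k * r))) has_vector_derivative
        euler_mode r / of_real r - a * (of_real (euler_J n (k * r)) / of_real r)) (at r)"
      by (intro has_vector_derivative_diff has_vector_derivative_mult_right dJ mode_deriv r0)
    then have "(b has_vector_derivative
        euler_mode r / of_real r - a * (of_real (euler_J n (k * r)) / of_real r)) (at r)"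
      by (rule has_vector_derivative_transform_within_open[where S = "{e<..}"]) (use r b in auto)
    then show "(b has_vector_derivative eb r / of_real r) (at r)" using eb[of r] r by (simp add: diff_divide_distrib)
    have "((\<lambda>r. euler_mode r - a * of_real (euler_J n (k * r))) has_vector_derivative
        of_real ((real n)\<^sup>2 / r - k\<^sup>2 * r) * c r - a * (of_real ((real n)\<^sup>2 / r - k\<^sup>2 * r) * of_real (bessel_J_nat n (k * r)))) (at r)"
      using euler_mode_deriv[OF r0] r
      by (intro has_vector_derivative_diff has_vector_derivative_mult_right dJ) (simp add: step_coeff_def)
    then have "(eb has_vector_derivative
        of_real ((real n)\<^sup>2 / r - k\<^sup>2 * r) * c r - a * (of_real ((real n)\<^sup>2 / r - k\<^sup>2 * r) * of_real (bessel_J_nat n (k * r)))) (at r)"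
      by (rule has_vector_derivative_transform_within_open[where S = "{e<..}"]) (use r eb in auto)
    moreover have "x * c r - a * (x * of_real (bessel_J_nat n (k * r))) = x * b r" for x
      unfolding b[OF less_imp_le[OF r]] by (simp add: algebra_simps)
    ultimately show "(eb has_vector_derivative of_real ((real n)\<^sup>2 / r - k\<^sup>2 * r) * b r) (at r)"
      by (simp only:)
  qed
  define W where "W Z r = b r * euler Z n (k * r) - Z n (k * r) * eb r" for Z :: "nat \<Rightarrow> real \<Rightarrow> complex" and r
  have cJ: "continuous_on UNIV (bessel_J_nat n)" "continuous_on UNIV (euler_J n)"
    by (intro continuous_at_imp_continuous_on ballI isCont_J isCont_euler_J)+
  have ck: "continuous_on {e..} (\<lambda>r. k * r)" by (intro continuous_intros)
  have cJk: "continuous_on {e..} (\<lambda>r. bessel_J_nat n (k * r))" "continuous_on {e..} (\<lambda>r. euler_J n (k * r))"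
    by (rule continuous_on_compose2[OF cJ(1) ck] continuous_on_compose2[OF cJ(2) ck]; simp)+
  have "continuous_on {e..} (\<lambda>r. c r - a * of_real (bessel_J_nat n (k * r)))"
    by (intro continuous_on_diff continuous_on_mult_left continuous_on_of_real cJk continuous_on_subset[OF c]) (use e in auto)
  then have cb: "continuous_on {e..} b" by (rule continuous_on_eq) (simp add: b)
  have "continuous_on {e..} (\<lambda>r. euler_mode r - a * of_real (euler_J n (k * r)))"
    by (intro continuous_on_diff continuous_on_mult_left continuous_on_of_real cJk continuous_on_subset[OF cont_euler_mode]) (use e in auto)
  then have ceb: "continuous_on {e..} eb" by (rule continuous_on_eq) (simp add: eb)
  have W: "W Z r = W Z e" if Z: "ladder Z" and r: "r \<ge> e" for Z r
  proof (rule constant_on_interval[OF r])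
    have "continuous_on {e..r} (\<lambda>r. Z n (k * r))" "continuous_on {e..r} (\<lambda>r. euler Z n (k * r))"
      by (intro continuous_at_imp_continuous_on ballI has_vector_derivative_continuous[OF ladder_euler_deriv(1)[OF Z k]]
          has_vector_derivative_continuous[OF ladder_euler_deriv(2)[OF Z k]]; use e in simp)+
    then show "continuous_on {e..r} (W Z)" unfolding W_def
      by (intro continuous_intros continuous_on_subset[OF cb] continuous_on_subset[OF ceb]) auto
    fix s assume s: "e < s" "s < r"
    then have s0: "s > 0" using e by simp
    show "(W Z has_vector_derivative 0) (at s)"
      unfolding W_def[abs_def]
      by (rule wronskian_deriv[OF db[OF s(1)] ladder_euler_deriv[OF Z k s0]])
  qed
  define D where "D = - (2 * \<i> * of_real (flux Z))"
  have D: "D \<noteq> 0" using flux by (simp add: D_def)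
  have DW: "Z n (k * r) * euler ?Zc n (k * r) - cnj (Z n (k * r)) * euler Z n (k * r) = D" if r: "r \<ge> e" for r
  proof -
    have "Im (cnj (Z n (k * r)) * euler Z n (k * r)) = flux Z"
      by (rule euler_flux(1)[OF Z]) (use r e k in auto)
    moreover have "euler ?Zc n (k * r) = cnj (euler Z n (k * r))" by (simp add: euler_def)
    ultimately show ?thesis unfolding D_def by (simp add: complex_eq_iff algebra_simps)
  qed
  have rep: "b r * D = Z n (k * r) * W ?Zc e - cnj (Z n (k * r)) * W Z e"
    "eb r * D = euler Z n (k * r) * W ?Zc e - cnj (euler Z n (k * r)) * W Z e" if r: "r \<ge> e" for r
  proof -
    have ec: "euler ?Zc n (k * r) = cnj (euler Z n (k * r))" by (simp add: euler_def)
    show "b r * D = Z n (k * r) * W ?Zc e - cnj (Z n (k * r)) * W Z e"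
      unfolding DW[OF r, symmetric] W[OF Z r, symmetric] W[OF Zc r, symmetric] unfolding W_def by (simp add: algebra_simps)
    show "eb r * D = euler Z n (k * r) * W ?Zc e - cnj (euler Z n (k * r)) * W Z e"
      unfolding DW[OF r, symmetric] W[OF Z r, symmetric] W[OF Zc r, symmetric] unfolding W_def ec by (simp add: algebra_simps)
  qed
  obtain C where C: "\<And>s. s \<ge> 1 \<Longrightarrow> cmod (liou Z n s) \<le> C" "\<And>s. s \<ge> 1 \<Longrightarrow> cmod (dliou Z n s - \<i> * liou Z n s) \<le> C / s\<^sup>2"
    using out unfolding outgoing_at_def by blast
  have C0: "C \<ge> 0" using C(1)[of 1] norm_ge_zero[of "liou Z n 1"] by linarith
  have hb: "cmod (Z n s) \<le> C / sqrt s" "cmod (euler Z n s - \<i> * of_real s * Z n s) \<le> 2 * C / sqrt s" if s: "s \<ge> 1" for s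
  proof -
    have q: "sqrt s > 0" "sqrt s * sqrt s = s" using s by auto
    have qc: "complex_of_real (sqrt s) * of_real (sqrt s) = of_real s" using q(2) by (simp flip: of_real_mult)
    show z: "cmod (Z n s) \<le> C / sqrt s" using C(1)[OF s] q by (simp add: liou_def norm_mult field_simps)
    have "of_real (sqrt s) * (dliou Z n s - \<i> * liou Z n s)
        = (of_real (sqrt s) * of_real (sqrt s)) * (of_real ((real n + 1/2) / s) * Z n s - Z (Suc n) s - \<i> * Z n s)"
      by (simp add: liou_def dliou_def algebra_simps)
    also have "\<dots> = euler Z n s - \<i> * of_real s * Z n s + Z n s / 2"
      unfolding qc euler_def using s by (simp add: field_simps)
    finally have "euler Z n s - \<i> * of_real s * Z n s = of_real (sqrt s) * (dliou Z n s - \<i> * liou Z n s) - Z n s / 2"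
      by simp
    then have "cmod (euler Z n s - \<i> * of_real s * Z n s) \<le> sqrt s * cmod (dliou Z n s - \<i> * liou Z n s) + cmod (Z n s) / 2"
      using norm_triangle_ineq4[of "of_real (sqrt s) * (dliou Z n s - \<i> * liou Z n s)" "Z n s / 2"] q(1)
      by (simp add: norm_mult norm_divide)
    also have "\<dots> \<le> sqrt s * (C / s\<^sup>2) + C / sqrt s / 2"
      using C(2)[OF s] z q(1) by (intro add_mono mult_left_mono divide_right_mono) auto
    also have "sqrt s * (C / s\<^sup>2) \<le> C / sqrt s"
    proof -
      have "sqrt s * (C / s\<^sup>2) = C / sqrt s / s" using q s by (simp add: field_simps power2_eq_square)
      also have "\<dots> \<le> C / sqrt s / 1" using s C0 q by (intro divide_left_mono) auto
      finally show ?thesis by simp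
    qed
    also have "C / sqrt s + C / sqrt s / 2 \<le> 2 * C / sqrt s" using C0 q by (simp add: field_simps)
    finally show "cmod (euler Z n s - \<i> * of_real s * Z n s) \<le> 2 * C / sqrt s" by simp
  qed
  define B where "B = (cmod (W ?Zc e) + cmod (W Z e)) / cmod D"
  have B0: "B \<ge> 0" by (simp add: B_def)
  have bB: "cmod (b r) \<le> B * cmod (Z n (k * r))" if r: "r \<ge> e" for r
  proof -
    have "cmod (b r) * cmod D \<le> cmod (Z n (k * r)) * cmod (W ?Zc e) + cmod (Z n (k * r)) * cmod (W Z e)"
      using norm_triangle_ineq4[of "Z n (k * r) * W ?Zc e" "cnj (Z n (k * r)) * W Z e"] rep(1)[OF r]
      by (metis norm_mult complex_mod_cnj)
    then show ?thesis using D by (simp add: B_def field_simps)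
  qed
  have W0: "W Z e = 0"
  proof (rule ccontr)
    assume "W Z e \<noteq> 0"
    \<comment> \<open>Below, |W Z| is at most 2 B C^2 / (k r) + delta C / sqrt k. The choice makes
      the second summand at most half of |W Z|; the summand 1 keeps the denominator positive when C
      = 0.\<close>
    define \<delta> where "\<delta> = cmod (W Z e) / (2 * (C / sqrt k + 1))"
    have den: "C / sqrt k + 1 > 0" using C0 k by (simp add: add_nonneg_pos)
    have \<delta>: "\<delta> > 0" using \<open>W Z e \<noteq> 0\<close> den by (simp add: \<delta>_def)
    have "((\<lambda>r. (2 * B * C\<^sup>2 / k) / r ^ 1) \<longlongrightarrow> 0) at_top" by (rule decay_tendsto_0) simp
    then have "\<forall>\<^sub>F r in at_top. (2 * B * C\<^sup>2 / k) / r ^ 1 < cmod (W Z e) / 2"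
      by (rule order_tendstoD(2)) (use \<open>W Z e \<noteq> 0\<close> in simp)
    with rad[OF \<delta>] eventually_ge_at_top[of e] eventually_ge_at_top[of "1 / k"]
    have "\<forall>\<^sub>F r in (at_top :: real filter). False"
    proof eventually_elim
      case (elim r)
      have r0: "r > 0" using elim e by simp
      have s: "k * r \<ge> 1" using elim k by (simp add: field_simps)
      have sq: "sqrt (k * r) > 0" "sqrt (k * r) * sqrt (k * r) = k * r" using k r0 by auto
      have "W Z e = W Z r" by (rule W[OF Z elim(2), symmetric])
      \<comment> \<open>Adding and subtracting i k r b Z pairs each decaying function with the
        radiation residual of the other.\<close>
      also have "\<dots> = b r * (euler Z n (k * r) - \<i> * of_real (k * r) * Z n (k * r))
          - Z n (k * r) * (of_real r * (eb r / of_real r - \<i> * of_real k * b r))"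
        using r0 by (simp add: W_def field_simps)
      finally have "cmod (W Z e) \<le> cmod (b r) * cmod (euler Z n (k * r) - \<i> * of_real (k * r) * Z n (k * r))
          + cmod (Z n (k * r)) * (r * cmod (eb r / of_real r - \<i> * of_real k * b r))"
        using norm_triangle_ineq4[of "b r * (euler Z n (k * r) - \<i> * of_real (k * r) * Z n (k * r))"
            "Z n (k * r) * (of_real r * (eb r / of_real r - \<i> * of_real k * b r))"] r0
        by (simp only: norm_mult norm_of_real abs_of_pos)
      also have "\<dots> \<le> (B * (C / sqrt (k * r))) * (2 * C / sqrt (k * r)) + (C / sqrt (k * r)) * (r * (\<delta> * r powr (- 1/2)))"
        using bB[OF elim(2)] hb[OF s] elim(1) r0 B0 C0
        by (intro add_mono mult_mono order_trans[OF bB[OF elim(2)]] mult_left_mono) (use k in auto)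
      also have "(B * (C / sqrt (k * r))) * (2 * C / sqrt (k * r)) = (2 * B * C\<^sup>2 / k) / r ^ 1"
      proof -
        have "(B * (C / q)) * (2 * C / q) = 2 * B * C\<^sup>2 / (q * q)" for q by (simp add: power2_eq_square)
        from this[of "sqrt (k * r)", unfolded sq(2)] show ?thesis by (rule trans) simp
      qed
      also have "(C / sqrt (k * r)) * (r * (\<delta> * r powr (- 1/2))) = C / sqrt k * \<delta>"
      proof -
        have p: "r powr (- 1/2) = 1 / sqrt r"
          using powr_minus_divide[of r "1/2"] powr_half_sqrt[of r] r0 by simp
        have "C / (z * y) * (y * y * (\<delta> * (1 / y))) = C / z * \<delta>" if "y \<noteq> 0" for y z
          using that by simp
        from this[of "sqrt r" "sqrt k"] show ?thesis unfolding p real_sqrt_mult using r0 by simp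
      qed
      also have "C / sqrt k * \<delta> \<le> cmod (W Z e) / 2"
      proof -
        have "C / sqrt k * \<delta> \<le> (C / sqrt k + 1) * \<delta>" using \<delta> by (intro mult_right_mono) auto
        also have "\<dots> = cmod (W Z e) / 2"
        proof -
          have "d * (w / (2 * d)) = w / 2" if "d > 0" for d w :: real using that by simp
          from this[OF den] show ?thesis unfolding \<delta>_def .
        qed
        finally show ?thesis .
      qed
      finally show False using elim(4) by simp
    qed
    then show False by simp
  qed
  show ?thesis
  proof (intro exI allI impI conjI)
    fix r assume r: "e \<le> r"
    show "b r = W ?Zc e / D * Z n (k * r)" "eb r = W ?Zc e / D * euler Z n (k * r)"
      using rep[OF r] D unfolding W0 by (simp_all add: field_simps)
  qed
qed

end

subsection \<open>Fourier coefficients\<close>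

lemma cis_integral: "integral {0..2 * pi} (\<lambda>\<theta>. cis (of_int j * \<theta>)) = (if j = 0 then 2 * of_real pi else 0)"
proof (cases "j = 0")
  case False
  have d: "((\<lambda>\<theta>. cis (of_int j * \<theta>) / (\<i> * of_int j)) has_vector_derivative cis (of_int j * \<theta>)) (at \<theta> within {0..2 * pi})" for \<theta>
  proof -
    have "((\<lambda>\<theta>. cis (of_int j * \<theta>)) has_vector_derivative of_real (of_int j) * (\<i> * cis (of_int j * \<theta>))) (at \<theta>)"
      by (rule scaled_deriv[OF cis_deriv])
    then have "((\<lambda>\<theta>. cis (of_int j * \<theta>) / (\<i> * of_int j)) has_vector_derivative
        of_real (of_int j) * (\<i> * cis (of_int j * \<theta>)) / (\<i> * of_int j)) (at \<theta>)"
      by (rule has_vector_derivative_divide)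
    then show ?thesis using False by (auto intro: has_vector_derivative_at_within)
  qed
  have "((\<lambda>\<theta>. cis (of_int j * \<theta>)) has_integral
      cis (of_int j * (2 * pi)) / (\<i> * of_int j) - cis (of_int j * 0) / (\<i> * of_int j)) {0..2 * pi}"
    by (rule fundamental_theorem_of_calculus) (use d in auto)
  moreover have "cis (of_int j * (2 * pi)) = 1"
    using cis_multiple_2pi[of "of_int j"] by (simp add: mult_ac)
  ultimately show ?thesis using False by (simp add: integral_unique)
qed (simp add: scaleR_conv_of_real)

text \<open>Unconditional convergence at theta = 0 already makes the coefficients absolutely
  summable. Hence the finite partial sums approximate f uniformly on the circle, and their
  coefficients are read off by orthogonality.\<close>

lemma fourier_coeff_has_sum:
  assumes s: "\<And>\<theta>. ((\<lambda>n. T n * cis (of_int n * \<theta>)) has_sum f (rcis r \<theta>)) UNIV"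
    and c: "continuous_on {0..2 * pi} (\<lambda>\<theta>. f (rcis r \<theta>))"
  shows "fourier_coeff f r m = T m"
proof -
  have "T summable_on UNIV" using s[of 0] by (auto simp: summable_on_def)
  then have abs: "(\<lambda>n. cmod (T n)) summable_on UNIV"
    by (rule summable_on_iff_abs_summable_on_complex[THEN iffD1])
  have close: "cmod (fourier_coeff f r m - T m) \<le> \<delta>" if \<delta>: "\<delta> > 0" for \<delta>
  proof -
    have "((\<lambda>F. sum (\<lambda>n. cmod (T n)) F) \<longlongrightarrow> infsum (\<lambda>n. cmod (T n)) UNIV) (finite_subsets_at_top UNIV)"
      using abs has_sum_infsum by (auto simp: has_sum_def)
    then have "\<forall>\<^sub>F F in finite_subsets_at_top UNIV. dist (sum (\<lambda>n. cmod (T n)) F) (infsum (\<lambda>n. cmod (T n)) UNIV) < \<delta>"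
      using \<delta> by (rule tendstoD)
    then obtain F0 where F0: "finite F0"
      "\<And>F. finite F \<Longrightarrow> F0 \<subseteq> F \<Longrightarrow> dist (sum (\<lambda>n. cmod (T n)) F) (infsum (\<lambda>n. cmod (T n)) UNIV) < \<delta>"
      unfolding eventually_finite_subsets_at_top by auto
    define F where "F = insert m F0"
    have F: "finite F" "m \<in> F" using F0 by (auto simp: F_def)
    have tail: "infsum (\<lambda>n. cmod (T n)) (- F) < \<delta>"
    proof -
      have "infsum (\<lambda>n. cmod (T n)) UNIV = infsum (\<lambda>n. cmod (T n)) F + infsum (\<lambda>n. cmod (T n)) (- F)"
        using infsum_Un_disjoint[of "\<lambda>n. cmod (T n)" F "- F"] abs summable_on_subset_banach[OF abs] by simp
      then show ?thesis using F0(2)[OF F(1)] F(1) by (simp add: F_def dist_real_def subset_insertI)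
    qed
    have b: "cmod (f (rcis r \<theta>) - (\<Sum>n\<in>F. T n * cis (of_int n * \<theta>))) \<le> \<delta>" for \<theta>
    proof -
      have "((\<lambda>n. T n * cis (of_int n * \<theta>)) has_sum (f (rcis r \<theta>) - (\<Sum>n\<in>F. T n * cis (of_int n * \<theta>)))) (UNIV - F)"
        by (rule has_sum_Diff[OF s]) (use F in auto)
      then have "f (rcis r \<theta>) - (\<Sum>n\<in>F. T n * cis (of_int n * \<theta>)) = infsum (\<lambda>n. T n * cis (of_int n * \<theta>)) (UNIV - F)"
        by (rule infsumI[symmetric])
      also have "cmod \<dots> \<le> infsum (\<lambda>n. cmod (T n * cis (of_int n * \<theta>))) (UNIV - F)"
        by (rule norm_infsum_bound) (simp add: norm_mult summable_on_subset_banach[OF abs])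
      finally have "cmod (f (rcis r \<theta>) - (\<Sum>n\<in>F. T n * cis (of_int n * \<theta>))) \<le> infsum (\<lambda>n. cmod (T n)) (UNIV - F)"
        by (simp add: norm_mult)
      then show ?thesis using tail by (simp add: Compl_eq_Diff_UNIV)
    qed
    let ?S = "\<lambda>\<theta>. \<Sum>n\<in>F. T n * cis (of_int n * \<theta>)"
    have cS: "continuous_on {0..2 * pi} (\<lambda>\<theta>. ?S \<theta> * cis (- (of_int m * \<theta>)))"
      unfolding cis_conv_exp by (intro continuous_intros)
    have cf: "continuous_on {0..2 * pi} (\<lambda>\<theta>. f (rcis r \<theta>) * cis (- (of_int m * \<theta>)))"
      unfolding cis_conv_exp by (intro continuous_intros c)
    have "integral {0..2 * pi} (\<lambda>\<theta>. ?S \<theta> * cis (- (of_int m * \<theta>)))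
        = integral {0..2 * pi} (\<lambda>\<theta>. \<Sum>n\<in>F. T n * cis (of_int (n - m) * \<theta>))"
    proof (rule integral_cong)
      fix \<theta> :: real
      have "T n * cis (of_int n * \<theta>) * cis (- (of_int m * \<theta>)) = T n * cis (of_int (n - m) * \<theta>)" for n
        by (simp add: cis_mult left_diff_distrib mult.assoc)
      then show "?S \<theta> * cis (- (of_int m * \<theta>)) = (\<Sum>n\<in>F. T n * cis (of_int (n - m) * \<theta>))"
        unfolding sum_distrib_right by (intro sum.cong refl)
    qed
    also have "\<dots> = (\<Sum>n\<in>F. integral {0..2 * pi} (\<lambda>\<theta>. T n * cis (of_int (n - m) * \<theta>)))"
      by (rule integral_sum[OF F(1)]) (unfold cis_conv_exp, intro integrable_continuous_real continuous_intros)
    also have "\<dots> = (\<Sum>n\<in>F. T n * (if n = m then 2 * of_real pi else 0))"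
      using cis_integral[of "n - m" for n] by (intro sum.cong) (auto simp del: of_int_diff)
    also have "\<dots> = T m * (2 * of_real pi)" using F by (simp add: if_distrib sum.delta cong: if_cong)
    finally have "T m = 1 / (2 * pi) * integral {0..2 * pi} (\<lambda>\<theta>. ?S \<theta> * cis (- (of_int m * \<theta>)))" by simp
    then have "fourier_coeff f r m - T m = 1 / (2 * pi) *
        (integral {0..2 * pi} (\<lambda>\<theta>. f (rcis r \<theta>) * cis (- (of_int m * \<theta>))) - integral {0..2 * pi} (\<lambda>\<theta>. ?S \<theta> * cis (- (of_int m * \<theta>))))"
      by (simp add: fourier_coeff_def right_diff_distrib)
    also have "\<dots> = 1 / (2 * pi) * integral {0..2 * pi} (\<lambda>\<theta>. (f (rcis r \<theta>) - ?S \<theta>) * cis (- (of_int m * \<theta>)))"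
      unfolding left_diff_distrib by (subst integral_diff) (auto intro: integrable_continuous_real cS cf)
    finally have e: "fourier_coeff f r m - T m = 1 / (2 * pi) * integral {0..2 * pi} (\<lambda>\<theta>. (f (rcis r \<theta>) - ?S \<theta>) * cis (- (of_int m * \<theta>)))" .
    have "norm (integral {0..2 * pi} (\<lambda>\<theta>. (f (rcis r \<theta>) - ?S \<theta>) * cis (- (of_int m * \<theta>)))) \<le> \<delta> * (2 * pi - 0)"
    proof (rule integral_bound)
      show "continuous_on {0..2 * pi} (\<lambda>\<theta>. (f (rcis r \<theta>) - ?S \<theta>) * cis (- (of_int m * \<theta>)))"
        unfolding left_diff_distrib by (intro continuous_on_diff cS cf)
    qed (use b in \<open>auto simp: norm_mult\<close>)
    then show ?thesis unfolding e by (simp add: norm_mult norm_divide field_simps)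
  qed
  have "cmod (fourier_coeff f r m - T m) \<le> 0 + \<delta>" if "\<delta> > 0" for \<delta> using close[OF that] by simp
  then have "cmod (fourier_coeff f r m - T m) \<le> 0" by (rule field_le_epsilon)
  then show ?thesis by simp
qed

lemma derivative_bound_right:
  fixes B :: "real \<Rightarrow> complex"
  assumes d: "(B has_vector_derivative B') (at r)" and b: "\<And>s. s > r \<Longrightarrow> cmod (B s - B r) \<le> K * (s - r)"
  shows "cmod B' \<le> K"
proof (rule field_le_epsilon)
  fix \<delta> :: real assume \<delta>: "\<delta> > 0"
  have "(B has_derivative (\<lambda>h. h *\<^sub>R B')) (at r within {r<..})"
    using has_vector_derivative_at_within[OF d] by (simp add: has_vector_derivative_def)
  then have "\<forall>\<^sub>F s in at r within {r<..}. norm (B s - B r - (s - r) *\<^sub>R B') \<le> \<delta> * norm (s - r)"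
    using \<delta> unfolding has_derivative_within_alt2 by blast
  then have "\<forall>\<^sub>F s in at_right r. norm (B s - B r - (s - r) *\<^sub>R B') \<le> \<delta> * norm (s - r) \<and> r < s"
    using eventually_at_right_less[of r] by (rule eventually_conj)
  then obtain s where s: "norm (B s - B r - (s - r) *\<^sub>R B') \<le> \<delta> * norm (s - r)" "r < s"
    using eventually_happens'[OF trivial_limit_at_right_real] by blast
  have "norm ((s - r) *\<^sub>R B') \<le> norm (B s - B r) + norm (B s - B r - (s - r) *\<^sub>R B')"
    using norm_triangle_ineq4[of "B s - B r" "B s - B r - (s - r) *\<^sub>R B'"] by simp
  also have "\<dots> \<le> K * (s - r) + \<delta> * (s - r)" using b[OF s(2)] s by (intro add_mono) auto
  also have "norm ((s - r) *\<^sub>R B') = (s - r) * cmod B'" using s by simp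
  finally have "(s - r) * cmod B' \<le> (s - r) * (K + \<delta>)" by (simp add: algebra_simps)
  then show "cmod B' \<le> K + \<delta>" using s(2) by simp
qed

text \<open>The radiation condition controls \<open>dv\<close> for each angle separately. Rather
  than integrating \<open>dv\<close> over the circle, the increment of exp (- i k r) us between two
  radii is bounded uniformly in the angle, integrated, and divided by the distance. The phase factor
  makes dv - i k us a total derivative.\<close>

lemma outgoing_mode:
  assumes out: "outgoing k e us" and e: "e > 0"
    and c: "\<And>r. r \<ge> e \<Longrightarrow> continuous_on {0..2 * pi} (\<lambda>\<theta>. us (rcis r \<theta>))"
    and d: "\<And>r. r > e \<Longrightarrow> ((\<lambda>r. fourier_coeff us r m) has_vector_derivative b' r) (at r)" and \<delta>: "\<delta> > 0"
  shows "\<forall>\<^sub>F r in at_top. cmod (b' r - \<i> * of_real k * fourier_coeff us r m) \<le> \<delta> * r powr (- 1/2)"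
proof -
  obtain dv where dv: "\<And>r \<theta>. r > e \<Longrightarrow> ((\<lambda>s. us (rcis s \<theta>)) has_vector_derivative dv r \<theta>) (at r)"
    and ev: "\<forall>\<^sub>F r in at_top. \<forall>\<theta>. cmod (dv r \<theta> - \<i> * of_real k * us (rcis r \<theta>)) \<le> \<delta> * r powr (- 1/2)"
    using out \<delta> unfolding outgoing_def by blast
  obtain N where N: "\<And>r \<theta>. r \<ge> N \<Longrightarrow> cmod (dv r \<theta> - \<i> * of_real k * us (rcis r \<theta>)) \<le> \<delta> * r powr (- 1/2)"
    using ev unfolding eventually_at_top_linorder by blast
  have ph: "((\<lambda>s. cis (- k * s)) has_vector_derivative of_real (- k) * (\<i> * cis (- k * r))) (at r)" for r
    by (rule scaled_deriv[OF cis_deriv])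
  show ?thesis unfolding eventually_at_top_linorder
  proof (intro exI allI impI)
    fix r assume r: "max (e + 1) N \<le> r"
    then have re: "r > e" "r > 0" using e by auto
    define B where "B s = cis (- k * s) * fourier_coeff us s m" for s
    have dB: "(B has_vector_derivative cis (- k * r) * (b' r - \<i> * of_real k * fourier_coeff us r m)) (at r)"
      unfolding B_def[abs_def]
      by (rule has_vector_derivative_eq_rhs[OF has_vector_derivative_mult[OF ph d[OF re(1)]]]) (simp add: algebra_simps)
    have "cmod (cis (- k * r) * (b' r - \<i> * of_real k * fourier_coeff us r m)) \<le> \<delta> * r powr (- 1/2)"
    proof (rule derivative_bound_right[OF dB])
      fix s assume s: "s > r"
      have pt: "cmod (cis (- k * s) * us (rcis s \<theta>) - cis (- k * r) * us (rcis r \<theta>)) \<le> \<delta> * r powr (- 1/2) * (s - r)" for \<theta>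
      proof -
        have dD: "((\<lambda>s. cis (- k * s) * us (rcis s \<theta>)) has_vector_derivative
            cis (- k * t) * dv t \<theta> + of_real (- k) * (\<i> * cis (- k * t)) * us (rcis t \<theta>)) (at t)" if "t > e" for t
          by (rule has_vector_derivative_mult[OF ph dv[OF that]])
        have "norm (cis (- k * s) * us (rcis s \<theta>) - cis (- k * r) * us (rcis r \<theta>))
            \<le> \<delta> * r powr (- 1/2) * s - \<delta> * r powr (- 1/2) * r"
        proof (rule differentiable_bound_general[OF s])
          show "continuous_on {r..s} (\<lambda>s. cis (- k * s) * us (rcis s \<theta>))"
            by (intro continuous_at_imp_continuous_on ballI has_vector_derivative_continuous[OF dD]) (use re in auto)
          show "continuous_on {r..s} (\<lambda>t. \<delta> * r powr (- 1/2) * t)" by (intro continuous_intros)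
          fix t assume t: "r < t" "t < s"
          show "((\<lambda>s. cis (- k * s) * us (rcis s \<theta>)) has_vector_derivative
            cis (- k * t) * dv t \<theta> + of_real (- k) * (\<i> * cis (- k * t)) * us (rcis t \<theta>)) (at t)"
            by (rule dD) (use t re in simp)
          show "((\<lambda>t. \<delta> * r powr (- 1/2) * t) has_vector_derivative \<delta> * r powr (- 1/2)) (at t)"
            using DERIV_cmult_Id[of "\<delta> * r powr (- 1/2)" t] by (simp add: has_real_derivative_iff_has_vector_derivative)
          have "cis (- k * t) * dv t \<theta> + of_real (- k) * (\<i> * cis (- k * t)) * us (rcis t \<theta>)
              = cis (- k * t) * (dv t \<theta> - \<i> * of_real k * us (rcis t \<theta>))" by (simp add: algebra_simps)
          then have "norm (cis (- k * t) * dv t \<theta> + of_real (- k) * (\<i> * cis (- k * t)) * us (rcis t \<theta>))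
              = cmod (dv t \<theta> - \<i> * of_real k * us (rcis t \<theta>))" by (simp add: norm_mult)
          also have "\<dots> \<le> \<delta> * t powr (- 1/2)" by (rule N) (use t r in simp)
          also have "\<dots> \<le> \<delta> * r powr (- 1/2)" using t re \<delta> by (intro mult_left_mono powr_mono2') auto
          finally show "norm (cis (- k * t) * dv t \<theta> + of_real (- k) * (\<i> * cis (- k * t)) * us (rcis t \<theta>)) \<le> \<delta> * r powr (- 1/2)" .
        qed
        then show ?thesis by (simp add: algebra_simps)
      qed
      have c1: "continuous_on {0..2 * pi} (\<lambda>\<theta>. us (rcis t \<theta>) * cis (- (of_int m * \<theta>)))" if "t \<ge> e" for t
        unfolding cis_conv_exp by (intro continuous_intros c that)
      have BI: "B t = 1 / (2 * pi) * integral {0..2 * pi} (\<lambda>\<theta>. cis (- k * t) * (us (rcis t \<theta>) * cis (- (of_int m * \<theta>))))" if "t \<ge> e" for t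
        unfolding integral_mult_right by (simp add: B_def fourier_coeff_def)
      have "B s - B r = 1 / (2 * pi) * integral {0..2 * pi} (\<lambda>\<theta>.
          cis (- k * s) * (us (rcis s \<theta>) * cis (- (of_int m * \<theta>))) - cis (- k * r) * (us (rcis r \<theta>) * cis (- (of_int m * \<theta>))))"
        using BI[of s] BI[of r] s re
        by (subst integral_diff) (auto simp: right_diff_distrib intro!: integrable_continuous_real continuous_on_mult_left c1)
      moreover have "norm (integral {0..2 * pi} (\<lambda>\<theta>.
          cis (- k * s) * (us (rcis s \<theta>) * cis (- (of_int m * \<theta>))) - cis (- k * r) * (us (rcis r \<theta>) * cis (- (of_int m * \<theta>)))))
          \<le> \<delta> * r powr (- 1/2) * (s - r) * (2 * pi - 0)"
      proof (rule integral_bound)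
        show "continuous_on {0..2 * pi} (\<lambda>\<theta>. cis (- k * s) * (us (rcis s \<theta>) * cis (- (of_int m * \<theta>)))
            - cis (- k * r) * (us (rcis r \<theta>) * cis (- (of_int m * \<theta>))))"
          by (intro continuous_on_diff continuous_on_mult_left c1) (use s re in auto)
        fix \<theta> assume "\<theta> \<in> {0..2 * pi}"
        have "cis (- k * s) * (us (rcis s \<theta>) * cis (- (of_int m * \<theta>))) - cis (- k * r) * (us (rcis r \<theta>) * cis (- (of_int m * \<theta>)))
            = (cis (- k * s) * us (rcis s \<theta>) - cis (- k * r) * us (rcis r \<theta>)) * cis (- (of_int m * \<theta>))"
          by (simp only: left_diff_distrib mult.assoc)
        then show "norm (cis (- k * s) * (us (rcis s \<theta>) * cis (- (of_int m * \<theta>))) - cis (- k * r) * (us (rcis r \<theta>) * cis (- (of_int m * \<theta>))))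
            \<le> \<delta> * r powr (- 1/2) * (s - r)" using pt[of \<theta>] by (simp only: norm_mult norm_cis mult_1_right)
      qed simp
      moreover have "cmod (1 / (2 * pi) * I) \<le> 1 / (2 * pi) * X" if "norm I \<le> X" for I :: complex and X
        using that by (simp add: norm_mult norm_divide divide_right_mono)
      ultimately have "cmod (B s - B r) \<le> 1 / (2 * pi) * (\<delta> * r powr (- 1/2) * (s - r) * (2 * pi - 0))"
        by (simp only:)
      then show "cmod (B s - B r) \<le> \<delta> * r powr (- 1/2) * (s - r)" by simp
    qed
    then show "cmod (b' r - \<i> * of_real k * fourier_coeff us r m) \<le> \<delta> * r powr (- 1/2)"
      by (simp add: norm_mult)
  qed
qed

subsection \<open>Norms of the scattered field\<close>

text \<open>The mode 0 is split off by sqrt (A + B) <= sqrt A + sqrt B. For the other modes the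
  squared factor (1 + |m|)^(-1/3) shifts the exponent from sigma to sigma - 1/3.\<close>

lemma circle_norm_mode_bound:
  assumes K: "K \<ge> 0"
    and b: "\<And>m. m \<noteq> 0 \<Longrightarrow> cmod (fourier_coeff us R m)
      \<le> K * (cmod (fourier_coeff ui e m) * (1 + \<bar>real_of_int m\<bar>) powr (- 1/3))"
  shows "circle_norm \<sigma> us R \<le> ennreal (sqrt (2 * pi) * cmod (fourier_coeff us R 0))
    + ennreal K * circle_norm_star (\<sigma> - 1/3) ui e"
proof -
  define w where "w m = (cmod (fourier_coeff us R m))\<^sup>2 * (1 + \<bar>real_of_int m\<bar>) powr (2 * \<sigma>)" for m
  define v where "v m = (cmod (fourier_coeff ui e m))\<^sup>2 * (1 + \<bar>real_of_int m\<bar>) powr (2 * (\<sigma> - 1/3))" for m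
  have w0: "w m \<ge> 0" and v0: "v m \<ge> 0" for m by (simp_all add: w_def v_def)
  have wv: "w m \<le> K\<^sup>2 * v m" if "m \<noteq> 0" for m
  proof -
    let ?M = "1 + \<bar>real_of_int m\<bar>"
    have "(cmod (fourier_coeff us R m))\<^sup>2 \<le> (K * (cmod (fourier_coeff ui e m) * ?M powr (- 1/3)))\<^sup>2"
      using b[OF that] by (intro power_mono) auto
    then have "w m \<le> (K * (cmod (fourier_coeff ui e m) * ?M powr (- 1/3)))\<^sup>2 * ?M powr (2 * \<sigma>)"
      unfolding w_def by (intro mult_right_mono) auto
    also have "\<dots> = K\<^sup>2 * ((cmod (fourier_coeff ui e m))\<^sup>2 * (?M powr (2 * \<sigma>) * (?M powr (- 1/3))\<^sup>2))"
      by (simp add: power_mult_distrib)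
    also have "?M powr (2 * \<sigma>) * (?M powr (- 1/3))\<^sup>2 = ?M powr (2 * (\<sigma> - 1/3))"
      by (simp add: power2_eq_square powr_add[symmetric])
    finally show ?thesis by (simp add: v_def)
  qed
  have cn: "circle_norm \<sigma> us R = (if w summable_on UNIV then ennreal (sqrt (2 * pi) * sqrt (infsum w UNIV)) else \<infinity>)"
    unfolding circle_norm_def circle_norm_over_def Let_def w_def[abs_def] by simp
  have cs: "circle_norm_star (\<sigma> - 1/3) ui e = (if v summable_on - {0} then ennreal (sqrt (2 * pi) * sqrt (infsum v (- {0}))) else \<infinity>)"
    unfolding circle_norm_star_def circle_norm_over_def Let_def v_def[abs_def] by simp
  have main: "circle_norm \<sigma> us R \<le> ennreal (sqrt (2 * pi) * cmod (fourier_coeff us R 0)) + ennreal (K * (sqrt (2 * pi) * sqrt S))"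
    if s: "w summable_on - {0}" and S: "infsum w (- {0}) \<le> K\<^sup>2 * S" and S0: "S \<ge> 0" for S
  proof -
    have U: "insert 0 (- {0}) = (UNIV :: int set)" by auto
    have "w summable_on insert 0 (- {0})" by (rule summable_on_insert_iff[THEN iffD2, OF s])
    then have sU: "w summable_on UNIV" unfolding U .
    have "infsum w (insert 0 (- {0})) = w 0 + infsum w (- {0})" by (rule infsum_insert[OF s]) simp
    then have "infsum w UNIV = w 0 + infsum w (- {0})" unfolding U .
    also have "\<dots> \<le> (cmod (fourier_coeff us R 0))\<^sup>2 + K\<^sup>2 * S" using S by (simp add: w_def)
    finally have "sqrt (infsum w UNIV) \<le> sqrt ((cmod (fourier_coeff us R 0))\<^sup>2 + K\<^sup>2 * S)" by (rule real_sqrt_le_mono)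
    also have "\<dots> \<le> sqrt ((cmod (fourier_coeff us R 0))\<^sup>2) + sqrt (K\<^sup>2 * S)"
      by (rule sqrt_add_le_add_sqrt) (use S0 in auto)
    also have "\<dots> = cmod (fourier_coeff us R 0) + K * sqrt S" using K by (simp add: real_sqrt_mult)
    finally have "sqrt (2 * pi) * sqrt (infsum w UNIV) \<le> sqrt (2 * pi) * (cmod (fourier_coeff us R 0) + K * sqrt S)"
      by (intro mult_left_mono) auto
    then have "circle_norm \<sigma> us R \<le> ennreal (sqrt (2 * pi) * cmod (fourier_coeff us R 0) + K * (sqrt (2 * pi) * sqrt S))"
      unfolding cn using sU by (simp add: algebra_simps ennreal_leI)
    also have "\<dots> = ennreal (sqrt (2 * pi) * cmod (fourier_coeff us R 0)) + ennreal (K * (sqrt (2 * pi) * sqrt S))"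
      using K S0 by (intro ennreal_plus) auto
    finally show ?thesis .
  qed
  show ?thesis
  proof (cases "v summable_on - {0}")
    case True
    have sKv: "(\<lambda>m. K\<^sup>2 * v m) summable_on - {0}" by (intro summable_on_cmult_right True)
    have s: "w summable_on - {0}"
      by (rule summable_on_comparison_test[OF sKv]) (use wv w0 in auto)
    have "infsum w (- {0}) \<le> infsum (\<lambda>m. K\<^sup>2 * v m) (- {0})"
      by (rule infsum_mono[OF s sKv]) (use wv in auto)
    also have "\<dots> = K\<^sup>2 * infsum v (- {0})" by (rule infsum_cmult_right) (use True in simp)
    finally have "circle_norm \<sigma> us R \<le> ennreal (sqrt (2 * pi) * cmod (fourier_coeff us R 0))
        + ennreal (K * (sqrt (2 * pi) * sqrt (infsum v (- {0}))))"
      by (intro main s) (auto intro: infsum_nonneg v0)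
    then show ?thesis unfolding cs using True K by (simp add: ennreal_mult infsum_nonneg v0)
  next
    case False
    show ?thesis
    \<comment> \<open>In \<open>ennreal\<close> the product of 0 and infinity is 0, so an infinite
      incident norm does not make the claim trivial when K = 0. In that case all modes other than 0
      vanish.\<close>
    proof (cases "K = 0")
      case True
      then have z: "w m = 0" if "m \<in> - {0}" for m using wv[of m] w0[of m] that by simp
      have s: "w summable_on - {0}" by (rule summable_on_0[OF z])
      have "infsum w (- {0}) = 0" by (rule infsum_0[OF z])
      then show ?thesis using main[OF s, of 0] True by simp
    next
      case False': False
      then have "ennreal K * circle_norm_star (\<sigma> - 1/3) ui e = \<infinity>"
        unfolding cs using False K by (simp add: ennreal_mult_top)
      then show ?thesis by simp
    qed
  qed
qed

text \<open>This amounts to 1 + t <= 27 t, where 27 is the cube of 3. The constant 3 of both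
  estimates originates here.\<close>

lemma powr_third_bound:
  fixes t :: real
  assumes "t \<ge> 1"
  shows "t powr (- 1/3) \<le> 3 * (1 + t) powr (- 1/3)"
proof -
  have "(27 * t) powr (- 1/3) \<le> (1 + t) powr (- 1/3)" using assms by (intro powr_mono2') auto
  moreover have "(27 * t) powr (- 1/3) = 27 powr (- 1/3) * t powr (- 1/3)" by (rule powr_mult)
  moreover have "(27 :: real) powr (- 1/3) = 1 / 3"
  proof -
    have "(27 :: real) = 3 powr 3" by simp
    then have "(27 :: real) powr (- 1/3) = 3 powr (3 * (- 1/3))" by (simp only: powr_powr)
    then show ?thesis by (simp add: powr_minus_divide)
  qed
  ultimately have "1 / 3 * t powr (- 1/3) \<le> (1 + t) powr (- 1/3)" by (simp only:)
  then show ?thesis by linarith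
qed

section \<open>Assembly of the mode estimates for the disc\<close>

locale disc_scattering =
  fixes e om q q0 :: real and a :: "int \<Rightarrow> complex" and ui u us :: "complex \<Rightarrow> complex"
  assumes e: "e > 0" and om: "om > 0" and q: "q > 0" and q0: "q0 > 0"
    and incident: "incident_field om q0 a ui"
    and scattered: "scattering_solution e om q q0 ui u us"
begin

definition k where "k = sqrt q0 * om"
definition l where "l = sqrt (q / q0)"

lemma k: "k > 0" and l: "l > 0"
  using om q q0 by (simp_all add: k_def l_def)

lemma k2: "k\<^sup>2 = om\<^sup>2 * q0" and lk2: "(l * k)\<^sup>2 = om\<^sup>2 * q"
  using q q0 by (simp_all add: k_def l_def power_mult_distrib)

lemma cont_u: "continuous_on UNIV u" and cont_ui: "continuous_on UNIV ui"
  using scattered incident by (auto simp: scattering_solution_def incident_field_def H1_loc_solution_def)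

lemma us_eq: "cmod z \<ge> e \<Longrightarrow> us z = u z - ui z"
  using scattered by (simp add: scattering_solution_def)

lemma cont_circle: "continuous_on UNIV f \<Longrightarrow> continuous_on S (\<lambda>\<theta>. f (rcis r \<theta>))"
  by (rule continuous_on_compose2[OF _ continuous_rcis]) (auto intro!: continuous_intros)

lemma cont_us: "r \<ge> e \<Longrightarrow> continuous_on {0..2 * pi} (\<lambda>\<theta>. us (rcis r \<theta>))"
proof -
  assume "r \<ge> e"
  then have "us (rcis r \<theta>) = u (rcis r \<theta>) - ui (rcis r \<theta>)" for \<theta> using e by (intro us_eq) simp
  then show ?thesis by (simp only:) (intro continuous_on_diff cont_circle cont_u cont_ui)
qed

lemma weak_mode: "radial_weak (nat \<bar>m\<bar>) (step_coeff e ((l * k)\<^sup>2) (k\<^sup>2)) (\<lambda>r. fourier_coeff u r m)"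
proof (rule radial_weak_fourier_coeff)
  have "(\<lambda>z. om\<^sup>2 * q_disc e q q0 z) = (\<lambda>z. step_coeff e ((l * k)\<^sup>2) (k\<^sup>2) (cmod z))"
    unfolding k2 lk2 by (auto simp: q_disc_def step_coeff_def)
  then show "H1_loc_solution (\<lambda>z. step_coeff e ((l * k)\<^sup>2) (k\<^sup>2) (cmod z)) u"
    using scattered by (simp add: scattering_solution_def)
qed

text \<open>The sign in J_(-n) = (-1)^n J_n is moved into the amplitude, so that the mode m involves
  only the order |m|.\<close>

definition amp :: "int \<Rightarrow> complex" where
  "amp m = (if m \<ge> 0 then a m else (- 1) ^ nat (- m) * a m)"

lemma fourier_ui:
  assumes "r \<ge> 0"
  shows "fourier_coeff ui r m = a m * of_real (bessel_J m (k * r))"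
proof (rule fourier_coeff_has_sum)
  show "((\<lambda>n. a n * of_real (bessel_J n (k * r)) * cis (of_int n * \<theta>)) has_sum ui (rcis r \<theta>)) UNIV" for \<theta>
    using incident assms by (simp add: incident_field_def k_def)
qed (rule cont_circle[OF cont_ui])

lemma amp_J: "a m * of_real (bessel_J m x) = amp m * of_real (bessel_J_nat (nat \<bar>m\<bar>) x)"
  by (simp add: amp_def bessel_J_def)

lemma ui_0: "ui 0 = a 0"
proof -
  have h: "((\<lambda>n. a n * of_real (bessel_J n 0) * cis (of_int n * 0)) has_sum ui 0) UNIV"
  proof -
    have "\<forall>r\<ge>0. \<forall>\<theta>. ((\<lambda>n. a n * of_real (bessel_J n (sqrt q0 * om * r)) * cis (of_int n * \<theta>)) has_sum ui (rcis r \<theta>)) UNIV"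
      using incident by (simp add: incident_field_def)
    from this[rule_format, of 0 0] show ?thesis by simp
  qed
  have "((\<lambda>n. a n * of_real (bessel_J n 0) * cis (of_int n * 0)) has_sum a 0) UNIV
      \<longleftrightarrow> ((\<lambda>n. a n * of_real (bessel_J n 0) * cis (of_int n * 0)) has_sum a 0) {0}"
    by (rule has_sum_cong_neutral) (auto simp: bessel_J_def)
  moreover have "((\<lambda>n. a n * of_real (bessel_J n 0) * cis (of_int n * 0)) has_sum a 0) {0}"
    using has_sum_finite[of "{0::int}" "\<lambda>n. a n * of_real (bessel_J n 0) * cis (of_int n * 0)"] by (simp add: bessel_J_def)
  ultimately show ?thesis using has_sum_unique[OF h] by blast
qed

lemma fourier_us:
  assumes r: "r \<ge> e"
  shows "fourier_coeff us r m = fourier_coeff u r m - amp m * of_real (bessel_J_nat (nat \<bar>m\<bar>) (k * r))"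
proof -
  have us: "us (rcis r \<theta>) = u (rcis r \<theta>) - ui (rcis r \<theta>)" for \<theta> using e r by (intro us_eq) simp
  have i: "(\<lambda>\<theta>. f (rcis r \<theta>) * cis (- (of_int m * \<theta>))) integrable_on {0..2 * pi}" if "continuous_on UNIV f" for f
    unfolding cis_conv_exp by (intro integrable_continuous_real continuous_intros cont_circle that)
  have "fourier_coeff us r m = fourier_coeff u r m - fourier_coeff ui r m"
    unfolding fourier_coeff_def us left_diff_distrib
    by (subst integral_diff[OF i[OF cont_u] i[OF cont_ui]]) (simp add: right_diff_distrib)
  then show ?thesis using fourier_ui[of r m] r e by (simp add: amp_J)
qed

text \<open>The mode and its Euler derivative are continuous across r = e. The interior relation and
  the exterior representation therefore hold for the same values at e, and eliminating these gives
  the matching condition.\<close>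

lemma mode_representation:
  assumes Z: "ladder Z" and out: "outgoing_at Z (nat \<bar>m\<bar>)" and fl: "flux Z > 0"
  shows "\<exists>\<beta>. (\<forall>r\<ge>e. fourier_coeff us r m = \<beta> * Z (nat \<bar>m\<bar>) (k * r)) \<and>
    (amp m * of_real (bessel_J_nat (nat \<bar>m\<bar>) (k * e)) + \<beta> * Z (nat \<bar>m\<bar>) (k * e)) * of_real (euler_J (nat \<bar>m\<bar>) (l * (k * e)))
      = of_real (bessel_J_nat (nat \<bar>m\<bar>) (l * (k * e))) * (amp m * of_real (euler_J (nat \<bar>m\<bar>) (k * e)) + \<beta> * euler Z (nat \<bar>m\<bar>) (k * e))"
proof -
  define n where "n = nat \<bar>m\<bar>"
  define c where "c r = fourier_coeff u r m" for r
  have cc: "continuous_on {0..} c" unfolding c_def by (rule continuous_fourier_coeff[OF cont_u])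
  have w: "radial_weak n (step_coeff e ((l * k)\<^sup>2) (k\<^sup>2)) c" unfolding c_def[abs_def] n_def by (rule weak_mode)
  define ec where "ec = euler_mode n e k l c"
  define eb where "eb r = ec r - amp m * of_real (euler_J n (k * r))" for r
  have b: "fourier_coeff us r m = c r - amp m * of_real (bessel_J_nat n (k * r))" if "r \<ge> e" for r
    using fourier_us[OF that, of m] by (simp add: c_def n_def)
  have db: "((\<lambda>r. fourier_coeff us r m) has_vector_derivative eb r / of_real r) (at r)" if r: "r > e" for r
  proof -
    have r0: "r > 0" using r e by simp
    note dJ = ladder_euler_deriv[OF ladder_J k r0, of n, unfolded euler_ladder_J]
    have "((\<lambda>r. c r - amp m * of_real (bessel_J_nat n (k * r))) has_vector_derivative
        ec r / of_real r - amp m * (of_real (euler_J n (k * r)) / of_real r)) (at r)"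
      unfolding ec_def by (intro has_vector_derivative_diff has_vector_derivative_mult_right dJ mode_deriv[OF cc e k l w r0])
    then have "((\<lambda>r. fourier_coeff us r m) has_vector_derivative
        ec r / of_real r - amp m * (of_real (euler_J n (k * r)) / of_real r)) (at r)"
      by (rule has_vector_derivative_transform_within_open[where S = "{e<..}"]) (use r b in auto)
    then show ?thesis by (simp add: eb_def diff_divide_distrib)
  qed
  have out': "outgoing k e us"
    using scattered by (simp add: scattering_solution_def k_def mult.commute)
  obtain \<beta> where \<beta>: "\<And>r. r \<ge> e \<Longrightarrow> fourier_coeff us r m = \<beta> * Z n (k * r)"
    "\<And>r. r \<ge> e \<Longrightarrow> eb r = \<beta> * euler Z n (k * r)"
    using exterior_form[OF cc e k l w Z out[folded n_def] fl b, of eb] outgoing_mode[OF out' e cont_us db]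
    by (auto simp: eb_def ec_def)
  have "c e * of_real (euler_J n (l * (k * e))) = of_real (bessel_J_nat n (l * (k * e))) * ec e"
    unfolding ec_def by (rule interior_match[OF cc e k l w])
  moreover have "c e = amp m * of_real (bessel_J_nat n (k * e)) + \<beta> * Z n (k * e)"
    using b[of e] \<beta>(1)[of e] by simp
  moreover have "ec e = amp m * of_real (euler_J n (k * e)) + \<beta> * euler Z n (k * e)"
    using \<beta>(2)[of e] by (simp add: eb_def diff_eq_eq add.commute)
  ultimately show ?thesis using \<beta>(1) unfolding n_def by auto
qed

lemma ex_outgoing_system:
  "\<exists>\<tau>. Im \<tau> > 0 \<and> (1 + (cmod \<tau>)\<^sup>2) * (2 / pi)\<^sup>2 \<le> 5 / 4 * (Im \<tau>)\<^sup>2 \<and> (\<forall>n. outgoing_at (cyl 1 \<tau>) n)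
    \<and> flux (cyl 1 \<tau>) > 0"
proof -
  obtain \<tau> where "Im \<tau> > 0" "(1 + (cmod \<tau>)\<^sup>2) * (2 / pi)\<^sup>2 \<le> 5 / 4 * (Im \<tau>)\<^sup>2" "\<forall>n. outgoing_at (cyl 1 \<tau>) n"
    using ex_outgoing_cyl by blast
  moreover from this have "flux (cyl 1 \<tau>) > 0" by (simp add: flux_cyl)
  ultimately show ?thesis by blast
qed

lemma zero_mode_transparent:
  assumes "a m = 0" "R \<ge> e"
  shows "fourier_coeff us R m = 0"
proof -
  obtain \<tau> where t: "Im \<tau> > 0" "outgoing_at (cyl 1 \<tau>) (nat \<bar>m\<bar>)" "flux (cyl 1 \<tau>) > 0"
    using ex_outgoing_system by blast
  obtain \<beta> where \<beta>: "\<And>r. r \<ge> e \<Longrightarrow> fourier_coeff us r m = \<beta> * cyl 1 \<tau> (nat \<bar>m\<bar>) (k * r)"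
    and match: "(amp m * of_real (bessel_J_nat (nat \<bar>m\<bar>) (k * e)) + \<beta> * cyl 1 \<tau> (nat \<bar>m\<bar>) (k * e)) * of_real (euler_J (nat \<bar>m\<bar>) (l * (k * e)))
      = of_real (bessel_J_nat (nat \<bar>m\<bar>) (l * (k * e))) * (amp m * of_real (euler_J (nat \<bar>m\<bar>) (k * e)) + \<beta> * euler (cyl 1 \<tau>) (nat \<bar>m\<bar>) (k * e))"
    using mode_representation[OF ladder_cyl t(2,3)] by blast
  have "amp m = 0" using assms by (simp add: amp_def)
  then have "\<beta> * cyl 1 \<tau> (nat \<bar>m\<bar>) (k * e) * of_real (euler_J (nat \<bar>m\<bar>) (l * (k * e)))
      = of_real (bessel_J_nat (nat \<bar>m\<bar>) (l * (k * e))) * (\<beta> * euler (cyl 1 \<tau>) (nat \<bar>m\<bar>) (k * e))"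
    using match by simp
  then have "\<beta> = 0"
    by (intro mode_determined[of "k * e" "l * (k * e)" \<tau> \<beta> "nat \<bar>m\<bar>"]) (use k l e t in auto)
  then show ?thesis using \<beta>[OF assms(2)] by simp
qed

lemma high_mode_bound:
  assumes m: "m \<noteq> 0" and x: "k * e \<le> \<bar>real_of_int m\<bar>" and l1: "l \<le> 1" and R: "R \<ge> e"
  shows "cmod (fourier_coeff us R m) \<le> 3 * (1 - l) * (k * e) * sqrt (e / R)
    * (cmod (fourier_coeff ui e m) * (1 + \<bar>real_of_int m\<bar>) powr (- 1/3))"
proof -
  define n where "n = nat \<bar>m\<bar>"
  have nn: "n \<ge> 1" "real n = \<bar>real_of_int m\<bar>" using m by (auto simp: n_def)
  obtain \<tau> where t: "Im \<tau> > 0" "outgoing_at (cyl 1 \<tau>) n" "flux (cyl 1 \<tau>) > 0"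
    using ex_outgoing_system by blast
  interpret outgoing_wave "cyl 1 \<tau>" n
    by unfold_locales (use t nn ladder_cyl in auto)
  obtain \<beta> where \<beta>: "\<And>r. r \<ge> e \<Longrightarrow> fourier_coeff us r m = \<beta> * cyl 1 \<tau> n (k * r)"
    and match: "(amp m * of_real (bessel_J_nat n (k * e)) + \<beta> * cyl 1 \<tau> n (k * e)) * of_real (euler_J n (l * (k * e)))
      = of_real (bessel_J_nat n (l * (k * e))) * (amp m * of_real (euler_J n (k * e)) + \<beta> * euler (cyl 1 \<tau>) n (k * e))"
    using mode_representation[OF ladder_cyl t(2,3)[unfolded n_def], folded n_def] by blast
  have f: "fourier_coeff ui e m = amp m * of_real (bessel_J_nat n (k * e))"
    using fourier_ui[of e m] e by (simp add: amp_J n_def)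
  have "cmod (\<beta> * cyl 1 \<tau> n (k * R)) \<le> sqrt (k * e / (k * R)) *
      ((1 - l) * (k * e) * real n powr (- 1/3) * cmod (amp m * of_real (bessel_J_nat n (k * e))))"
    by (rule mode_bound[OF _ x[folded nn(2)] l l1 _ match]) (use k e R in auto)
  then have "cmod (fourier_coeff us R m) \<le> sqrt (e / R) * ((1 - l) * (k * e) * real n powr (- 1/3) * cmod (fourier_coeff ui e m))"
    unfolding f \<beta>[OF R] using k by simp
  also have "\<dots> \<le> sqrt (e / R) * ((1 - l) * (k * e) * (3 * (1 + real n) powr (- 1/3)) * cmod (fourier_coeff ui e m))"
    using powr_third_bound[of "real n"] nn(1) l1 k e R
    by (intro mult_left_mono mult_right_mono) auto
  finally show ?thesis unfolding nn(2) by (simp only: mult_ac)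
qed

lemma low_mode_final:
  assumes y01: "first_positive_zero (bessel_Y 0) y01" and x: "k * e < y01" and l1: "l \<le> 1" and R: "R \<ge> e"
  shows "sqrt (2 * pi) * cmod (fourier_coeff us R 0)
    \<le> (1 - l) * (k * e) * (9 * (k * e) * cmod (ui 0) * cmod (hankel1 0 (k * R)))"
proof -
  obtain \<tau> where t: "Im \<tau> > 0" "(1 + (cmod \<tau>)\<^sup>2) * (2 / pi)\<^sup>2 \<le> 5 / 4 * (Im \<tau>)\<^sup>2"
    "outgoing_at (cyl 1 \<tau>) 0" "flux (cyl 1 \<tau>) > 0"
    using ex_outgoing_system by blast
  obtain \<beta> where \<beta>: "\<And>r. r \<ge> e \<Longrightarrow> fourier_coeff us r 0 = \<beta> * cyl 1 \<tau> 0 (k * r)"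
    and match: "(a 0 * of_real (bessel_J_nat 0 (k * e)) + \<beta> * cyl 1 \<tau> 0 (k * e)) * of_real (euler_J 0 (l * (k * e)))
      = of_real (bessel_J_nat 0 (l * (k * e))) * (a 0 * of_real (euler_J 0 (k * e)) + \<beta> * euler (cyl 1 \<tau>) 0 (k * e))"
    using mode_representation[OF ladder_cyl, of 1 \<tau> 0] t(3,4) by (auto simp: amp_def)
  have x0: "0 < k * e" using k e by simp
  have 1: "cmod \<beta> * (Im \<tau> * (2 / pi)) \<le> cmod (a 0) * ((1 - l) * (k * e)\<^sup>2)"
    by (rule low_mode_bound[OF y01 x0 x l l1 t(1) match])
  have 2: "sqrt (2 * pi) * cmod (cyl 1 \<tau> 0 (k * R)) \<le> 9 * (Im \<tau> * (2 / pi)) * cmod (hankel1 0 (k * R))"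
    by (rule low_mode_const[OF t(1,2)])
  have "sqrt (2 * pi) * cmod (fourier_coeff us R 0) = cmod \<beta> * (sqrt (2 * pi) * cmod (cyl 1 \<tau> 0 (k * R)))"
    unfolding \<beta>[OF R] by (simp add: norm_mult)
  also have "\<dots> \<le> cmod \<beta> * (9 * (Im \<tau> * (2 / pi)) * cmod (hankel1 0 (k * R)))"
    using 2 by (intro mult_left_mono) auto
  also have "\<dots> = 9 * cmod (hankel1 0 (k * R)) * (cmod \<beta> * (Im \<tau> * (2 / pi)))" by simp
  also have "\<dots> \<le> 9 * cmod (hankel1 0 (k * R)) * (cmod (a 0) * ((1 - l) * (k * e)\<^sup>2))"
    using 1 by (intro mult_left_mono) auto
  also have "\<dots> = (1 - l) * (k * e) * (9 * (k * e) * cmod (ui 0) * cmod (hankel1 0 (k * R)))"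
    unfolding ui_0 by (simp add: power2_eq_square mult_ac)
  finally show ?thesis .
qed

end

theorem theorem2p1:
  fixes \<epsilon> \<omega> q q0 \<omega>\<epsilon> lam y01 \<sigma> R :: real
    and a :: "int \<Rightarrow> complex"
    and ui u us :: "complex \<Rightarrow> complex"
  assumes pos: "\<epsilon> > 0" "\<omega> > 0" "q > 0" "q0 > 0"
    and omega_eps: "\<omega>\<epsilon> = sqrt q0 * \<omega> * \<epsilon>"
    and lam: "lam = sqrt (q / q0)"
    and incident: "incident_field \<omega> q0 a ui"
    and scattered: "scattering_solution \<epsilon> \<omega> q q0 ui u us"
    and y01: "first_positive_zero (bessel_Y 0) y01"
    and R: "\<epsilon> \<le> R"
    and lam_le: "lam \<le> 1"
  shows "(\<omega>\<epsilon> < y01 \<longrightarrow>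
           circle_norm \<sigma> us R
           \<le> ennreal ((1 - lam) * \<omega>\<epsilon>) *
              (ennreal (3 * sqrt (\<epsilon> / R)) * circle_norm_star (\<sigma> - 1/3) ui \<epsilon>
               + ennreal (9 * \<omega>\<epsilon> * cmod (ui 0) * cmod (hankel1 0 (sqrt q0 * \<omega> * R))))) \<and>
         (\<forall>p::nat. p > 0 \<longrightarrow>
            (\<forall>n. \<bar>n\<bar> < int p \<longrightarrow>
               fourier_coeff ui (1 / (\<epsilon> * \<omega>)) n = 0 \<and>
               (bessel_J n (sqrt q0 * \<omega> * (1 / (\<epsilon> * \<omega>))) = 0 \<longrightarrow> a n = 0)) \<longrightarrow>
            \<omega>\<epsilon> < real p \<longrightarrow>
            circle_norm \<sigma> us R
            \<le> ennreal (3 * (1 - lam) * \<omega>\<epsilon> * sqrt (\<epsilon> / R)) * circle_norm_star (\<sigma> - 1/3) ui \<epsilon>)"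
proof -
  interpret disc_scattering \<epsilon> \<omega> q q0 a ui u us
    by unfold_locales (use pos incident scattered in auto)
  have kw: "sqrt q0 * \<omega> = k" and x: "\<omega>\<epsilon> = k * \<epsilon>" and ll: "lam = l"
    by (simp_all add: k_def l_def omega_eps lam)
  have l1: "l \<le> 1" using lam_le by (simp add: ll)
  have x0: "0 < \<omega>\<epsilon>" using k pos(1) by (simp add: x)
  have R0: "0 < R" using R pos(1) by simp
  define K where "K = 3 * (1 - l) * (k * \<epsilon>) * sqrt (\<epsilon> / R)"
  have K: "0 \<le> K" using l1 x0 R0 pos(1) by (simp add: K_def x)
  have first: "circle_norm \<sigma> us R
        \<le> ennreal ((1 - lam) * \<omega>\<epsilon>) *
          (ennreal (3 * sqrt (\<epsilon> / R)) * circle_norm_star (\<sigma> - 1/3) ui \<epsilon>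
           + ennreal (9 * \<omega>\<epsilon> * cmod (ui 0) * cmod (hankel1 0 (sqrt q0 * \<omega> * R))))"
    if y: "\<omega>\<epsilon> < y01"
  proof -
    let ?H = "9 * \<omega>\<epsilon> * cmod (ui 0) * cmod (hankel1 0 (sqrt q0 * \<omega> * R))"
    have "circle_norm \<sigma> us R \<le> ennreal (sqrt (2 * pi) * cmod (fourier_coeff us R 0))
        + ennreal K * circle_norm_star (\<sigma> - 1/3) ui \<epsilon>"
    proof (rule circle_norm_mode_bound[OF K])
      fix m :: int assume m: "m \<noteq> 0"
      \<comment> \<open>Because y01 < 1, every nonzero mode lies in the range of
        \<open>high_mode_bound\<close>.\<close>
      have "k * \<epsilon> \<le> \<bar>real_of_int m\<bar>" using y y01_less_1[OF y01] m unfolding x by linarith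
      then show "cmod (fourier_coeff us R m)
          \<le> K * (cmod (fourier_coeff ui \<epsilon> m) * (1 + \<bar>real_of_int m\<bar>) powr (- 1/3))"
        unfolding K_def by (rule high_mode_bound[OF m _ l1 R])
    qed
    also have "\<dots> \<le> ennreal ((1 - lam) * \<omega>\<epsilon> * ?H) + ennreal K * circle_norm_star (\<sigma> - 1/3) ui \<epsilon>"
      using low_mode_final[OF y01 y[unfolded x] l1 R] unfolding x kw ll
      by (intro add_right_mono ennreal_leI)
    also have "\<dots> = ennreal ((1 - lam) * \<omega>\<epsilon>) *
          (ennreal (3 * sqrt (\<epsilon> / R)) * circle_norm_star (\<sigma> - 1/3) ui \<epsilon> + ennreal ?H)"
    proof -
      have c: "0 \<le> (1 - lam) * \<omega>\<epsilon>" using lam_le x0 by simp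
      have m: "ennreal ((1 - lam) * \<omega>\<epsilon> * B) = ennreal ((1 - lam) * \<omega>\<epsilon>) * ennreal B" if "0 \<le> B" for B
        by (rule ennreal_mult[OF c that])
      have "K = (1 - lam) * \<omega>\<epsilon> * (3 * sqrt (\<epsilon> / R))" by (simp add: K_def x ll)
      then have "ennreal K = ennreal ((1 - lam) * \<omega>\<epsilon>) * ennreal (3 * sqrt (\<epsilon> / R))"
        using R0 pos(1) by (simp only:) (rule m, simp)
      moreover have "ennreal ((1 - lam) * \<omega>\<epsilon> * ?H) = ennreal ((1 - lam) * \<omega>\<epsilon>) * ennreal ?H"
        by (rule m) (use x0 in simp)
      ultimately show ?thesis by (simp only: distrib_left mult.assoc add.commute)
    qed
    finally show ?thesis .
  qed
  have second: "circle_norm \<sigma> us R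
        \<le> ennreal (3 * (1 - lam) * \<omega>\<epsilon> * sqrt (\<epsilon> / R)) * circle_norm_star (\<sigma> - 1/3) ui \<epsilon>"
    if p: "p > 0"
      and z: "\<forall>n. \<bar>n\<bar> < int p \<longrightarrow> fourier_coeff ui (1 / (\<epsilon> * \<omega>)) n = 0 \<and>
           (bessel_J n (sqrt q0 * \<omega> * (1 / (\<epsilon> * \<omega>))) = 0 \<longrightarrow> a n = 0)"
      and xp: "\<omega>\<epsilon> < real p" for p :: nat
  proof -
    have a0: "a m = 0" if "\<bar>m\<bar> < int p" for m
    proof -
      \<comment> \<open>The vanishing Fourier coefficient is this product. Where its Bessel factor
        is 0, the second half of the hypothesis supplies a m = 0.\<close>
      have "a m * of_real (bessel_J m (k * (1 / (\<epsilon> * \<omega>)))) = 0"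
        using z that fourier_ui[of "1 / (\<epsilon> * \<omega>)" m] pos by simp
      then show ?thesis using z that unfolding kw by auto
    qed
    have "circle_norm \<sigma> us R \<le> ennreal (sqrt (2 * pi) * cmod (fourier_coeff us R 0))
        + ennreal K * circle_norm_star (\<sigma> - 1/3) ui \<epsilon>"
    proof (rule circle_norm_mode_bound[OF K])
      fix m :: int assume m: "m \<noteq> 0"
      show "cmod (fourier_coeff us R m)
          \<le> K * (cmod (fourier_coeff ui \<epsilon> m) * (1 + \<bar>real_of_int m\<bar>) powr (- 1/3))"
      proof (cases "\<bar>m\<bar> < int p")
        case True
        then show ?thesis using zero_mode_transparent[OF a0 R] K by simp
      next
        case False
        \<comment> \<open>The modes that remain have |m| >= p, which exceeds the frequency
          parameter.\<close>
        then have "k * \<epsilon> \<le> \<bar>real_of_int m\<bar>" using xp unfolding x by linarith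
        then show ?thesis unfolding K_def by (rule high_mode_bound[OF m _ l1 R])
      qed
    qed
    moreover have "fourier_coeff us R 0 = 0" using zero_mode_transparent[OF a0 R] p by simp
    moreover have "K = 3 * (1 - lam) * \<omega>\<epsilon> * sqrt (\<epsilon> / R)" by (simp add: K_def x ll)
    ultimately show ?thesis by simp
  qed
  show ?thesis using first second by blast
qed

end
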